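(* Let $1\le p<n$ be integers. (1) The toric degeneration $\mathrm{Proj}(\mathrm{in}_{<_{\mathrm{ss}}}\tilde{\mathcal P})$ of the semi-infinite Grassmannian $\mathrm{Proj}\,\tilde{\mathcal P}$ is isomorphic to the toric variety $\mathrm{Proj}\,A_{\tilde Q,\varnothing}(\tilde Q,\prec)$ of the order polytope $\Pi_{\tilde Q,\varnothing}(\tilde Q,\prec)$ of the poset $(\tilde Q,\prec)$. (2) The distributive lattice $(\tilde{\mathcal I}_{\mathrm{ss}},\prec_{\mathrm{ss}})$ is isomorphic to the lattice $(\mathcal J(\tilde Q),\subset)$ of finite order ideals in $(\tilde Q,\prec)$.
   Context: Notation: $\mathbb N_0=\{0,1,2,\dots\}$, and $[a,b]$ denotes the set of integers $x$ with $a\le x\le b$. Fix integers $1\le p<n$. Semi-infinite Plücker algebra. Consider variables $z_{i,j}^{(k)}$ with $i\in[1,p]$, $j\in[1,n]$, $k\in\mathbb N_0$. Let $z_{i,j}(t)=\sum_{k\ge 0} z_{i,j}^{(k)}t^k$ and let $Z(t)$ be the $p\times n$ matrix with entries $z_{i,j}(t)$. For a $p$-tuple $I=(\alpha_1,\dots,\alpha_p)$ of integers in $[1,n]$ let $Z_I(t)$ be the $p\times p$ matrix whose $j$th column is the $\alpha_j$th column of $Z(t)$; let $D_I(t)=\det Z_I(t)$ and let $D_I^{(k)}$ be the coefficient of $t^k$ in $D_I(t)$. The semi-infinite Plücker algebra $\tilde{\mathcal P}$ is the subalgebra of $\mathbb C[\{z_{i,j}^{(k)}\}]$ generated by all $D_I^{(k)}$.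 It is $\mathbb N_0$-graded with every $D_I^{(k)}$ in degree $1$ (i.e. the degree is the total degree divided by $p$); initial subalgebras of $\tilde{\mathcal P}$ are graded in the same way. The scheme $\mathrm{Proj}\,\tilde{\mathcal P}$ is called the semi-infinite (or quantum) Grassmannian. Initial subalgebras. A monomial order on a polynomial ring is a total order on monomials such that $m_1<m_2$ implies $m_1x<m_2x$ for every variable $x$. $\mathrm{in}_<(f)$ is the $<$-maximal term of $f$ (with its coefficient), and for a subalgebra $A$, $\mathrm{in}_<A$ is the linear span of all $\mathrm{in}_<(f)$, $f\in A$. Given an enumeration (ordering) $x_1,x_2,\dots$ of the variables, the degree reverse lexicographic order is: $\prod x_i^{a_i}<\prod x_i^{b_i}$ iff $\sum a_i<\sum b_i$, or $\sum a_i=\sum b_i$ and the last non-zero entry of $a-b$ is positive. The order $<_{\mathrm{ss}}$ is the degree reverse lexicographic order on $\mathbb C[\{z_{i,j}^{(k)}\}]$ for the ordering of the $z_{i,j}^{(k)}$ first by $k$, then by $i$, then by $j$ (all increasingly). The poset. $(\tilde Q,\prec)$ consists of elements $q_{i,j}$ with integers $i\ge1$, $j\ge p+1$, $j-i\in[0,n-1]$, where $q_{i_1,j_1}\preceq q_{i_2,j_2}$ iff at least one of: (i) $i_1\le i_2$ and $j_1\le j_2$; (ii) $i_1+p\le i_2$; (iii) $j_1+n-p\le j_2$. $\mathcal J(\tilde Q)$ is the set of finite order ideals (finite down-closed subsets) of $(\tilde Q,\prec)$, ordered by inclusion. Order polytope and its toric variety. For $J\in\mathcal J(\tilde Q)$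 let $v_{\tilde Q,\varnothing}(J)\in\mathbb R^{\tilde Q}$ be the indicator vector of $J$. The order polytope $\Pi_{\tilde Q,\varnothing}(\tilde Q,\prec)$ is the convex hull of all these points. In the polynomial ring $\mathbb C[\{y_q\}_{q\in\tilde Q}][s]$, graded by degree in $s$, let $A_{\tilde Q,\varnothing}(\tilde Q,\prec)$ be the subalgebra generated by the monomials $s\prod_{q\in J}y_q$, $J\in\mathcal J(\tilde Q)$. The toric variety of the order polytope is by definition $\mathrm{Proj}\,A_{\tilde Q,\varnothing}(\tilde Q,\prec)$. The lattice. $\tilde{\mathcal I}_{\mathrm{ss}}$ is the set of all symbols $I^{(k)}$ with $I$ a (strictly) increasing $p$-tuple of integers in $[1,n]$ and $k\in\mathbb N_0$. For $I=(\alpha_1,\dots,\alpha_p)$ and $I'=(\alpha'_1,\dots,\alpha'_p)$ one sets $I^{(k)}\preceq_{\mathrm{ss}}I'^{(k')}$ iff $k\le k'$ and $\alpha_i\le\alpha'_{i'}$ for all $i,i'\in[1,p]$ with $i'-i=k'-k$; $\prec_{\mathrm{ss}}$ is the strict relation. *)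

theory Defs
  imports
    Complex_Main
    "HOL-Library.FuncSet"
    "HOL-Library.Poly_Mapping"
    "HOL-Computational_Algebra.Polynomial"
    "HOL-Computational_Algebra.Formal_Power_Series"
    "HOL-Algebra.Ideal"
    "HOL-Algebra.Lattice"
    "HOL-Algebra.QuotRing"
    "HOL-Analysis.Abstract_Topology"
    "Jordan_Normal_Form.Determinant"
begin

section \<open>Spaces with a sheaf of complex algebras\<close>

text \<open>
  A topological space with a presheaf of rings on its open sets, every ring of sections
  coming with a map from the complex numbers. For a scheme over the complex numbers this
  map is the structure morphism.
\<close>

record ('p, 's) cspace =
  topol :: "'p topology"
  sections :: "'p set \<Rightarrow> 's ring"
  restr :: "'p set \<Rightarrow> 'p set \<Rightarrow> 's \<Rightarrow> 's"  \<comment> \<open>from the first open set to the second\<close>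
  scalar :: "'p set \<Rightarrow> complex \<Rightarrow> 's"

text \<open>
  An isomorphism of ringed spaces over the complex numbers. No condition on stalks is needed:
  the maps induced on stalks are ring isomorphisms, so between locally ringed spaces (in
  particular, schemes) this is the same as an isomorphism of locally ringed spaces.
\<close>

definition cspace_isomorphic :: "('p, 's) cspace \<Rightarrow> ('q, 't) cspace \<Rightarrow> bool" where
  "cspace_isomorphic X Y \<longleftrightarrow>
    (\<exists>\<phi> \<psi>. homeomorphic_map (topol X) (topol Y) \<phi> \<and>
      (let pre = (\<lambda>V. {x \<in> topspace (topol X). \<phi> x \<in> V}) in
        (\<forall>V. openin (topol Y) V \<longrightarrow>
          \<psi> V \<in> ring_iso (sections Y V) (sections X (pre V)) \<and>
          (\<forall>c. \<psi> V (scalar Y V c) = scalar X (pre V) c)) \<and>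
        (\<forall>V W. openin (topol Y) V \<longrightarrow> openin (topol Y) W \<longrightarrow> W \<subseteq> V \<longrightarrow>
          (\<forall>s \<in> carrier (sections Y V).
            \<psi> W (restr Y V W s) = restr X (pre V) (pre W) (\<psi> V s)))))"

section \<open>Proj of a graded algebra\<close>

record 'a graded_alg = "'a ring" +
  hpart :: "nat \<Rightarrow> 'a set"
  cst :: "complex \<Rightarrow> 'a"

definition hom_elems :: "('a, 'm) graded_alg_scheme \<Rightarrow> 'a set" where
  "hom_elems R = (\<Union>d. hpart R d)"

definition homogeneous_ideal :: "('a, 'm) graded_alg_scheme \<Rightarrow> 'a set \<Rightarrow> bool" where
  "homogeneous_ideal R I \<longleftrightarrow> ideal I R \<and> I = genideal R (I \<inter> hom_elems R)"

definition irrelevant_ideal :: "('a, 'm) graded_alg_scheme \<Rightarrow> 'a set" where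
  "irrelevant_ideal R = genideal R (\<Union>d \<in> {1..}. hpart R d)"

definition proj_points :: "('a, 'm) graded_alg_scheme \<Rightarrow> 'a set set" where
  "proj_points R = {P. primeideal P R \<and> homogeneous_ideal R P \<and> \<not> irrelevant_ideal R \<subseteq> P}"

text \<open>
  The Zariski topology. Since points are homogeneous ideals, the vanishing locus of a set E
  is that of the homogeneous ideal generated by all homogeneous components of elements of E;
  hence allowing arbitrary sets E yields the usual closed sets.
\<close>

definition proj_closed :: "('a, 'm) graded_alg_scheme \<Rightarrow> 'a set \<Rightarrow> 'a set set" where
  "proj_closed R E = {P \<in> proj_points R. E \<subseteq> P}"

definition proj_open :: "('a, 'm) graded_alg_scheme \<Rightarrow> 'a set set \<Rightarrow> bool" where
  "proj_open R U \<longleftrightarrow> (\<exists>E \<subseteq> carrier R. U = proj_points R - proj_closed R E)"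

lemma istopology_proj_open: "istopology (proj_open R)"
  unfolding istopology_def
proof (intro conjI allI impI)
  fix U V assume "proj_open R U" "proj_open R V"
  then obtain E F where EF: "E \<subseteq> carrier R" "F \<subseteq> carrier R"
    "U = proj_points R - proj_closed R E" "V = proj_points R - proj_closed R F"
    unfolding proj_open_def by blast
  define G where "G = {g \<in> carrier R. \<exists>e\<in>E. \<exists>f\<in>F. g = e \<otimes>\<^bsub>R\<^esub> f}"
  have "G \<subseteq> P \<longleftrightarrow> E \<subseteq> P \<or> F \<subseteq> P" if "P \<in> proj_points R" for P
  proof -
    interpret primeideal P R
      using that by (simp add: proj_points_def)
    show ?thesis
    proof
      assume G: "G \<subseteq> P"
      show "E \<subseteq> P \<or> F \<subseteq> P"
      proof (rule ccontr)
        assume "\<not> (E \<subseteq> P \<or> F \<subseteq> P)"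
        then obtain e f where ef: "e \<in> E" "e \<notin> P" "f \<in> F" "f \<notin> P" by blast
        then have c: "e \<in> carrier R" "f \<in> carrier R" using EF by auto
        then have "e \<otimes>\<^bsub>R\<^esub> f \<in> G" unfolding G_def using ef by auto
        then show False using G I_prime[OF c] ef by blast
      qed
    next
      assume "E \<subseteq> P \<or> F \<subseteq> P"
      then show "G \<subseteq> P"
        unfolding G_def using EF I_l_closed I_r_closed by blast
    qed
  qed
  then have "U \<inter> V = proj_points R - proj_closed R G"
    unfolding EF proj_closed_def by blast
  moreover have "G \<subseteq> carrier R" unfolding G_def by blast
  ultimately show "proj_open R (U \<inter> V)" unfolding proj_open_def by blast
next
  fix K assume "\<forall>U\<in>K. proj_open R U"
  then have "\<forall>U\<in>K. \<exists>E. E \<subseteq> carrier R \<and> U = proj_points R - proj_closed R E"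
    unfolding proj_open_def by blast
  then obtain E where E: "\<forall>U\<in>K. E U \<subseteq> carrier R \<and> U = proj_points R - proj_closed R (E U)"
    by metis
  have "\<Union> K = proj_points R - proj_closed R (\<Union> (E ` K))"
  proof -
    have "P \<in> \<Union> K \<longleftrightarrow> P \<in> proj_points R \<and> (\<exists>U\<in>K. \<not> E U \<subseteq> P)" for P
      using E unfolding proj_closed_def by blast
    then show ?thesis unfolding proj_closed_def by blast
  qed
  moreover have "\<Union> (E ` K) \<subseteq> carrier R" using E by blast
  ultimately show "proj_open R (\<Union> K)" unfolding proj_open_def by blast
qed

definition proj_top :: "('a, 'm) graded_alg_scheme \<Rightarrow> 'a set topology" where
  "proj_top R = topology (proj_open R)"

lemma openin_proj_top: "openin (proj_top R) U \<longleftrightarrow> proj_open R U"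
  by (simp add: proj_top_def istopology_proj_open)

text \<open>
  The degree zero part of the localization of R at the homogeneous elements outside P.
  A fraction a/f is represented by the set of all pairs equivalent to (a, f).
\<close>

definition hfrac_pairs :: "('a, 'm) graded_alg_scheme \<Rightarrow> 'a set \<Rightarrow> ('a \<times> 'a) set" where
  "hfrac_pairs R P = {(a, f). \<exists>d. a \<in> hpart R d \<and> f \<in> hpart R d \<and> f \<notin> P}"

definition hfrac :: "('a, 'm) graded_alg_scheme \<Rightarrow> 'a set \<Rightarrow> 'a \<Rightarrow> 'a \<Rightarrow> ('a \<times> 'a) set" where
  "hfrac R P a f = {(b, g) \<in> hfrac_pairs R P.
     \<exists>h \<in> hom_elems R - P. h \<otimes>\<^bsub>R\<^esub> (a \<otimes>\<^bsub>R\<^esub> g) = h \<otimes>\<^bsub>R\<^esub> (b \<otimes>\<^bsub>R\<^esub> f)}"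

definition hfrac_add ::
  "('a, 'm) graded_alg_scheme \<Rightarrow> 'a set \<Rightarrow> ('a \<times> 'a) set \<Rightarrow> ('a \<times> 'a) set \<Rightarrow> ('a \<times> 'a) set" where
  "hfrac_add R P X Y = (\<Union>(a, f) \<in> X. \<Union>(b, g) \<in> Y.
     hfrac R P ((a \<otimes>\<^bsub>R\<^esub> g) \<oplus>\<^bsub>R\<^esub> (b \<otimes>\<^bsub>R\<^esub> f)) (f \<otimes>\<^bsub>R\<^esub> g))"

definition hfrac_mult ::
  "('a, 'm) graded_alg_scheme \<Rightarrow> 'a set \<Rightarrow> ('a \<times> 'a) set \<Rightarrow> ('a \<times> 'a) set \<Rightarrow> ('a \<times> 'a) set" where
  "hfrac_mult R P X Y = (\<Union>(a, f) \<in> X. \<Union>(b, g) \<in> Y.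
     hfrac R P (a \<otimes>\<^bsub>R\<^esub> b) (f \<otimes>\<^bsub>R\<^esub> g))"

text \<open>
  Sections of the structure sheaf: functions assigning to every P in U an element of the
  homogeneous localization at P which locally are given by a single fraction. They are
  normalized to be undefined outside U.
\<close>

definition proj_sections ::
  "('a, 'm) graded_alg_scheme \<Rightarrow> 'a set set \<Rightarrow> ('a set \<Rightarrow> ('a \<times> 'a) set) set" where
  "proj_sections R U = {s \<in> extensional U.
     \<forall>P \<in> U. \<exists>V. openin (proj_top R) V \<and> P \<in> V \<and> V \<subseteq> U \<and>
       (\<exists>d. \<exists>a \<in> hpart R d. \<exists>f \<in> hpart R d. \<forall>Q \<in> V. f \<notin> Q \<and> s Q = hfrac R Q a f)}"

definition proj_section_ring ::
  "('a, 'm) graded_alg_scheme \<Rightarrow> 'a set set \<Rightarrow> ('a set \<Rightarrow> ('a \<times> 'a) set) ring" where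
  "proj_section_ring R U =
    \<lparr>carrier = proj_sections R U,
     mult = (\<lambda>s t. \<lambda>P\<in>U. hfrac_mult R P (s P) (t P)),
     one = (\<lambda>P\<in>U. hfrac R P \<one>\<^bsub>R\<^esub> \<one>\<^bsub>R\<^esub>),
     zero = (\<lambda>P\<in>U. hfrac R P \<zero>\<^bsub>R\<^esub> \<one>\<^bsub>R\<^esub>),
     add = (\<lambda>s t. \<lambda>P\<in>U. hfrac_add R P (s P) (t P))\<rparr>"

definition Proj ::
  "('a, 'm) graded_alg_scheme \<Rightarrow> ('a set, 'a set \<Rightarrow> ('a \<times> 'a) set) cspace" where
  "Proj R =
    \<lparr>topol = proj_top R,
     sections = proj_section_ring R,
     restr = (\<lambda>U V s. restrict s V),
     scalar = (\<lambda>U c. \<lambda>P\<in>U. hfrac R P (cst R c) \<one>\<^bsub>R\<^esub>)\<rparr>"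

section \<open>Polynomials and subalgebras\<close>

type_synonym 'v monomial = "'v \<Rightarrow>\<^sub>0 nat"
type_synonym 'v cpoly = "'v monomial \<Rightarrow>\<^sub>0 complex"

definition cvar :: "'v \<Rightarrow> 'v cpoly" where
  "cvar v = Poly_Mapping.single (Poly_Mapping.single v 1) 1"

definition cconst :: "complex \<Rightarrow> 'v cpoly" where
  "cconst c = Poly_Mapping.single 0 c"

inductive_set subalg_gen :: "(complex \<Rightarrow> 'a::comm_ring_1) \<Rightarrow> 'a set \<Rightarrow> 'a set"
  for \<iota> :: "complex \<Rightarrow> 'a" and S :: "'a set" where
  scalar: "\<iota> c \<in> subalg_gen \<iota> S"
| gen: "x \<in> S \<Longrightarrow> x \<in> subalg_gen \<iota> S"
| add: "x \<in> subalg_gen \<iota> S \<Longrightarrow> y \<in> subalg_gen \<iota> S \<Longrightarrow> x + y \<in> subalg_gen \<iota> S"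
| mult: "x \<in> subalg_gen \<iota> S \<Longrightarrow> y \<in> subalg_gen \<iota> S \<Longrightarrow> x * y \<in> subalg_gen \<iota> S"

text \<open>The subalgebra with underlying set A, graded by its intersections with the sets H d.\<close>

definition graded_subalg ::
  "(complex \<Rightarrow> 'a::comm_ring_1) \<Rightarrow> (nat \<Rightarrow> 'a set) \<Rightarrow> 'a set \<Rightarrow> 'a graded_alg" where
  "graded_subalg \<iota> H A =
    \<lparr>carrier = A, mult = (*), one = 1, zero = 0, add = (+),
     hpart = (\<lambda>d. A \<inter> H d), cst = \<iota>\<rparr>"

section \<open>Initial subalgebras\<close>

definition mdeg :: "'v monomial \<Rightarrow> nat" where
  "mdeg m = (\<Sum>v \<in> Poly_Mapping.keys m. Poly_Mapping.lookup m v)"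

definition homogeneous_polys :: "nat \<Rightarrow> 'v cpoly set" where
  "homogeneous_polys d = {f. \<forall>m \<in> Poly_Mapping.keys f. mdeg m = d}"

definition initial_term :: "('v monomial \<Rightarrow> 'v monomial \<Rightarrow> bool) \<Rightarrow> 'v cpoly \<Rightarrow> 'v cpoly" where
  "initial_term mless f =
    (let m = (THE m. m \<in> Poly_Mapping.keys f \<and>
                (\<forall>m' \<in> Poly_Mapping.keys f. m' \<noteq> m \<longrightarrow> mless m' m))
     in Poly_Mapping.single m (Poly_Mapping.lookup f m))"

definition initial_space ::
  "('v monomial \<Rightarrow> 'v monomial \<Rightarrow> bool) \<Rightarrow> 'v cpoly set \<Rightarrow> 'v cpoly set" where
  "initial_space mless A =
    module.span (\<lambda>c f. cconst c * f) {initial_term mless f |f. f \<in> A \<and> f \<noteq> 0}"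

text \<open>
  The variable order is given as a strict order. Monomials of the same degree are compared
  at the last variable where their exponents differ; the larger exponent there makes the
  monomial smaller.
\<close>

definition degrevlex ::
  "('v \<Rightarrow> 'v \<Rightarrow> bool) \<Rightarrow> 'v monomial \<Rightarrow> 'v monomial \<Rightarrow> bool" where
  "degrevlex vless a b \<longleftrightarrow>
    mdeg a < mdeg b \<or>
    mdeg a = mdeg b \<and>
      (\<exists>v. Poly_Mapping.lookup b v < Poly_Mapping.lookup a v \<and>
           (\<forall>w. vless v w \<longrightarrow> Poly_Mapping.lookup a w = Poly_Mapping.lookup b w))"

section \<open>The semi-infinite Pluecker algebra\<close>

text \<open>The triple (i, j, k) is the index of the variable $z_{i,j}^{(k)}$.\<close>

type_synonym zvar = "nat \<times> nat \<times> nat"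

definition z_series :: "nat \<Rightarrow> nat \<Rightarrow> zvar cpoly fps" where
  "z_series i j = Abs_fps (\<lambda>k. cvar (i, j, k))"

text \<open>
  Matrix and list indices in the library start from 0, whence the shift of the row index by 1;
  the entries of the tuple I are the actual column numbers.
\<close>

definition D_series :: "nat \<Rightarrow> nat list \<Rightarrow> zvar cpoly fps" where
  "D_series p I = det (mat p p (\<lambda>(i, j). z_series (i + 1) (I ! j)))"

definition D_coeff :: "nat \<Rightarrow> nat list \<Rightarrow> nat \<Rightarrow> zvar cpoly" where
  "D_coeff p I k = fps_nth (D_series p I) k"

text \<open>All D's have total degree p; the grading is by total degree divided by p.\<close>

definition plucker_alg :: "nat \<Rightarrow> nat \<Rightarrow> zvar cpoly graded_alg" where
  "plucker_alg p n =
    graded_subalg cconst (\<lambda>d. homogeneous_polys (p * d))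
      (subalg_gen cconst {D_coeff p I k |I k. length I = p \<and> set I \<subseteq> {1..n}})"

fun zvar_less :: "zvar \<Rightarrow> zvar \<Rightarrow> bool" where
  "zvar_less (i, j, k) (i', j', k') \<longleftrightarrow>
    k < k' \<or> k = k' \<and> (i < i' \<or> i = i' \<and> j < j')"

definition ss_less :: "zvar monomial \<Rightarrow> zvar monomial \<Rightarrow> bool" where
  "ss_less = degrevlex zvar_less"

definition initial_plucker_alg :: "nat \<Rightarrow> nat \<Rightarrow> zvar cpoly graded_alg" where
  "initial_plucker_alg p n =
    graded_subalg cconst (\<lambda>d. homogeneous_polys (p * d))
      (initial_space ss_less (carrier (plucker_alg p n)))"

section \<open>The poset and its order polytope algebra\<close>

text \<open>The pair (i, j) stands for $q_{i,j}$; the condition $j - i \in [0, n-1]$ is written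
  without subtraction.\<close>

definition Q_set :: "nat \<Rightarrow> nat \<Rightarrow> (nat \<times> nat) set" where
  "Q_set p n = {(i, j). 1 \<le> i \<and> p + 1 \<le> j \<and> i \<le> j \<and> j < i + n}"

fun Q_le :: "nat \<Rightarrow> nat \<Rightarrow> nat \<times> nat \<Rightarrow> nat \<times> nat \<Rightarrow> bool" where
  "Q_le p n (i1, j1) (i2, j2) \<longleftrightarrow>
    (i1 \<le> i2 \<and> j1 \<le> j2) \<or> i1 + p \<le> i2 \<or> j1 + (n - p) \<le> j2"

definition finite_ideals :: "nat \<Rightarrow> nat \<Rightarrow> (nat \<times> nat) set set" where
  "finite_ideals p n = {J. finite J \<and> J \<subseteq> Q_set p n \<and>
     (\<forall>x \<in> J. \<forall>y \<in> Q_set p n. Q_le p n y x \<longrightarrow> y \<in> J)}"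

text \<open>
  The univariate polynomial variable plays the role of s, so the ambient ring is
  $\mathbb{C}[\{y_q\}][s]$ graded by the degree in s.
\<close>

definition order_polytope_alg :: "nat \<Rightarrow> nat \<Rightarrow> (nat \<times> nat) cpoly poly graded_alg" where
  "order_polytope_alg p n =
    graded_subalg (\<lambda>c. [:cconst c:]) (\<lambda>d. {Polynomial.monom f d |f. True})
      (subalg_gen (\<lambda>c. [:cconst c:])
        {Polynomial.monom (\<Prod>q\<in>J. cvar q) 1 |J. J \<in> finite_ideals p n})"

section \<open>The two lattices\<close>

definition ideal_lattice :: "nat \<Rightarrow> nat \<Rightarrow> (nat \<times> nat) set gorder" where
  "ideal_lattice p n = \<lparr>carrier = finite_ideals p n, eq = (=), le = (\<subseteq>)\<rparr>"

definition ss_index_set :: "nat \<Rightarrow> nat \<Rightarrow> (nat list \<times> nat) set" where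
  "ss_index_set p n =
    {(I, k). length I = p \<and> sorted_wrt (<) I \<and> set I \<subseteq> {1..n}}"

text \<open>The condition $i' - i = k' - k$ is written without subtraction and is invariant under
  the shift to list indices starting from 0.\<close>

fun ss_le :: "nat \<Rightarrow> nat list \<times> nat \<Rightarrow> nat list \<times> nat \<Rightarrow> bool" where
  "ss_le p (I, k) (I', k') \<longleftrightarrow>
    k \<le> k' \<and> (\<forall>i<p. \<forall>i'<p. i' + k = i + k' \<longrightarrow> I ! i \<le> I' ! i')"

definition ss_lattice :: "nat \<Rightarrow> nat \<Rightarrow> (nat list \<times> nat) gorder" where
  "ss_lattice p n = \<lparr>carrier = ss_index_set p n, eq = (=), le = ss_le p\<rparr>"

definition distributive_lattice :: "('a, 'm) gorder_scheme \<Rightarrow> bool" where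
  "distributive_lattice L \<longleftrightarrow> lattice L \<and>
    (\<forall>x \<in> carrier L. \<forall>y \<in> carrier L. \<forall>z \<in> carrier L.
       x \<sqinter>\<^bsub>L\<^esub> (y \<squnion>\<^bsub>L\<^esub> z) = (x \<sqinter>\<^bsub>L\<^esub> y) \<squnion>\<^bsub>L\<^esub> (x \<sqinter>\<^bsub>L\<^esub> z))"

definition lattice_isomorphic :: "('a, 'm) gorder_scheme \<Rightarrow> ('b, 'k) gorder_scheme \<Rightarrow> bool" where
  "lattice_isomorphic L M \<longleftrightarrow>
    (\<exists>f. bij_betw f (carrier L) (carrier M) \<and>
      (\<forall>x \<in> carrier L. \<forall>y \<in> carrier L.
         (x \<sqsubseteq>\<^bsub>L\<^esub> y \<longleftrightarrow> f x \<sqsubseteq>\<^bsub>M\<^esub> f y) \<and>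
         f (x \<squnion>\<^bsub>L\<^esub> y) = f x \<squnion>\<^bsub>M\<^esub> f y \<and>
         f (x \<sqinter>\<^bsub>L\<^esub> y) = f x \<sqinter>\<^bsub>M\<^esub> f y))"

end

theory Submission
  imports Defs
    "HOL-Algebra.RingHom"
begin

text \<open>
  The products of the $D_I^{(k)}$ along multichains of the lattice span the Pluecker algebra. To
  straighten $D_I^{(k)} D_{I'}^{(k+d)}$ for incomparable factors, one antisymmetrizes
  $D_I(t) D_{I'}(t)$ over p + d + 1 columns, after applying the Euler operator t d/dt at most d
  times to the first factor: this operator changes at most d of the p rows, so the result vanishes
  by antisymmetry. Hence the coefficient sums with k, ..., k + d in the first factor are
  combinations of those with exponents further apart.

  The leading monomial of $D_I^{(k)}$ is the antidiagonal of a minor on p consecutive rows. A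
  monomial substitution takes it to s times the product over the order ideal that corresponds to
  $I^{(k)}$, and a multichain of ideals is determined by the multiplicities of its members'
  elements. So the leading monomials of the multichain products are distinct, the initial
  subalgebra is spanned by the products of the leading monomials of the generators, and the
  substitution maps it isomorphically onto the algebra of the order polytope. Finally, an
  isomorphism of graded algebras induces one of their Proj.
\<close>

section \<open>Functoriality of Proj\<close>

text \<open>Comparing coefficients of t^N in one antisymmetrized product gives a single relation
  among all splittings of N into a and N - a. For superscripts k and k + d there are d + 1
  splittings in the window from k to k + d, all but one of which have to be eliminated. The powers
  0, ..., d of the Euler operator supply the d + 1 relations: they weight the splitting a by 1, a,
  ..., a^d, and Lagrange interpolation isolates a = k. The price is d altered rows. It is paid by
  the length p + d + 1 of the antisymmetrized stretch: its positions fill that many of the 2p places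
  of the two factors, so at least d + 1 of the p rows have both places in the stretch, and one of
  these rows is unaltered. A violated inequality between entries whose positions differ by d singles
  out exactly this many columns.

  No presentation by generators and relations enters. A spanning family with distinct leading
  monomials controls the leading monomial of every element, so arbitrary products of leading
  monomials can be compared through the Pluecker algebra itself.\<close>

locale graded_ring_iso =
  fixes R :: "('a, 'm) graded_alg_scheme" and S :: "('b, 'k) graded_alg_scheme" and h :: "'a \<Rightarrow> 'b"
  assumes cring_dom: "cring R" and cring_cod: "cring S"
    and bij: "bij_betw h (carrier R) (carrier S)"
    and hom_add: "\<And>x y. x \<in> carrier R \<Longrightarrow> y \<in> carrier R \<Longrightarrow> h (x \<oplus>\<^bsub>R\<^esub> y) = h x \<oplus>\<^bsub>S\<^esub> h y"
    and hom_mult: "\<And>x y. x \<in> carrier R \<Longrightarrow> y \<in> carrier R \<Longrightarrow> h (x \<otimes>\<^bsub>R\<^esub> y) = h x \<otimes>\<^bsub>S\<^esub> h y"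
    and hom_one: "h \<one>\<^bsub>R\<^esub> = \<one>\<^bsub>S\<^esub>"
    and hpart_closed: "\<And>d. hpart R d \<subseteq> carrier R"
    and hpart_image: "\<And>d. h ` hpart R d = hpart S d"
    and cst_closed: "\<And>c. cst R c \<in> carrier R"
    and cst_image: "\<And>c. h (cst R c) = cst S c"
begin

abbreviation g where "g \<equiv> inv_into (carrier R) h"

lemma inj: "inj_on h (carrier R)" and surj: "h ` carrier R = carrier S"
  using bij by (auto simp: bij_betw_def)

lemma closed [simp]: "x \<in> carrier R \<Longrightarrow> h x \<in> carrier S"
  using surj by blast

lemma g_closed: "y \<in> carrier S \<Longrightarrow> g y \<in> carrier R"
  using surj by (metis inv_into_into)

lemma g_h [simp]: "x \<in> carrier R \<Longrightarrow> g (h x) = x"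
  using inj by simp

lemma h_g [simp]: "y \<in> carrier S \<Longrightarrow> h (g y) = y"
  using surj by (simp add: f_inv_into_f)

lemma g_image_h_image [simp]: "X \<subseteq> carrier R \<Longrightarrow> g ` h ` X = X"
  using inj by (simp add: inv_into_image_cancel)

lemma h_image_g_image [simp]: "Y \<subseteq> carrier S \<Longrightarrow> h ` g ` Y = Y"
  using surj by (metis image_inv_into_cancel)

text \<open>The assumptions are symmetric in the two algebras. Image lemmas therefore also serve for
  the inverse map, which supplies the reverse inclusions.\<close>

lemma inverse: "graded_ring_iso S R g"
proof (rule graded_ring_iso.intro)
  interpret R: cring R by (rule cring_dom)
  interpret S: cring S by (rule cring_cod)
  show "cring S" by (rule cring_cod)
  show "cring R" by (rule cring_dom)
  show "bij_betw g (carrier S) (carrier R)" using bij by (rule bij_betw_inv_into)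
  show "g (x \<oplus>\<^bsub>S\<^esub> y) = g x \<oplus>\<^bsub>R\<^esub> g y" if "x \<in> carrier S" "y \<in> carrier S" for x y
    using g_h[OF R.a_closed[OF g_closed[OF that(1)] g_closed[OF that(2)]]] that
    by (simp add: hom_add g_closed)
  show "g (x \<otimes>\<^bsub>S\<^esub> y) = g x \<otimes>\<^bsub>R\<^esub> g y" if "x \<in> carrier S" "y \<in> carrier S" for x y
    using g_h[OF R.m_closed[OF g_closed[OF that(1)] g_closed[OF that(2)]]] that
    by (simp add: hom_mult g_closed)
  show "g \<one>\<^bsub>S\<^esub> = \<one>\<^bsub>R\<^esub>" using g_h[OF R.one_closed] by (simp add: hom_one)
  show "hpart S d \<subseteq> carrier S" for d using image_mono[OF hpart_closed, of h d] by (simp add: hpart_image surj)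
  show "g ` hpart S d = hpart R d" for d using g_image_h_image[OF hpart_closed] by (simp add: hpart_image)
  show "cst S c \<in> carrier S" for c using closed[OF cst_closed] by (simp add: cst_image)
  show "g (cst S c) = cst R c" for c using g_h[OF cst_closed] by (simp add: cst_image)
qed

section \<open>Ideals and points of Proj under a graded isomorphism\<close>

lemma ideal_image:
  assumes "ideal I R"
  shows "ideal (h ` I) S"
proof -
  interpret R: cring R by (rule cring_dom)
  interpret S: cring S by (rule cring_cod)
  interpret ideal I R by (rule assms)
  interpret rh: ring_hom_ring R S h
    by (rule ring_hom_ringI) (auto simp: R.ring_axioms S.ring_axioms hom_mult hom_add hom_one)
  show ?thesis
  proof (rule idealI)
    show "ring S" by (rule S.ring_axioms)
    show "subgroup (h ` I) (add_monoid S)"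
      by (rule group_hom.subgroup_img_is_subgroup[OF rh.a_group_hom a_subgroup])
    fix y x assume "y \<in> h ` I" "x \<in> carrier S"
    then obtain a b where "y = h a" "a \<in> I" "x = h b" "b \<in> carrier R" using surj by blast
    then have "x \<otimes>\<^bsub>S\<^esub> y = h (b \<otimes>\<^bsub>R\<^esub> a)" "y \<otimes>\<^bsub>S\<^esub> x = h (a \<otimes>\<^bsub>R\<^esub> b)"
      "b \<otimes>\<^bsub>R\<^esub> a \<in> I" "a \<otimes>\<^bsub>R\<^esub> b \<in> I"
      using I_l_closed I_r_closed a_subset by (auto simp: hom_mult)
    then show "x \<otimes>\<^bsub>S\<^esub> y \<in> h ` I" "y \<otimes>\<^bsub>S\<^esub> x \<in> h ` I" by simp_all
  qed
qed

lemma ideal_subset: "ideal I R \<Longrightarrow> I \<subseteq> carrier R"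
  by (rule additive_subgroup.a_subset[OF ideal.axioms(1)])

text \<open>Minimality of generated ideals on both sides; in R it is applied to the image under
  \<open>g\<close> of the ideal generated in S.\<close>

lemma genideal_image:
  assumes "X \<subseteq> carrier R"
  shows "h ` genideal R X = genideal S (h ` X)"
proof -
  interpret i: graded_ring_iso S R g by (rule inverse)
  interpret R: cring R by (rule cring_dom)
  interpret S: cring S by (rule cring_cod)
  have XS: "h ` X \<subseteq> carrier S" using assms by auto
  show ?thesis
  proof
    have "genideal R X \<subseteq> g ` genideal S (h ` X)"
    proof (rule R.genideal_minimal)
      show "ideal (g ` genideal S (h ` X)) R"
        by (rule i.ideal_image[OF S.genideal_ideal[OF XS]])
      show "X \<subseteq> g ` genideal S (h ` X)"
        using image_mono[OF S.genideal_self[OF XS], of g] assms by simp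
    qed
    then have "h ` genideal R X \<subseteq> h ` g ` genideal S (h ` X)" by (rule image_mono)
    then show "h ` genideal R X \<subseteq> genideal S (h ` X)"
      using i.ideal_subset[OF S.genideal_ideal[OF XS]] by simp
    show "genideal S (h ` X) \<subseteq> h ` genideal R X"
      by (rule S.genideal_minimal[OF ideal_image[OF R.genideal_ideal[OF assms]]
            image_mono[OF R.genideal_self[OF assms]]])
  qed
qed

lemma mem_image_iff: "x \<in> carrier R \<Longrightarrow> X \<subseteq> carrier R \<Longrightarrow> h x \<in> h ` X \<longleftrightarrow> x \<in> X"
  using inj by (simp add: inj_on_image_mem_iff)

lemma subset_image_iff: "X \<subseteq> carrier R \<Longrightarrow> Y \<subseteq> carrier R \<Longrightarrow> h ` X \<subseteq> h ` Y \<longleftrightarrow> X \<subseteq> Y"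
  using image_mono[of "h ` X" "h ` Y" g] image_mono[of X Y h] by auto

lemma primeideal_image:
  assumes "primeideal P R"
  shows "primeideal (h ` P) S"
proof -
  interpret R: cring R by (rule cring_dom)
  interpret primeideal P R by (rule assms)
  have P: "P \<subseteq> carrier R" by (rule ideal_subset[OF ideal_axioms])
  show ?thesis
  proof (rule primeidealI)
    show "ideal (h ` P) S" by (rule ideal_image[OF ideal_axioms])
    show "cring S" by (rule cring_cod)
    show "carrier S \<noteq> h ` P"
      using I_notcarr inj_on_image_eq_iff[OF inj subset_refl P] surj by auto
    fix a b assume "a \<in> carrier S" "b \<in> carrier S" and ab: "a \<otimes>\<^bsub>S\<^esub> b \<in> h ` P"
    then obtain a' b' where ab': "a = h a'" "a' \<in> carrier R" "b = h b'" "b' \<in> carrier R"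
      using surj by blast
    then have "a' \<otimes>\<^bsub>R\<^esub> b' \<in> P"
      using ab P mem_image_iff[OF R.m_closed[OF ab'(2,4)] P] by (simp add: hom_mult)
    then show "a \<in> h ` P \<or> b \<in> h ` P" using ab' I_prime by blast
  qed
qed

lemma hom_elems_subset: "hom_elems R \<subseteq> carrier R"
  using hpart_closed by (auto simp: hom_elems_def)

lemma hom_elems_image: "h ` hom_elems R = hom_elems S"
  by (simp add: hom_elems_def image_UN hpart_image)

lemma homogeneous_ideal_image:
  assumes "homogeneous_ideal R P"
  shows "homogeneous_ideal S (h ` P)"
proof -
  have P: "ideal P R" "P = genideal R (P \<inter> hom_elems R)"
    using assms by (auto simp: homogeneous_ideal_def)
  then have "P \<subseteq> carrier R" by (simp add: ideal_subset)
  then have "h ` (P \<inter> hom_elems R) = h ` P \<inter> hom_elems S"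
    using inj hom_elems_subset hom_elems_image by (metis inj_on_image_Int)
  then have "h ` P = genideal S (h ` P \<inter> hom_elems S)"
    using P genideal_image[of "P \<inter> hom_elems R"] hom_elems_subset by auto
  then show ?thesis using P ideal_image by (auto simp: homogeneous_ideal_def)
qed

lemma irrelevant_ideal_image: "h ` irrelevant_ideal R = irrelevant_ideal S"
  unfolding irrelevant_ideal_def
  using hpart_closed by (subst genideal_image) (auto simp: image_UN hpart_image)

lemma irrelevant_ideal_subset: "irrelevant_ideal R \<subseteq> carrier R"
proof -
  interpret R: cring R by (rule cring_dom)
  have "(\<Union>d\<in>{1..}. hpart R d) \<subseteq> carrier R" using hpart_closed by blast
  then show ?thesis unfolding irrelevant_ideal_def by (rule ideal_subset[OF R.genideal_ideal])
qed

lemma proj_points_subset: "P \<in> proj_points R \<Longrightarrow> P \<subseteq> carrier R"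
  by (simp add: proj_points_def homogeneous_ideal_def ideal_subset)

lemma proj_points_image:
  assumes "P \<in> proj_points R"
  shows "h ` P \<in> proj_points S"
proof -
  have "h ` irrelevant_ideal R \<subseteq> h ` P \<longleftrightarrow> irrelevant_ideal R \<subseteq> P"
    by (rule subset_image_iff[OF irrelevant_ideal_subset proj_points_subset[OF assms]])
  then show ?thesis
    using assms primeideal_image homogeneous_ideal_image irrelevant_ideal_image
    by (auto simp: proj_points_def)
qed

lemma proj_points_image_eq: "(`) h ` proj_points R = proj_points S"
proof
  interpret i: graded_ring_iso S R g by (rule inverse)
  show "(`) h ` proj_points R \<subseteq> proj_points S" using proj_points_image by blast
  show "proj_points S \<subseteq> (`) h ` proj_points R"
  proof
    fix Q assume "Q \<in> proj_points S"
    then have "Q = h ` g ` Q" "g ` Q \<in> proj_points R"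
      using i.proj_points_image i.proj_points_subset by auto
    then show "Q \<in> (`) h ` proj_points R" by blast
  qed
qed

lemma inj_on_proj_points: "inj_on ((`) h) (proj_points R)"
  using proj_points_subset inj by (meson inj_onI inj_on_image_eq_iff)

text \<open>Since \<open>h\<close> preserves and reflects inclusions between subsets of the carrier,
  it matches the vanishing locus of E with that of the image of E.\<close>

lemma proj_open_image:
  assumes "proj_open R U"
  shows "proj_open S ((`) h ` U)"
proof -
  obtain E where E: "E \<subseteq> carrier R" "U = proj_points R - proj_closed R E"
    using assms by (auto simp: proj_open_def)
  have "(`) h ` proj_closed R E = proj_closed S (h ` E)"
    unfolding proj_closed_def proj_points_image_eq[symmetric]
    using E(1) subset_image_iff[OF E(1) proj_points_subset] by blast
  then have "(`) h ` U = proj_points S - proj_closed S (h ` E)"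
    unfolding E(2) proj_points_image_eq[symmetric]
    by (subst inj_on_image_set_diff[OF inj_on_proj_points])
      (auto simp: proj_closed_def)
  moreover have "h ` E \<subseteq> carrier S" using E by auto
  ultimately show ?thesis by (auto simp: proj_open_def)
qed

lemma openin_image: "openin (proj_top R) U \<Longrightarrow> openin (proj_top S) ((`) h ` U)"
  by (simp add: openin_proj_top proj_open_image)

lemma openin_subset: "openin (proj_top R) U \<Longrightarrow> U \<subseteq> proj_points R"
  by (auto simp: openin_proj_top proj_open_def)

text \<open>The set of all points is open, being the complement of the locus where 1 vanishes; this
  locus is empty because prime ideals are proper.\<close>

lemma topspace_proj_top: "topspace (proj_top R) = proj_points R"
proof -
  interpret R: cring R by (rule cring_dom)
  have "proj_closed R {\<one>\<^bsub>R\<^esub>} = {}"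
    using ideal.one_imp_carrier primeideal.axioms(1) primeideal.I_notcarr
    by (fastforce simp: proj_closed_def proj_points_def)
  then have "openin (proj_top R) (proj_points R)"
    unfolding openin_proj_top proj_open_def by (intro exI[of _ "{\<one>\<^bsub>R\<^esub>}"]) auto
  then show ?thesis using openin_subset unfolding topspace_def by blast
qed

section \<open>Homogeneous fractions\<close>

abbreviation H where "H \<equiv> (`) (map_prod h h)"

lemma hfrac_pairs_subset: "hfrac_pairs R P \<subseteq> carrier R \<times> carrier R"
  using hpart_closed by (auto simp: hfrac_pairs_def)

lemma hfrac_subset: "hfrac R P a f \<subseteq> carrier R \<times> carrier R"
  using hfrac_pairs_subset by (auto simp: hfrac_def)

lemma hfrac_pairs_image:
  assumes "P \<subseteq> carrier R"
  shows "H (hfrac_pairs R P) = hfrac_pairs S (h ` P)"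
proof (intro equalityI subsetI)
  fix z assume "z \<in> H (hfrac_pairs R P)"
  then obtain a f d where z: "z = (h a, h f)" "a \<in> hpart R d" "f \<in> hpart R d" "f \<notin> P"
    by (auto simp: hfrac_pairs_def)
  then have "h f \<notin> h ` P" using mem_image_iff[OF _ assms, of f] hpart_closed by auto
  moreover have "h a \<in> hpart S d" "h f \<in> hpart S d" using z hpart_image[of d] by auto
  ultimately show "z \<in> hfrac_pairs S (h ` P)" unfolding hfrac_pairs_def z(1) by blast
next
  fix z assume "z \<in> hfrac_pairs S (h ` P)"
  then obtain b g d where z: "z = (b, g)" "b \<in> hpart S d" "g \<in> hpart S d" "g \<notin> h ` P"
    by (auto simp: hfrac_pairs_def)
  then obtain a f where "b = h a" "a \<in> hpart R d" "g = h f" "f \<in> hpart R d"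
    using hpart_image by blast
  then show "z \<in> H (hfrac_pairs R P)" using z
    by (intro image_eqI[of _ _ "(a, f)"]) (auto simp: hfrac_pairs_def)
qed

text \<open>A fraction is a whole class of pairs, so it is transported by taking the image of the
  class. By injectivity of \<open>h\<close> the defining equation holds for a pair exactly when it
  holds for its image, and the multipliers outside the prime correspond as well.\<close>

lemma hfrac_image:
  assumes P: "P \<subseteq> carrier R" and a: "a \<in> carrier R" and f: "f \<in> carrier R"
  shows "H (hfrac R P a f) = hfrac S (h ` P) (h a) (h f)"
proof -
  interpret R: cring R by (rule cring_dom)
  have outside: "hom_elems S - h ` P = h ` (hom_elems R - P)"
    unfolding hom_elems_image[symmetric]
    using hom_elems_subset P by (subst inj_on_image_set_diff[OF inj]) auto
  have eq: "h k \<otimes>\<^bsub>S\<^esub> (h a \<otimes>\<^bsub>S\<^esub> h y) = h k \<otimes>\<^bsub>S\<^esub> (h x \<otimes>\<^bsub>S\<^esub> h f) \<longleftrightarrow>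
      k \<otimes>\<^bsub>R\<^esub> (a \<otimes>\<^bsub>R\<^esub> y) = k \<otimes>\<^bsub>R\<^esub> (x \<otimes>\<^bsub>R\<^esub> f)"
    if "k \<in> carrier R" "x \<in> carrier R" "y \<in> carrier R" for k x y
  proof -
    have "h (k \<otimes>\<^bsub>R\<^esub> (a \<otimes>\<^bsub>R\<^esub> y)) = h k \<otimes>\<^bsub>S\<^esub> (h a \<otimes>\<^bsub>S\<^esub> h y)"
      "h (k \<otimes>\<^bsub>R\<^esub> (x \<otimes>\<^bsub>R\<^esub> f)) = h k \<otimes>\<^bsub>S\<^esub> (h x \<otimes>\<^bsub>S\<^esub> h f)"
      using that a f by (simp_all add: hom_mult)
    then show ?thesis
      using inj_on_eq_iff[OF inj, of "k \<otimes>\<^bsub>R\<^esub> (a \<otimes>\<^bsub>R\<^esub> y)" "k \<otimes>\<^bsub>R\<^esub> (x \<otimes>\<^bsub>R\<^esub> f)"] that a f by simp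
  qed
  have *: "(h x, h y) \<in> hfrac S (h ` P) (h a) (h f) \<longleftrightarrow> (x, y) \<in> hfrac R P a f"
    if xy: "(x, y) \<in> hfrac_pairs R P" for x y
  proof -
    have c: "x \<in> carrier R" "y \<in> carrier R" using xy hfrac_pairs_subset by auto
    have "(h x, h y) \<in> hfrac_pairs S (h ` P)"
      unfolding hfrac_pairs_image[OF P, symmetric] using xy by (intro image_eqI[of _ _ "(x, y)"]) auto
    then have "(h x, h y) \<in> hfrac S (h ` P) (h a) (h f) \<longleftrightarrow> (\<exists>k\<in>hom_elems R - P.
        h k \<otimes>\<^bsub>S\<^esub> (h a \<otimes>\<^bsub>S\<^esub> h y) = h k \<otimes>\<^bsub>S\<^esub> (h x \<otimes>\<^bsub>S\<^esub> h f))"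
      by (simp add: hfrac_def outside)
    also have "\<dots> \<longleftrightarrow> (\<exists>k\<in>hom_elems R - P. k \<otimes>\<^bsub>R\<^esub> (a \<otimes>\<^bsub>R\<^esub> y) = k \<otimes>\<^bsub>R\<^esub> (x \<otimes>\<^bsub>R\<^esub> f))"
      using eq[OF _ c] hom_elems_subset by (intro bex_cong) auto
    also have "\<dots> \<longleftrightarrow> (x, y) \<in> hfrac R P a f" using xy by (simp add: hfrac_def)
    finally show ?thesis .
  qed
  show ?thesis
  proof (intro equalityI subsetI)
    fix z assume "z \<in> H (hfrac R P a f)"
    then obtain x y where z: "z = (h x, h y)" "(x, y) \<in> hfrac R P a f" by auto
    moreover have "(x, y) \<in> hfrac_pairs R P" using z by (simp add: hfrac_def)
    ultimately show "z \<in> hfrac S (h ` P) (h a) (h f)" using * by simp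
  next
    fix z assume z: "z \<in> hfrac S (h ` P) (h a) (h f)"
    then have "z \<in> H (hfrac_pairs R P)" unfolding hfrac_pairs_image[OF P] by (auto simp: hfrac_def)
    then obtain x y where xy: "z = (h x, h y)" "(x, y) \<in> hfrac_pairs R P" by auto
    then show "z \<in> H (hfrac R P a f)"
      using * z by (intro image_eqI[of _ _ "(x, y)"]) auto
  qed
qed

lemma hfrac_mult_image:
  assumes "P \<subseteq> carrier R" "X \<subseteq> carrier R \<times> carrier R" "Y \<subseteq> carrier R \<times> carrier R"
  shows "H (hfrac_mult R P X Y) = hfrac_mult S (h ` P) (H X) (H Y)"
proof -
  interpret R: cring R by (rule cring_dom)
  have *: "H (hfrac R P (fst z \<otimes>\<^bsub>R\<^esub> fst w) (snd z \<otimes>\<^bsub>R\<^esub> snd w)) =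
      hfrac S (h ` P) (h (fst z) \<otimes>\<^bsub>S\<^esub> h (fst w)) (h (snd z) \<otimes>\<^bsub>S\<^esub> h (snd w))"
    if "z \<in> X" "w \<in> Y" for z w
  proof -
    have "fst z \<in> carrier R" "snd z \<in> carrier R" "fst w \<in> carrier R" "snd w \<in> carrier R"
      using that assms by auto
    then show ?thesis using assms(1) by (simp add: hfrac_image hom_mult hom_add)
  qed
  have "H (hfrac_mult R P X Y) = (\<Union>z\<in>X. \<Union>w\<in>Y. H (hfrac R P
      (fst z \<otimes>\<^bsub>R\<^esub> fst w) (snd z \<otimes>\<^bsub>R\<^esub> snd w)))"
    by (simp add: hfrac_mult_def image_UN case_prod_unfold)
  also have "\<dots> = (\<Union>z\<in>X. \<Union>w\<in>Y. hfrac S (h ` P)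
      (h (fst z) \<otimes>\<^bsub>S\<^esub> h (fst w)) (h (snd z) \<otimes>\<^bsub>S\<^esub> h (snd w)))"
    by (intro SUP_cong refl *)
  also have "\<dots> = hfrac_mult S (h ` P) (H X) (H Y)"
    by (simp add: hfrac_mult_def case_prod_unfold)
  finally show ?thesis .
qed

lemma hfrac_add_image:
  assumes "P \<subseteq> carrier R" "X \<subseteq> carrier R \<times> carrier R" "Y \<subseteq> carrier R \<times> carrier R"
  shows "H (hfrac_add R P X Y) = hfrac_add S (h ` P) (H X) (H Y)"
proof -
  interpret R: cring R by (rule cring_dom)
  have *: "H (hfrac R P ((fst z \<otimes>\<^bsub>R\<^esub> snd w) \<oplus>\<^bsub>R\<^esub> (fst w \<otimes>\<^bsub>R\<^esub> snd z)) (snd z \<otimes>\<^bsub>R\<^esub> snd w)) =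
      hfrac S (h ` P) ((h (fst z) \<otimes>\<^bsub>S\<^esub> h (snd w)) \<oplus>\<^bsub>S\<^esub> (h (fst w) \<otimes>\<^bsub>S\<^esub> h (snd z))) (h (snd z) \<otimes>\<^bsub>S\<^esub> h (snd w))"
    if "z \<in> X" "w \<in> Y" for z w
  proof -
    have "fst z \<in> carrier R" "snd z \<in> carrier R" "fst w \<in> carrier R" "snd w \<in> carrier R"
      using that assms by auto
    then show ?thesis using assms(1) by (simp add: hfrac_image hom_mult hom_add)
  qed
  have "H (hfrac_add R P X Y) = (\<Union>z\<in>X. \<Union>w\<in>Y. H (hfrac R P
      ((fst z \<otimes>\<^bsub>R\<^esub> snd w) \<oplus>\<^bsub>R\<^esub> (fst w \<otimes>\<^bsub>R\<^esub> snd z)) (snd z \<otimes>\<^bsub>R\<^esub> snd w)))"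
    by (simp add: hfrac_add_def image_UN case_prod_unfold)
  also have "\<dots> = (\<Union>z\<in>X. \<Union>w\<in>Y. hfrac S (h ` P)
      ((h (fst z) \<otimes>\<^bsub>S\<^esub> h (snd w)) \<oplus>\<^bsub>S\<^esub> (h (fst w) \<otimes>\<^bsub>S\<^esub> h (snd z))) (h (snd z) \<otimes>\<^bsub>S\<^esub> h (snd w)))"
    by (intro SUP_cong refl *)
  also have "\<dots> = hfrac_add S (h ` P) (H X) (H Y)"
    by (simp add: hfrac_add_def case_prod_unfold)
  finally show ?thesis .
qed

section \<open>Sections of the structure sheaf\<close>

definition sec_map where
  "sec_map U s = (\<lambda>Q \<in> (`) h ` U. H (s (g ` Q)))"

lemma sec_map_apply:
  assumes "U \<subseteq> proj_points R" "P \<in> U"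
  shows "sec_map U s (h ` P) = H (s P)"
proof -
  have "g ` h ` P = P" using assms proj_points_subset by (intro g_image_h_image) blast
  then show ?thesis using assms(2) by (simp add: sec_map_def del: g_image_h_image)
qed

lemma image_image_inverse:
  assumes "U \<subseteq> proj_points R"
  shows "(`) g ` (`) h ` U = U"
proof -
  have "g ` h ` P = P" if "P \<in> U" for P
    using that assms proj_points_subset by (intro g_image_h_image) blast
  then have "(\<lambda>P. g ` h ` P) ` U = (\<lambda>P. P) ` U" by (intro image_cong refl)
  then show ?thesis by (simp only: image_image image_ident)
qed

lemma section_subset:
  assumes "s \<in> proj_sections R U" "P \<in> U"
  shows "s P \<subseteq> carrier R \<times> carrier R"
proof -
  obtain V d a f where "P \<in> V" "\<forall>Q\<in>V. f \<notin> Q \<and> s Q = hfrac R Q a f"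
    using assms unfolding proj_sections_def by blast
  then have "s P = hfrac R P a f" by blast
  then show ?thesis using hfrac_subset by simp
qed

text \<open>A fraction a / f that represents the section near P is carried by \<open>h\<close> to
  one that represents the new section near the image of P.\<close>

lemma sec_map_closed:
  assumes U: "U \<subseteq> proj_points R" and s: "s \<in> proj_sections R U"
  shows "sec_map U s \<in> proj_sections S ((`) h ` U)"
  unfolding proj_sections_def
proof (intro CollectI conjI ballI)
  show "sec_map U s \<in> extensional ((`) h ` U)" by (simp add: sec_map_def)
  fix Q assume "Q \<in> (`) h ` U"
  then obtain P where P: "P \<in> U" "Q = h ` P" by blast
  then obtain V d a f where V: "openin (proj_top R) V" "P \<in> V" "V \<subseteq> U" "a \<in> hpart R d" "f \<in> hpart R d"
    "\<forall>Q\<in>V. f \<notin> Q \<and> s Q = hfrac R Q a f"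
    using s unfolding proj_sections_def by blast
  have c: "a \<in> carrier R" "f \<in> carrier R" using V hpart_closed by auto
  have "h f \<notin> h ` P' \<and> sec_map U s (h ` P') = hfrac S (h ` P') (h a) (h f)" if "P' \<in> V" for P'
  proof -
    have P': "P' \<in> U" using that V by blast
    then have sub: "P' \<subseteq> carrier R" using U proj_points_subset by blast
    have "f \<notin> P'" "s P' = hfrac R P' a f" using V(6) that by auto
    then show ?thesis
      by (simp only: sec_map_apply[OF U P'] hfrac_image[OF sub c] mem_image_iff[OF c(2) sub]) simp
  qed
  moreover have "h a \<in> hpart S d" "h f \<in> hpart S d" using V hpart_image[of d] by auto
  ultimately show "\<exists>V. openin (proj_top S) V \<and> Q \<in> V \<and> V \<subseteq> (`) h ` U \<and>
      (\<exists>d. \<exists>a\<in>hpart S d. \<exists>f\<in>hpart S d. \<forall>Q\<in>V. f \<notin> Q \<and> sec_map U s Q = hfrac S Q a f)"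
    using V(2,3) P(2) openin_image[OF V(1)] by (intro exI[of _ "(`) h ` V"]) blast
qed

lemma sec_map_inverse:
  assumes U: "U \<subseteq> proj_points R" and s: "s \<in> proj_sections R U"
  shows "graded_ring_iso.sec_map S g ((`) h ` U) (sec_map U s) = s"
proof
  interpret i: graded_ring_iso S R g by (rule inverse)
  fix P
  have US: "(`) h ` U \<subseteq> proj_points S" using image_mono[OF U, of "(`) h"] by (simp only: proj_points_image_eq)
  note gU = image_image_inverse[OF U]
  show "i.sec_map ((`) h ` U) (sec_map U s) P = s P"
  proof (cases "P \<in> U")
    case True
    then have P: "P \<subseteq> carrier R" using U proj_points_subset by blast
    have "i.sec_map ((`) h ` U) (sec_map U s) (g ` h ` P) = map_prod g g ` sec_map U s (h ` P)"
      using True by (intro i.sec_map_apply[OF US]) blast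
    also have "\<dots> = map_prod g g ` H (s P)" by (simp add: sec_map_apply[OF U True])
    also have "\<dots> = s P"
    proof -
      have "(map_prod g g \<circ> map_prod h h) z = z" if "z \<in> s P" for z
        using section_subset[OF s True] that by (cases z) auto
      then have "(map_prod g g \<circ> map_prod h h) ` s P = (\<lambda>z. z) ` s P" by (intro image_cong refl)
      then show ?thesis by (simp only: image_comp image_ident)
    qed
    finally show ?thesis by (simp only: g_image_h_image[OF P])
  next
    case False
    \<comment> \<open>Outside U both sides are \<open>undefined\<close>; this is where the
      normalization of sections enters.\<close>
    have "s \<in> extensional U" using s by (simp add: proj_sections_def)
    then have "s P = undefined" using False by (rule extensional_arb)
    moreover have "i.sec_map ((`) h ` U) (sec_map U s) P = undefined"
      using False unfolding i.sec_map_def gU by (simp add: restrict_def)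
    ultimately show ?thesis by (simp only:)
  qed
qed

lemma sec_map_iso:
  assumes "openin (proj_top R) U"
  shows "sec_map U \<in> ring_iso (proj_section_ring R U) (proj_section_ring S ((`) h ` U))"
proof (rule ring_iso_memI)
  interpret R: cring R by (rule cring_dom)
  have U: "U \<subseteq> proj_points R" by (rule openin_subset[OF assms])
  have sub: "P \<subseteq> carrier R" if "P \<in> U" for P using that U proj_points_subset by blast
  have app: "sec_map U s (h ` P) = H (s P)" if "P \<in> U" for s P
    by (rule sec_map_apply[OF U that])
  have eqI: "sec_map U s = (\<lambda>Q \<in> (`) h ` U. F Q)" if "\<And>P. P \<in> U \<Longrightarrow> H (s P) = F (h ` P)" for s F
  proof
    fix Q show "sec_map U s Q = (\<lambda>Q \<in> (`) h ` U. F Q) Q"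
    proof (cases "Q \<in> (`) h ` U")
      case True
      then obtain P where P: "P \<in> U" "Q = h ` P" by blast
      then show ?thesis using that[OF P(1)] app[OF P(1)] by auto
    qed (simp add: sec_map_def)
  qed
  fix s assume "s \<in> carrier (proj_section_ring R U)"
  then have s: "s \<in> proj_sections R U" by (simp add: proj_section_ring_def)
  then show "sec_map U s \<in> carrier (proj_section_ring S ((`) h ` U))"
    using sec_map_closed[OF U] by (simp add: proj_section_ring_def)
  fix t assume "t \<in> carrier (proj_section_ring R U)"
  then have t: "t \<in> proj_sections R U" by (simp add: proj_section_ring_def)
  show "sec_map U (s \<otimes>\<^bsub>proj_section_ring R U\<^esub> t) =
      sec_map U s \<otimes>\<^bsub>proj_section_ring S ((`) h ` U)\<^esub> sec_map U t"
    unfolding proj_section_ring_def monoid.simps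
    by (rule eqI) (simp add: app hfrac_mult_image[OF sub section_subset[OF s] section_subset[OF t]])
  show "sec_map U (s \<oplus>\<^bsub>proj_section_ring R U\<^esub> t) =
      sec_map U s \<oplus>\<^bsub>proj_section_ring S ((`) h ` U)\<^esub> sec_map U t"
    unfolding proj_section_ring_def ring.simps
    by (rule eqI) (simp add: app hfrac_add_image[OF sub section_subset[OF s] section_subset[OF t]])
next
  interpret R: cring R by (rule cring_dom)
  interpret i: graded_ring_iso S R g by (rule inverse)
  have U: "U \<subseteq> proj_points R" by (rule openin_subset[OF assms])
  have US: "(`) h ` U \<subseteq> proj_points S" using image_mono[OF U, of "(`) h"] by (simp only: proj_points_image_eq)
  note gU = image_image_inverse[OF U]
  have sub: "P \<subseteq> carrier R" if "P \<in> U" for P using that U proj_points_subset by blast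
  show "sec_map U \<one>\<^bsub>proj_section_ring R U\<^esub> = \<one>\<^bsub>proj_section_ring S ((`) h ` U)\<^esub>"
  proof
    fix Q
    show "sec_map U \<one>\<^bsub>proj_section_ring R U\<^esub> Q = \<one>\<^bsub>proj_section_ring S ((`) h ` U)\<^esub> Q"
    proof (cases "Q \<in> (`) h ` U")
      case True
      then obtain P where P: "P \<in> U" "Q = h ` P" by blast
      then show ?thesis using True hfrac_image[OF sub[OF P(1)] R.one_closed R.one_closed]
        by (simp add: proj_section_ring_def sec_map_apply[OF U P(1)] hom_one)
    qed (simp add: sec_map_def proj_section_ring_def)
  qed
  have "bij_betw (sec_map U) (proj_sections R U) (proj_sections S ((`) h ` U))"
  proof (rule bij_betw_byWitness[where f' = "i.sec_map ((`) h ` U)"])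
    show "\<forall>s\<in>proj_sections R U. i.sec_map ((`) h ` U) (sec_map U s) = s"
      using sec_map_inverse[OF U] by blast
    show "sec_map U ` proj_sections R U \<subseteq> proj_sections S ((`) h ` U)"
      using sec_map_closed[OF U] by blast
    show "i.sec_map ((`) h ` U) ` proj_sections S ((`) h ` U) \<subseteq> proj_sections R U"
      using i.sec_map_closed[OF US] unfolding gU by blast
    show "\<forall>t\<in>proj_sections S ((`) h ` U). sec_map U (i.sec_map ((`) h ` U) t) = t"
    proof (intro ballI ext)
      fix t Q assume t: "t \<in> proj_sections S ((`) h ` U)"
      show "sec_map U (i.sec_map ((`) h ` U) t) Q = t Q"
      proof (cases "Q \<in> (`) h ` U")
        case True
        then obtain P where P: "P \<in> U" "Q = h ` P" by blast
        have "i.sec_map ((`) h ` U) t (g ` Q) = map_prod g g ` t Q"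
          by (rule i.sec_map_apply[OF US True])
        then have "sec_map U (i.sec_map ((`) h ` U) t) Q = H (map_prod g g ` t Q)"
          by (simp only: P(2) sec_map_apply[OF U P(1)] g_image_h_image[OF sub[OF P(1)]])
        also have "\<dots> = t Q"
        proof -
          have "(map_prod h h \<circ> map_prod g g) z = z" if "z \<in> t Q" for z
            using i.section_subset[OF t True] that by (cases z) auto
          then have "(map_prod h h \<circ> map_prod g g) ` t Q = (\<lambda>z. z) ` t Q" by (intro image_cong refl)
          then show ?thesis by (simp only: image_comp image_ident)
        qed
        finally show ?thesis .
      next
        case False
        have "t \<in> extensional ((`) h ` U)" using t by (simp add: proj_sections_def)
        then have "t Q = undefined" using False by (rule extensional_arb)
        then show ?thesis using False by (simp add: sec_map_def restrict_def)
      qed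
    qed
  qed
  then show "bij_betw (sec_map U) (carrier (proj_section_ring R U))
      (carrier (proj_section_ring S ((`) h ` U)))"
    by (simp add: proj_section_ring_def)
qed

text \<open>The points are mapped by \<open>g\<close>, from Proj S to Proj R, because the comparison
  of sections runs the other way: the preimage of V under this map consists of the images of the
  points of V under \<open>h\<close>, which is exactly where \<open>sec_map\<close> lands.\<close>

theorem cspace_isomorphic_Proj: "cspace_isomorphic (Proj S) (Proj R)"
proof -
  interpret i: graded_ring_iso S R g by (rule inverse)
  interpret R: cring R by (rule cring_dom)
  have tops: "topspace (topol (Proj S)) = proj_points S" "topspace (topol (Proj R)) = proj_points R"
    by (simp_all add: Proj_def topspace_proj_top i.topspace_proj_top)
  have gh: "g ` h ` P = P" if "P \<in> proj_points R" for P
    by (rule g_image_h_image[OF proj_points_subset[OF that]])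
  have hg: "h ` g ` Q = Q" if "Q \<in> proj_points S" for Q
    by (rule h_image_g_image[OF i.proj_points_subset[OF that]])
  have pre: "{Q \<in> proj_points S. g ` Q \<in> V} = (`) h ` V" if "V \<subseteq> proj_points R" for V
  proof (intro equalityI subsetI)
    fix Q assume "Q \<in> {Q \<in> proj_points S. g ` Q \<in> V}"
    then show "Q \<in> (`) h ` V" using hg[of Q] by (intro image_eqI[of _ _ "g ` Q"]) auto
  next
    fix Q assume "Q \<in> (`) h ` V"
    then obtain P where "P \<in> V" "Q = h ` P" by blast
    then show "Q \<in> {Q \<in> proj_points S. g ` Q \<in> V}"
      using gh[OF subsetD[OF that]] proj_points_image[OF subsetD[OF that]] by simp
  qed
  have homeo: "homeomorphic_map (proj_top S) (proj_top R) ((`) g)"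
  proof (rule bijective_open_imp_homeomorphic_map)
    show "continuous_map (proj_top S) (proj_top R) ((`) g)"
      unfolding continuous_map_def topspace_proj_top i.topspace_proj_top
      by (simp add: Pi_iff i.proj_points_image pre[OF openin_subset] openin_image)
    show "open_map (proj_top S) (proj_top R) ((`) g)"
      using i.openin_image by (simp add: open_map_def)
    show "(`) g ` topspace (proj_top S) = topspace (proj_top R)"
      by (simp add: topspace_proj_top i.topspace_proj_top i.proj_points_image_eq)
    show "inj_on ((`) g) (topspace (proj_top S))"
      by (simp add: i.topspace_proj_top i.inj_on_proj_points)
  qed
  have scal: "sec_map V (scalar (Proj R) V c) = scalar (Proj S) ((`) h ` V) c"
    if V: "V \<subseteq> proj_points R" for V c
  proof
    fix Q show "sec_map V (scalar (Proj R) V c) Q = scalar (Proj S) ((`) h ` V) c Q"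
    proof (cases "Q \<in> (`) h ` V")
      case True
      then obtain P where P: "P \<in> V" "Q = h ` P" by blast
      then have "P \<subseteq> carrier R" using V proj_points_subset by blast
      then have "H (hfrac R P (cst R c) \<one>\<^bsub>R\<^esub>) = hfrac S (h ` P) (cst S c) \<one>\<^bsub>S\<^esub>"
        by (simp add: hfrac_image cst_closed hom_one cst_image)
      then show ?thesis using P True by (simp add: Proj_def sec_map_apply[OF V P(1)])
    qed (simp add: sec_map_def Proj_def)
  qed
  have res: "sec_map W (restrict s W) = restrict (sec_map V s) ((`) h ` W)"
    if W: "W \<subseteq> V" and V: "V \<subseteq> proj_points R" for V W s
  proof
    fix Q show "sec_map W (restrict s W) Q = restrict (sec_map V s) ((`) h ` W) Q"
    proof (cases "Q \<in> (`) h ` W")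
      case True
      then obtain P where P: "P \<in> W" "Q = h ` P" by blast
      have "P \<in> V" using P W by blast
      then show ?thesis using P True W V
        by (simp add: sec_map_apply[OF V] sec_map_apply[of W P] subset_trans[OF W V])
    qed (simp add: sec_map_def)
  qed
  show ?thesis
    unfolding cspace_isomorphic_def Let_def tops
  proof (rule exI[of _ "(`) g"], rule exI[of _ sec_map], intro conjI allI impI ballI)
    show "homeomorphic_map (topol (Proj S)) (topol (Proj R)) ((`) g)"
      using homeo by (simp add: Proj_def)
    fix V assume "openin (topol (Proj R)) V"
    then have V: "openin (proj_top R) V" by (simp add: Proj_def)
    note VP = openin_subset[OF V]
    show "sec_map V \<in> ring_iso (sections (Proj R) V) (sections (Proj S) {Q \<in> proj_points S. g ` Q \<in> V})"
      using sec_map_iso[OF V] pre[OF VP] by (simp add: Proj_def)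
    show "sec_map V (scalar (Proj R) V c) = scalar (Proj S) {Q \<in> proj_points S. g ` Q \<in> V} c" for c
      using scal[OF VP] pre[OF VP] by simp
    fix W s assume "W \<subseteq> V"
    then show "sec_map W (restr (Proj R) V W s) = restr (Proj S) {Q \<in> proj_points S. g ` Q \<in> V}
        {Q \<in> proj_points S. g ` Q \<in> W} (sec_map V s)"
      using res[OF _ VP] pre[OF VP] pre[of W] VP by (simp add: Proj_def)
  qed
qed

end


section \<open>Straightening of products of minors\<close>

lemma cconst_add: "cconst (a + b) = cconst a + cconst b"
  by (simp add: cconst_def single_add)

lemma cconst_mult: "cconst (a * b) = cconst a * cconst b"
  by (simp add: cconst_def mult_single)

lemma cconst_0 [simp]: "cconst 0 = 0"
  by (simp add: cconst_def)

lemma cconst_1 [simp]: "cconst 1 = 1"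
  by (simp add: cconst_def single_one)

lemma cconst_minus: "cconst (- a) = - cconst a"
  by (simp add: cconst_def single_uminus)

lemma cconst_sum: "cconst (sum f A) = (\<Sum>x\<in>A. cconst (f x))"
  by (induction A rule: infinite_finite_induct) (simp_all add: cconst_add)

lemma cconst_of_nat: "cconst (of_nat n) = of_nat n"
  by (induction n) (simp_all add: cconst_add)

lemma cconst_power: "cconst (a ^ n) = cconst a ^ n"
  by (induction n) (simp_all add: cconst_mult)

text \<open>The scalar multiplication has the form used in \<open>initial_space\<close>, so that
  \<open>cp.span\<close> is the span in that definition.\<close>

interpretation cp: Modules.module "\<lambda>c f. cconst c * f"
  by unfold_locales (simp_all add: algebra_simps cconst_add cconst_mult)

text \<open>Sign-reversing substitutions end in f = -f; over the complex numbers this forces f =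
  0.\<close>

lemma cpoly_add_self_eq_0:
  fixes f :: "'v cpoly"
  assumes "f + f = 0"
  shows "f = 0"
proof (rule poly_mapping_eqI)
  fix m
  have "Poly_Mapping.lookup f m + Poly_Mapping.lookup f m = 0"
    unfolding lookup_add[symmetric] assms by simp
  then show "Poly_Mapping.lookup f m = Poly_Mapping.lookup 0 m" by simp
qed

lemma cpoly_fps_add_self_eq_0:
  fixes f :: "'v cpoly fps"
  assumes "f + f = 0"
  shows "f = 0"
proof (rule fps_ext)
  fix k
  have "fps_nth f k + fps_nth f k = 0" unfolding fps_add_nth[symmetric] assms by simp
  then have "fps_nth f k = 0" by (rule cpoly_add_self_eq_0)
  then show "fps_nth f k = fps_nth 0 k" by simp
qed

text \<open>The Leibniz formula with the selection of columns as a function argument: permuting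
  columns becomes composition, and the matrix M can be changed row by row.\<close>

definition minor :: "nat \<Rightarrow> (nat \<Rightarrow> nat \<Rightarrow> 'a) \<Rightarrow> (nat \<Rightarrow> nat) \<Rightarrow> 'a::comm_ring_1" where
  "minor p M c = (\<Sum>\<sigma> | \<sigma> permutes {0..<p}. signof \<sigma> * (\<Prod>i = 0..<p. M i (c (\<sigma> i))))"

lemma D_series_eq_minor: "D_series p I = minor p (\<lambda>i. z_series (i + 1)) (\<lambda>j. I ! j)"
  unfolding D_series_def minor_def
proof (subst det_def'[where n = p], simp, intro sum.cong refl arg_cong2[where f = "(*)"] prod.cong)
  fix \<sigma> i assume "\<sigma> \<in> {\<sigma>. \<sigma> permutes {0..<p}}" "i \<in> {0..<p}"
  then have "\<sigma> i < p" "i < p" using permutes_in_image[of \<sigma> "{0..<p}" i] by auto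
  then show "mat p p (\<lambda>(i, j). z_series (i + 1) (I ! j)) $$ (i, \<sigma> i) = z_series (i + 1) (I ! \<sigma> i)"
    by simp
qed

lemma minor_permute:
  assumes "\<rho> permutes {0..<p}"
  shows "minor p M (\<lambda>j. c (\<rho> j)) = signof \<rho> * minor p M c"
proof -
  have "minor p M c = (\<Sum>\<sigma> | \<sigma> permutes {0..<p}. signof (\<rho> \<circ> \<sigma>) * (\<Prod>i = 0..<p. M i (c ((\<rho> \<circ> \<sigma>) i))))"
    unfolding minor_def by (rule setum_permutations_compose_left[OF assms])
  also have "\<dots> = signof \<rho> * minor p M (\<lambda>j. c (\<rho> j))"
    unfolding minor_def sum_distrib_left
  proof (rule sum.cong[OF refl])
    fix \<sigma> assume "\<sigma> \<in> {\<sigma>. \<sigma> permutes {0..<p}}"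
    then have "\<sigma> permutes {0..<p}" by simp
    then have "signof (\<rho> \<circ> \<sigma>) = (signof \<rho> * signof \<sigma> :: 'a)"
      by (rule signof_compose[OF assms])
    then show "signof (\<rho> \<circ> \<sigma>) * (\<Prod>i = 0..<p. M i (c ((\<rho> \<circ> \<sigma>) i))) =
        signof \<rho> * (signof \<sigma> * (\<Prod>i = 0..<p. M i (c (\<rho> (\<sigma> i)))))"
      by (simp add: mult.assoc)
  qed
  finally have "signof \<rho> * minor p M c = (signof \<rho> * signof \<rho>) * minor p M (\<lambda>j. c (\<rho> j))"
    by (simp only: mult.assoc)
  also have "signof \<rho> * signof \<rho> = (1 :: 'a)" by (simp add: sign_def)
  finally show ?thesis by simp
qed

lemma minor_cong: "(\<And>j. j < p \<Longrightarrow> c j = c' j) \<Longrightarrow> minor p M c = minor p M c'"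
  unfolding minor_def
proof (intro sum.cong refl arg_cong2[where f = "(*)"] prod.cong)
  fix \<sigma> i assume c: "\<And>j. j < p \<Longrightarrow> c j = c' j" and "\<sigma> \<in> {\<sigma>. \<sigma> permutes {0..<p}}" "i \<in> {0..<p}"
  then have "\<sigma> i < p" using permutes_in_image[of \<sigma> "{0..<p}" i] by auto
  then show "M i (c (\<sigma> i)) = M i (c' (\<sigma> i))" by (simp only: c)
qed

lemma minor_not_inj:
  fixes M :: "nat \<Rightarrow> nat \<Rightarrow> 'v cpoly fps"
  assumes "x < p" "y < p" "x \<noteq> y" "c x = c y"
  shows "minor p M c = 0"
proof -
  have t: "Transposition.transpose x y permutes {0..<p}"
    using assms by (intro permutes_swap_id) auto
  have eq: "(\<lambda>j. c (Transposition.transpose x y j)) = c"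
    using assms(4) by (auto simp: Transposition.transpose_def)
  have "minor p M c = signof (Transposition.transpose x y) * minor p M c"
    using minor_permute[OF t, of M c] unfolding eq .
  also have "\<dots> = - minor p M c" using assms(3) by (simp add: sign_swap_id)
  finally show ?thesis by (rule cpoly_fps_add_self_eq_0[OF iffD1[OF eq_neg_iff_add_eq_0]])
qed

text \<open>The operator t d/dt is diagonal on coefficients (\<open>theta_nth\<close>): the
  coefficient of t^a is multiplied by a. Its powers thus produce the weights \<open>a ^ l\<close> of
  a moment.\<close>

definition theta :: "'a::comm_ring_1 fps \<Rightarrow> 'a fps" where
  "theta F = fps_X * fps_deriv F"

lemma theta_nth: "fps_nth (theta F) a = of_nat a * fps_nth F a"
  by (cases a) (simp_all add: theta_def)

lemma theta_funpow_nth: "fps_nth ((theta ^^ l) F) a = of_nat a ^ l * fps_nth F a"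
  by (induction l) (simp_all add: theta_nth mult.assoc)

lemma theta_add: "theta (F + G) = theta F + theta G"
  by (simp add: theta_def algebra_simps)

lemma theta_0 [simp]: "theta 0 = 0"
  by (simp add: theta_def)

lemma theta_mult: "theta (F * G) = theta F * G + F * theta G"
  by (simp add: theta_def algebra_simps)

lemma theta_sum: "theta (sum f A) = (\<Sum>x\<in>A. theta (f x))"
  by (induction A rule: infinite_finite_induct) (simp_all add: theta_add)

lemma theta_signof: "theta (signof \<sigma> * F) = signof \<sigma> * theta F"
  by (simp add: sign_def theta_def)

lemma theta_prod:
  assumes "finite A"
  shows "theta (prod f A) = (\<Sum>r\<in>A. \<Prod>i\<in>A. if i = r then theta (f i) else f i)"
  using assms
proof (induction A)
  case empty
  then show ?case by (simp add: theta_def)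
next
  case (insert a A)
  have "(\<Prod>i\<in>insert a A. if i = a then theta (f i) else f i) = theta (f a) * prod f A"
  proof -
    have "(\<Prod>i\<in>A. if i = a then theta (f i) else f i) = prod f A"
      using insert(2) by (intro prod.cong refl) auto
    then show ?thesis using insert(1,2) by simp
  qed
  moreover have "(\<Prod>i\<in>insert a A. if i = r then theta (f i) else f i) =
      f a * (\<Prod>i\<in>A. if i = r then theta (f i) else f i)" if "r \<in> A" for r
    using insert that by auto
  ultimately show ?case
    using insert by (simp add: theta_mult sum_distrib_left)
qed

text \<open>A derivation applied to a determinant acts on one row at a time.\<close>

lemma theta_minor:
  "theta (minor p M c) = (\<Sum>r = 0..<p. minor p (M(r := \<lambda>j. theta (M r j))) c)"
proof -
  have "theta (minor p M c) = (\<Sum>\<sigma> | \<sigma> permutes {0..<p}. \<Sum>r = 0..<p.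
      signof \<sigma> * (\<Prod>i = 0..<p. (M(r := \<lambda>j. theta (M r j))) i (c (\<sigma> i))))"
    unfolding minor_def theta_sum theta_signof theta_prod[OF finite_atLeastLessThan] sum_distrib_left
    by (intro sum.cong refl arg_cong2[where f = "(*)"] prod.cong) auto
  also have "\<dots> = (\<Sum>r = 0..<p. minor p (M(r := \<lambda>j. theta (M r j))) c)"
    unfolding minor_def by (rule sum.swap)
  finally show ?thesis .
qed

text \<open>
  Sums of minors of matrices that differ from Z in at most l rows. By the product rule, theta
  raises l by one.
\<close>

inductive near :: "nat \<Rightarrow> (nat \<Rightarrow> nat \<Rightarrow> 'a) \<Rightarrow> nat \<Rightarrow> ((nat \<Rightarrow> nat) \<Rightarrow> 'a::comm_ring_1) \<Rightarrow> bool"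
  for p Z l where
  zero: "near p Z l (\<lambda>c. 0)"
| base: "card {i. i < p \<and> M i \<noteq> Z i} \<le> l \<Longrightarrow> near p Z l (minor p M)"
| add: "near p Z l F \<Longrightarrow> near p Z l G \<Longrightarrow> near p Z l (\<lambda>c. F c + G c)"

lemma near_sum:
  assumes "finite A" "\<And>x. x \<in> A \<Longrightarrow> near p Z l (F x)"
  shows "near p Z l (\<lambda>c. \<Sum>x\<in>A. F x c)"
  using assms by (induction A) (auto intro: near.intros)

lemma near_theta:
  assumes "near p Z l F"
  shows "near p Z (Suc l) (\<lambda>c. theta (F c))"
  using assms
proof induction
  case zero
  then show ?case by (simp add: near.zero)
next
  case (base M)
  have "near p Z (Suc l) (minor p (M(r := \<lambda>j. theta (M r j))))" for r
  proof (rule near.base)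
    have "{i. i < p \<and> (M(r := \<lambda>j. theta (M r j))) i \<noteq> Z i} \<subseteq> insert r {i. i < p \<and> M i \<noteq> Z i}"
      by auto
    then have "card {i. i < p \<and> (M(r := \<lambda>j. theta (M r j))) i \<noteq> Z i} \<le> card (insert r {i. i < p \<and> M i \<noteq> Z i})"
      by (intro card_mono) auto
    also have "\<dots> \<le> Suc (card {i. i < p \<and> M i \<noteq> Z i})" by (rule card_insert_le_m1) auto
    finally show "card {i. i < p \<and> (M(r := \<lambda>j. theta (M r j))) i \<noteq> Z i} \<le> Suc l"
      using base by simp
  qed
  then show ?case unfolding theta_minor by (intro near_sum) auto
next
  case (add F G)
  then show ?case by (simp add: theta_add near.add)
qed

lemma near_theta_funpow: "near p Z l (\<lambda>c. (theta ^^ l) (minor p Z c))"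
proof (induction l)
  case 0
  then show ?case using near.base[of p Z Z 0] by simp
next
  case (Suc l)
  then show ?case using near_theta by fastforce
qed

text \<open>
  If two positions x < p \<le> y of X carry the same row, then exchanging them changes the sign of
  the permutation only. Such positions exist by counting.
\<close>

lemma sum_permutes_near_eq_0:
  fixes Z :: "nat \<Rightarrow> nat \<Rightarrow> 'v cpoly fps"
  assumes X: "X \<subseteq> {0..<2 * p}" and card: "p + d < card X" and near: "near p Z d F"
  shows "(\<Sum>\<pi> | \<pi> permutes X. signof \<pi> * (F (\<lambda>j. C (\<pi> j)) * minor p Z (\<lambda>j. C (\<pi> (p + j))))) = 0"
  using near
proof induction
  case zero
  then show ?case by simp
next
  case (add F G)
  then show ?case by (simp add: algebra_simps sum.distrib)
next
  case (base M)
  have fX: "finite X" using X by (rule finite_subset) simp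
  define f where "f = (\<lambda>\<sigma> \<tau> \<pi>. (\<Prod>i = 0..<p. M i (C (\<pi> (\<sigma> i)))) * (\<Prod>i = 0..<p. Z i (C (\<pi> (p + \<tau> i)))))"
  have inner: "(\<Sum>\<pi> | \<pi> permutes X. signof \<pi> * f \<sigma> \<tau> \<pi>) = 0"
    if \<sigma>: "\<sigma> permutes {0..<p}" and \<tau>: "\<tau> permutes {0..<p}" for \<sigma> \<tau>
  proof -
    define A where "A = {i \<in> {0..<p}. \<sigma> i \<in> X}"
    define B where "B = {i \<in> {0..<p}. p + \<tau> i \<in> X}"
    have fin: "finite A" "finite B" by (auto simp: A_def B_def)
    \<comment> \<open>Each position in X is the place of a row: of the first factor if the position
      is below p, of the second otherwise.\<close>
    have "X \<subseteq> \<sigma> ` A \<union> (\<lambda>i. p + \<tau> i) ` B"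
    proof
      fix x assume x: "x \<in> X"
      show "x \<in> \<sigma> ` A \<union> (\<lambda>i. p + \<tau> i) ` B"
      proof (cases "x < p")
        case True
        then have "x \<in> \<sigma> ` {0..<p}" using permutes_image[OF \<sigma>] by simp
        then show ?thesis using x by (auto simp: A_def)
      next
        case False
        then have "x - p \<in> {0..<p}" using x X by auto
        then have "x - p \<in> \<tau> ` {0..<p}" using permutes_image[OF \<tau>] by simp
        then obtain i where i: "i \<in> {0..<p}" "x - p = \<tau> i" by blast
        then have "x = p + \<tau> i" using False by simp
        then show ?thesis using x i by (auto simp: B_def)
      qed
    qed
    then have "card X \<le> card (\<sigma> ` A \<union> (\<lambda>i. p + \<tau> i) ` B)" using fin by (intro card_mono) auto
    also have "\<dots> \<le> card A + card B"
      by (rule order.trans[OF card_Un_le add_mono[OF card_image_le[OF fin(1)] card_image_le[OF fin(2)]]])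
    \<comment> \<open>A and B are sets of rows, so their union has at most p elements; more than d
      rows remain that have both places in X.\<close>
    also have "\<dots> = card (A \<union> B) + card (A \<inter> B)" by (rule card_Un_Int[OF fin])
    also have "card (A \<union> B) \<le> card {0..<p}" by (rule card_mono) (auto simp: A_def B_def)
    finally have "d < card (A \<inter> B)" using card by simp
    then have "card {i. i < p \<and> M i \<noteq> Z i} < card (A \<inter> B)" using base by simp
    \<comment> \<open>At most d rows of M differ from those of Z, so some row with both places in X
      is common to both matrices.\<close>
    then have "\<not> A \<inter> B \<subseteq> {i. i < p \<and> M i \<noteq> Z i}"
      using card_mono[of "{i. i < p \<and> M i \<noteq> Z i}" "A \<inter> B"] by auto
    then obtain r where r: "r < p" "\<sigma> r \<in> X" "p + \<tau> r \<in> X" "M r = Z r"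
      by (auto simp: A_def B_def)
    define x where "x = \<sigma> r"
    define y where "y = p + \<tau> r"
    define t where "t = Transposition.transpose x y"
    have xp: "x < p" using permutes_in_image[OF \<sigma>, of r] r by (simp add: x_def)
    have xy: "x \<noteq> y" using xp by (simp add: y_def)
    have t: "t permutes X" unfolding t_def using r by (intro permutes_swap_id) (simp_all add: x_def y_def)
    have sgn: "sign t = -1" using xy by (simp add: t_def sign_swap_id)
    have inj: "\<sigma> i = x \<longleftrightarrow> i = r" "p + \<tau> i = y \<longleftrightarrow> i = r" for i
      by (simp_all add: x_def y_def inj_eq[OF permutes_inj[OF \<sigma>]] inj_eq[OF permutes_inj[OF \<tau>]])
    have ne: "\<sigma> i \<noteq> y" "p + \<tau> i \<noteq> x" if "i < p" for i
      using permutes_in_image[OF \<sigma>, of i] that xp by (simp_all add: y_def)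
    \<comment> \<open>The exchange merely swaps the arguments of two factors that come from the same
      row \<open>M r = Z r\<close>.\<close>
    have ft: "f \<sigma> \<tau> (\<pi> \<circ> t) = f \<sigma> \<tau> \<pi>" for \<pi>
    proof -
      have rem: "f \<sigma> \<tau> \<pi> = (M r (C (\<pi> (\<sigma> r))) * (\<Prod>i \<in> {0..<p} - {r}. M i (C (\<pi> (\<sigma> i))))) *
          (Z r (C (\<pi> (p + \<tau> r))) * (\<Prod>i \<in> {0..<p} - {r}. Z i (C (\<pi> (p + \<tau> i)))))" for \<pi>
        unfolding f_def by (intro arg_cong2[where f = "(*)"] prod.remove) (simp_all add: r(1))
      have 1: "(\<Prod>i \<in> {0..<p} - {r}. M i (C ((\<pi> \<circ> t) (\<sigma> i)))) = (\<Prod>i \<in> {0..<p} - {r}. M i (C (\<pi> (\<sigma> i))))"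
        by (intro prod.cong refl) (simp add: t_def transpose_apply_other inj ne)
      have 2: "(\<Prod>i \<in> {0..<p} - {r}. Z i (C ((\<pi> \<circ> t) (p + \<tau> i)))) = (\<Prod>i \<in> {0..<p} - {r}. Z i (C (\<pi> (p + \<tau> i))))"
        by (intro prod.cong refl) (simp add: t_def transpose_apply_other inj ne)
      have "(\<pi> \<circ> t) (\<sigma> r) = \<pi> (p + \<tau> r)" "(\<pi> \<circ> t) (p + \<tau> r) = \<pi> (\<sigma> r)"
        by (simp_all add: t_def x_def y_def)
      then show ?thesis by (simp only: rem 1 2 r(4) mult_ac)
    qed
    have "(\<Sum>\<pi> | \<pi> permutes X. signof \<pi> * f \<sigma> \<tau> \<pi>) =
        (\<Sum>\<pi> | \<pi> permutes X. signof (\<pi> \<circ> t) * f \<sigma> \<tau> (\<pi> \<circ> t))"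
      by (rule sum_permutations_compose_right[OF t])
    also have "\<dots> = - (\<Sum>\<pi> | \<pi> permutes X. signof \<pi> * f \<sigma> \<tau> \<pi>)"
      unfolding sum_negf[symmetric]
    proof (rule sum.cong[OF refl])
      fix \<pi> assume "\<pi> \<in> {\<pi>. \<pi> permutes X}"
      then have "sign (\<pi> \<circ> t) = - sign \<pi>"
        using sign_compose[OF permutes_imp_permutation[OF fX] permutes_imp_permutation[OF fX t]] sgn
        by simp
      then show "signof (\<pi> \<circ> t) * f \<sigma> \<tau> (\<pi> \<circ> t) = - (signof \<pi> * f \<sigma> \<tau> \<pi>)"
        unfolding ft by simp
    qed
    finally show ?thesis
      by (rule cpoly_fps_add_self_eq_0[OF iffD1[OF eq_neg_iff_add_eq_0]])
  qed
  have "(\<Sum>\<pi> | \<pi> permutes X. signof \<pi> * (minor p M (\<lambda>j. C (\<pi> j)) * minor p Z (\<lambda>j. C (\<pi> (p + j))))) =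
      (\<Sum>\<pi> | \<pi> permutes X. \<Sum>\<sigma> | \<sigma> permutes {0..<p}. \<Sum>\<tau> | \<tau> permutes {0..<p}.
        signof \<sigma> * signof \<tau> * (signof \<pi> * f \<sigma> \<tau> \<pi>))"
    unfolding minor_def sum_product unfolding sum_distrib_left f_def
    by (intro sum.cong refl) (simp only: mult_ac)
  also have "\<dots> = (\<Sum>\<sigma> | \<sigma> permutes {0..<p}. \<Sum>\<tau> | \<tau> permutes {0..<p}. \<Sum>\<pi> | \<pi> permutes X.
        signof \<sigma> * signof \<tau> * (signof \<pi> * f \<sigma> \<tau> \<pi>))"
    by (rule trans[OF sum.swap sum.cong[OF refl sum.swap]])
  also have "\<dots> = 0"
    unfolding sum_distrib_left[symmetric] using inner by (simp add: sum.neutral)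
  finally show ?case .
qed


section \<open>Relations between products of coefficients\<close>

lemma signof_mult_nth: "fps_nth (signof \<pi> * F) N = signof \<pi> * fps_nth F N"
  by (simp add: sign_def)

lemma D_coeff_eq_minor: "D_coeff p I k = fps_nth (minor p (\<lambda>i. z_series (i + 1)) (\<lambda>j. I ! j)) k"
  by (simp add: D_coeff_def D_series_eq_minor)

text \<open>The coefficient of t^N after l applications of \<open>theta\<close> to the first factor
  is the l-th moment. It vanishes for l \<le> d, and a polynomial of degree at most d combines these
  moments linearly.\<close>

lemma moments_eq_0:
  fixes Z :: "nat \<Rightarrow> nat \<Rightarrow> 'v cpoly fps"
  assumes X: "X \<subseteq> {0..<2 * p}" and card: "p + d < card X" and q: "degree q \<le> d"
  shows "(\<Sum>a = 0..N. cconst (poly q (of_nat a)) * (\<Sum>\<pi> | \<pi> permutes X. signof \<pi> *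
    (fps_nth (minor p Z (\<lambda>j. C (\<pi> j))) a * fps_nth (minor p Z (\<lambda>j. C (\<pi> (p + j)))) (N - a)))) = 0"
proof -
  define c where "c = (\<lambda>a. \<Sum>\<pi> | \<pi> permutes X. signof \<pi> *
    (fps_nth (minor p Z (\<lambda>j. C (\<pi> j))) a * fps_nth (minor p Z (\<lambda>j. C (\<pi> (p + j)))) (N - a)))"
  have mom: "(\<Sum>a = 0..N. of_nat a ^ l * c a) = 0" if "l \<le> d" for l
  proof -
    have "0 = fps_nth (\<Sum>\<pi> | \<pi> permutes X. signof \<pi> *
        ((theta ^^ l) (minor p Z (\<lambda>j. C (\<pi> j))) * minor p Z (\<lambda>j. C (\<pi> (p + j))))) N"
      using that card by (subst sum_permutes_near_eq_0[OF X _ near_theta_funpow]) auto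
    also have "\<dots> = (\<Sum>\<pi> | \<pi> permutes X. \<Sum>a = 0..N. of_nat a ^ l * (signof \<pi> *
        (fps_nth (minor p Z (\<lambda>j. C (\<pi> j))) a * fps_nth (minor p Z (\<lambda>j. C (\<pi> (p + j)))) (N - a))))"
      unfolding fps_sum_nth signof_mult_nth unfolding fps_mult_nth theta_funpow_nth
      unfolding sum_distrib_left
      by (intro sum.cong refl) (simp only: mult_ac)
    also have "\<dots> = (\<Sum>a = 0..N. of_nat a ^ l * c a)"
      unfolding c_def sum_distrib_left by (rule sum.swap)
    finally show ?thesis by simp
  qed
  have "(\<Sum>a = 0..N. cconst (poly q (of_nat a)) * c a) =
      (\<Sum>a = 0..N. \<Sum>l\<le>degree q. cconst (coeff q l) * (of_nat a ^ l * c a))"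
    unfolding poly_altdef cconst_sum cconst_mult cconst_power cconst_of_nat sum_distrib_right
    by (intro sum.cong refl) (simp only: mult.assoc)
  also have "\<dots> = (\<Sum>l\<le>degree q. cconst (coeff q l) * (\<Sum>a = 0..N. of_nat a ^ l * c a))"
    unfolding sum_distrib_left by (rule sum.swap)
  also have "\<dots> = 0" using mom q by (intro sum.neutral) auto
  finally show ?thesis by (simp add: c_def)
qed

text \<open>The product of the factors 1 - (x - k) / j over j = 1, ..., d equals 1 at k and vanishes
  at each k + j.\<close>

lemma lagrange_window:
  obtains q :: "complex poly" where "degree q \<le> d" "poly q (of_nat k) = 1"
    "\<And>a. k < a \<Longrightarrow> a \<le> k + d \<Longrightarrow> poly q (of_nat a) = 0"
proof -
  define q :: "complex poly" where "q = (\<Prod>j\<in>{1..d}. [:1 + of_nat k / of_nat j, - 1 / of_nat j:])"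
  have "degree q \<le> (\<Sum>j\<in>{1..d}. 1)"
    unfolding q_def
    by (rule order.trans[OF degree_prod_sum_le sum_mono]) (auto simp: degree_pCons_eq_if)
  moreover have "poly q (of_nat k) = 1" by (simp add: q_def poly_prod)
  moreover have "poly q (of_nat a) = 0" if "k < a" "a \<le> k + d" for a
  proof -
    have "a - k \<in> {1..d}" using that by auto
    moreover have "poly [:1 + of_nat k / of_nat (a - k), - 1 / of_nat (a - k):] (of_nat a :: complex) = 0"
      using that by (simp add: of_nat_diff field_simps)
    ultimately show ?thesis unfolding q_def poly_prod by (intro prod_zero) auto
  qed
  ultimately show ?thesis using that by simp
qed

text \<open>The total exponent 2k + d makes the window symmetric under exchanging the two exponents.
  Outside it, one of a and 2k + d - a is smaller than k, which is what straightening needs.\<close>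

lemma exchange_window:
  fixes Z :: "nat \<Rightarrow> nat \<Rightarrow> 'v cpoly fps"
  assumes X: "X \<subseteq> {0..<2 * p}" and card: "p + d < card X"
  obtains w :: "nat \<Rightarrow> complex" where
    "(\<Sum>\<pi> | \<pi> permutes X. signof \<pi> *
      (fps_nth (minor p Z (\<lambda>j. C (\<pi> j))) k * fps_nth (minor p Z (\<lambda>j. C (\<pi> (p + j)))) (k + d))) =
    (\<Sum>a \<in> {0..2 * k + d} - {k..k + d}. cconst (w a) * (\<Sum>\<pi> | \<pi> permutes X. signof \<pi> *
      (fps_nth (minor p Z (\<lambda>j. C (\<pi> j))) a * fps_nth (minor p Z (\<lambda>j. C (\<pi> (p + j)))) (2 * k + d - a))))"
proof -
  obtain q :: "complex poly" where q: "degree q \<le> d" "poly q (of_nat k) = 1"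
    "\<And>a. k < a \<Longrightarrow> a \<le> k + d \<Longrightarrow> poly q (of_nat a) = 0"
    using lagrange_window[of d k] by blast
  define c where "c = (\<lambda>a. \<Sum>\<pi> | \<pi> permutes X. signof \<pi> *
    (fps_nth (minor p Z (\<lambda>j. C (\<pi> j))) a * fps_nth (minor p Z (\<lambda>j. C (\<pi> (p + j)))) (2 * k + d - a)))"
  define h where "h = (\<lambda>a. cconst (poly q (of_nat a)) * c a)"
  have "0 = sum h {0..2 * k + d}"
    using moments_eq_0[OF X card q(1), where N = "2 * k + d" and Z = Z and C = C] by (simp add: h_def c_def)
  also have "\<dots> = sum h ({0..2 * k + d} - {k..k + d}) + sum h {k..k + d}"
    by (rule sum.subset_diff) auto
  also have "sum h {k..k + d} = h k + sum h {k<..k + d}"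
  proof -
    have "{k..k + d} = insert k {k<..k + d}" by auto
    then show ?thesis by simp
  qed
  also have "sum h {k<..k + d} = 0" using q(3) by (intro sum.neutral) (auto simp: h_def)
  also have "h k = c k" by (simp add: h_def q(2))
  finally have "c k = - sum h ({0..2 * k + d} - {k..k + d})" by (simp add: eq_neg_iff_add_eq_0 add.commute)
  also have "\<dots> = (\<Sum>a \<in> {0..2 * k + d} - {k..k + d}. cconst (- poly q (of_nat a)) * c a)"
    unfolding sum_negf[symmetric] h_def cconst_minus by simp
  finally show ?thesis
    using that[of "\<lambda>a. - poly q (of_nat a)"] by (simp add: c_def mult_2)
qed

text \<open>Minors alternate in their columns: a repeated column gives zero, and sorting distinct
  columns costs a sign. Hence increasing tuples suffice as generators.\<close>

lemma D_coeff_sort: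
  assumes len: "length L = p" and sub: "set L \<subseteq> {1..n}"
  shows "D_coeff p L k = 0 \<or>
    ((sort L, k) \<in> ss_index_set p n \<and> (\<exists>e. D_coeff p L k = cconst e * D_coeff p (sort L) k))"
proof (cases "distinct L")
  case False
  then obtain x y where "x < p" "y < p" "x \<noteq> y" "L ! x = L ! y"
    using len by (auto simp: distinct_conv_nth)
  then have "minor p (\<lambda>i. z_series (i + 1)) (\<lambda>j. L ! j) = 0" by (rule minor_not_inj)
  then show ?thesis by (simp add: D_coeff_eq_minor)
next
  case True
  have "mset L = mset (sort L)" by simp
  then obtain \<rho> where \<rho>: "\<rho> permutes {..<length (sort L)}" "permute_list \<rho> (sort L) = L"
    by (rule mset_eq_permutation)
  then have \<rho>': "\<rho> permutes {0..<p}" using len by (simp add: atLeast0LessThan)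
  have nth: "L ! j = sort L ! \<rho> j" if "j < p" for j
    using permute_list_nth[OF \<rho>(1), of j] \<rho>(2) that len by simp
  have "minor p (\<lambda>i. z_series (i + 1)) (\<lambda>j. L ! j) = minor p (\<lambda>i. z_series (i + 1)) (\<lambda>j. sort L ! \<rho> j)"
    by (rule minor_cong) (rule nth)
  also have "\<dots> = signof \<rho> * minor p (\<lambda>i. z_series (i + 1)) (\<lambda>j. sort L ! j)"
    by (rule minor_permute[OF \<rho>'])
  finally have "D_coeff p L k = signof \<rho> * D_coeff p (sort L) k"
    by (simp add: D_coeff_eq_minor signof_mult_nth)
  moreover have "signof \<rho> = (cconst (signof \<rho>) :: zvar cpoly)"
    by (simp add: sign_def cconst_minus)
  ultimately have "\<exists>e. D_coeff p L k = cconst e * D_coeff p (sort L) k" by metis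
  moreover have "(sort L, k) \<in> ss_index_set p n"
    using True len sub by (auto simp: ss_index_set_def strict_sorted_iff)
  ultimately show ?thesis by blast
qed

text \<open>
  A weight that orders the generators first by k and then by the sum of the columns.
\<close>

fun wt :: "nat \<Rightarrow> nat \<Rightarrow> nat list \<times> nat \<Rightarrow> nat" where
  "wt p n (I, k) = (p * n + 1) * k + sum_list I"

abbreviation Dgen :: "nat \<Rightarrow> nat list \<times> nat \<Rightarrow> zvar cpoly" where
  "Dgen p A \<equiv> D_coeff p (fst A) (snd A)"

lemma sum_list_bound: "length L = p \<Longrightarrow> set L \<subseteq> {1..n} \<Longrightarrow> sum_list L \<le> p * n" for L :: "nat list"
  by (induction L arbitrary: p) auto

text \<open>A column sum is at most p n, so the factor p n + 1 in \<open>wt\<close> lets one unit of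
  the superscript outweigh all columns.\<close>

lemma wt_mono:
  assumes "length L = p" "set L \<subseteq> {1..n}" "a < k"
  shows "wt p n (L, a) < wt p n (I, k)"
proof -
  have "wt p n (L, a) < (p * n + 1) * Suc a" using sum_list_bound[OF assms(1,2)] by simp
  also have "\<dots> \<le> (p * n + 1) * k" using assms(3) by (intro mult_le_mono2) simp
  also have "\<dots> \<le> wt p n (I, k)" by simp
  finally show ?thesis .
qed

text \<open>If s is the total weight of a pair and t the weight of its lighter member, these are the
  products whose two weights lie further apart.\<close>

definition smaller_pairs :: "nat \<Rightarrow> nat \<Rightarrow> nat \<Rightarrow> nat \<Rightarrow> zvar cpoly set" where
  "smaller_pairs p n s t = {Dgen p A * Dgen p B | A B. A \<in> ss_index_set p n \<and> B \<in> ss_index_set p n \<and>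
     wt p n A + wt p n B = s \<and> (wt p n A < t \<or> wt p n B < t)}"

text \<open>Sorting a tuple preserves its column sum and hence its weight, so unsorted factors are
  admissible.\<close>

lemma D_coeff_product_in_span:
  assumes L: "length L = p" "set L \<subseteq> {1..n}" and L': "length L' = p" "set L' \<subseteq> {1..n}"
    and s: "wt p n (L, a) + wt p n (L', b) = s" and t: "wt p n (L, a) < t \<or> wt p n (L', b) < t"
  shows "D_coeff p L a * D_coeff p L' b \<in> cp.span (smaller_pairs p n s t)"
proof (cases "D_coeff p L a = 0 \<or> D_coeff p L' b = 0")
  case True
  then have "D_coeff p L a * D_coeff p L' b = 0" by auto
  then show ?thesis by (simp only: cp.span_zero)
next
  case False
  obtain e where e: "(sort L, a) \<in> ss_index_set p n" "D_coeff p L a = cconst e * D_coeff p (sort L) a"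
    using D_coeff_sort[OF L, of a] False by blast
  obtain e' where e': "(sort L', b) \<in> ss_index_set p n" "D_coeff p L' b = cconst e' * D_coeff p (sort L') b"
    using D_coeff_sort[OF L', of b] False by blast
  have sl: "sum_list (sort M) = sum_list M" for M :: "nat list"
    by (simp add: sum_mset_sum_list[symmetric])
  have "Dgen p (sort L, a) * Dgen p (sort L', b) \<in> smaller_pairs p n s t"
    unfolding smaller_pairs_def
  proof (intro CollectI exI conjI)
    show "wt p n (sort L, a) + wt p n (sort L', b) = s" using s by (simp only: wt.simps sl)
    show "wt p n (sort L, a) < t \<or> wt p n (sort L', b) < t" using t by (simp only: wt.simps sl)
  qed (rule refl e(1) e'(1))+
  then have "cconst (e * e') * (Dgen p (sort L, a) * Dgen p (sort L', b)) \<in> cp.span (smaller_pairs p n s t)"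
    by (rule cp.span_scale[OF cp.span_base])
  moreover have "cconst (e * e') * (Dgen p (sort L, a) * Dgen p (sort L', b)) = D_coeff p L a * D_coeff p L' b"
    unfolding e(2) e'(2) fst_conv snd_conv cconst_mult by (simp only: mult_ac)
  ultimately show ?thesis by simp
qed

text \<open>After cancelling the common elements, two nonempty sets of the same size remain, with
  values below b on one side and at least b on the other.\<close>

lemma sum_lt_of_separated:
  fixes f :: "nat \<Rightarrow> nat"
  assumes "finite S" "finite T" "card S = card T" "S \<noteq> T"
    and sep: "\<And>x y. x \<in> S - T \<Longrightarrow> y \<in> T \<Longrightarrow> f x < b \<and> b \<le> f y"
  shows "sum f S < sum f T"
proof -
  have S: "sum f S = sum f (S - T) + sum f (S \<inter> T)" and T: "sum f T = sum f (T - S) + sum f (S \<inter> T)"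
    using assms by (metis Diff_Int_distrib2 add.commute sum.Int_Diff, metis Int_commute add.commute sum.Int_Diff)
  have c: "card (S - T) = card (T - S)"
    using assms by (simp add: card_Diff_subset_Int Int_commute)
  have "S - T \<noteq> {}"
  proof
    assume "S - T = {}"
    then have "S \<subseteq> T" by blast
    then show False using card_subset_eq[OF assms(2)] assms(3,4) by blast
  qed
  then have pos: "0 < card (S - T)" using assms(1) by (simp add: card_gt_0_iff)
  then have "T - S \<noteq> {}" using c by (metis card.empty less_numeral_extra(3))
  have "sum f (S - T) < card (S - T) * b"
    using sum_strict_mono[of "S - T" f "\<lambda>_. b"] sep \<open>S - T \<noteq> {}\<close> \<open>T - S \<noteq> {}\<close> assms(1) by auto
  also have "\<dots> = (\<Sum>y\<in>T - S. b)" by (simp add: c)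
  also have "\<dots> \<le> sum f (T - S)" using sep \<open>S - T \<noteq> {}\<close> by (intro sum_mono) auto
  finally show ?thesis using S T by simp
qed

text \<open>Shifting by p turns a permutation of the upper block into one of the columns of the
  second factor, with the same sign.\<close>

lemma minor_permute_upper:
  assumes "\<rho> permutes {p..<2 * p}"
  shows "minor p M (\<lambda>j. C (\<rho> (p + j))) = signof \<rho> * minor p M (\<lambda>j. C (p + j))"
proof -
  define \<rho>' where "\<rho>' = map_permutation {p..<2 * p} (\<lambda>x. x - p) \<rho>"
  have inj: "inj_on (\<lambda>x. x - p) {p..<2 * p}" by (auto simp: inj_on_def)
  have img: "(\<lambda>x. x - p) ` {p..<2 * p} = {0..<p}"
  proof (intro equalityI subsetI)
    fix x assume "x \<in> {0..<p}"
    then show "x \<in> (\<lambda>x. x - p) ` {p..<2 * p}" by (intro image_eqI[of _ _ "x + p"]) auto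
  qed auto
  have \<rho>': "\<rho>' permutes {0..<p}"
    unfolding \<rho>'_def by (rule map_permutation_permutes[OF _ assms]) (simp add: bij_betw_def inj img)
  have sgn: "sign \<rho>' = sign \<rho>"
    unfolding \<rho>'_def by (rule sign_map_permutation[OF inj assms]) simp
  have "\<rho> (p + j) = p + \<rho>' j" if "j < p" for j
  proof -
    have "p + j \<in> {p..<2 * p}" using that by simp
    then have "\<rho>' (p + j - p) = \<rho> (p + j) - p"
      unfolding \<rho>'_def by (rule map_permutation_apply[OF inj])
    moreover have "\<rho> (p + j) \<ge> p" using permutes_in_image[OF assms, of "p + j"] that by simp
    ultimately show ?thesis by simp
  qed
  then have "minor p M (\<lambda>j. C (\<rho> (p + j))) = minor p M (\<lambda>j. C (p + \<rho>' j))"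
    by (intro minor_cong) simp
  also have "\<dots> = signof \<rho>' * minor p M (\<lambda>j. C (p + j))"
    by (rule minor_permute[OF \<rho>'])
  finally show ?thesis by (simp only: sgn)
qed

text \<open>A permutation that preserves T is the composite of one acting on T and one acting on U.
  Each affects one minor only, and their signs cancel the sign of the whole.\<close>

lemma minor_pair_block_permute:
  assumes T: "T \<subseteq> {0..<p}" and U: "U \<subseteq> {p..<2 * p}" and \<pi>: "\<pi> permutes (T \<union> U)" and img: "\<pi> ` T = T"
  shows "signof \<pi> * (fps_nth (minor p M (\<lambda>j. C (\<pi> j))) a * fps_nth (minor p M (\<lambda>j. C (\<pi> (p + j)))) b) =
    fps_nth (minor p M C) a * fps_nth (minor p M (\<lambda>j. C (p + j))) b"
proof -
  have fin: "finite T" "finite U" using T U finite_subset by blast+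
  have dis: "T \<inter> U = {}" using T U by force
  have imgU: "\<pi> ` U = U"
  proof -
    have "U = (T \<union> U) - T" using dis by blast
    then have "\<pi> ` U = \<pi> ` (T \<union> U) - \<pi> ` T" using image_set_diff[OF permutes_inj[OF \<pi>]] by metis
    then show ?thesis using permutes_image[OF \<pi>] img dis by auto
  qed
  define \<rho> where "\<rho> = (\<lambda>x. if x \<in> T then \<pi> x else x)"
  define \<tau> where "\<tau> = (\<lambda>x. if x \<in> U then \<pi> x else x)"
  have inj: "inj_on \<pi> A" for A using permutes_inj[OF \<pi>] by (simp add: inj_on_def inj_def)
  have "\<rho> permutes T"
  proof (rule bij_imp_permutes)
    have "\<rho> ` T = T" unfolding \<rho>_def using img by simp
    moreover have "inj_on \<rho> T" using inj[of T] by (simp add: inj_on_def \<rho>_def)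
    ultimately show "bij_betw \<rho> T T" by (simp add: bij_betw_def)
  qed (simp add: \<rho>_def)
  then have \<rho>: "\<rho> permutes {0..<p}" using T by (rule permutes_subset)
  have "\<tau> permutes U"
  proof (rule bij_imp_permutes)
    have "\<tau> ` U = U" unfolding \<tau>_def using imgU by simp
    moreover have "inj_on \<tau> U" using inj[of U] by (simp add: inj_on_def \<tau>_def)
    ultimately show "bij_betw \<tau> U U" by (simp add: bij_betw_def)
  qed (simp add: \<tau>_def)
  then have \<tau>: "\<tau> permutes {p..<2 * p}" using U by (rule permutes_subset)
  have comp: "\<pi> = \<rho> \<circ> \<tau>"
  proof
    fix x
    show "\<pi> x = (\<rho> \<circ> \<tau>) x"
    proof (cases "x \<in> U")
      case True
      then have "\<pi> x \<in> U" using imgU by blast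
      then show ?thesis using True dis by (auto simp: \<rho>_def \<tau>_def)
    next
      case False
      then show ?thesis using permutes_not_in[OF \<pi>, of x] by (auto simp: \<rho>_def \<tau>_def)
    qed
  qed
  have sgn: "sign \<pi> = sign \<rho> * sign \<tau>"
    unfolding comp
    by (rule sign_compose) (use \<rho> \<tau> in \<open>auto intro: permutes_imp_permutation[rotated]\<close>)
  have "\<pi> j = \<rho> j" if "j < p" for j
  proof -
    have "j \<notin> U" using that U by auto
    then show ?thesis using fun_cong[OF comp, of j] by (simp add: \<tau>_def)
  qed
  then have "minor p M (\<lambda>j. C (\<pi> j)) = minor p M (\<lambda>j. C (\<rho> j))"
    by (intro minor_cong) simp
  then have 1: "minor p M (\<lambda>j. C (\<pi> j)) = signof \<rho> * minor p M C"
    by (simp only: minor_permute[OF \<rho>])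
  have "\<rho> (\<tau> (p + j)) = \<tau> (p + j)" if "j < p" for j
    using permutes_in_image[OF \<tau>, of "p + j"] that by (intro permutes_not_in[OF \<rho>]) simp
  then have "\<pi> (p + j) = \<tau> (p + j)" if "j < p" for j
    using that fun_cong[OF comp, of "p + j"] by simp
  then have "minor p M (\<lambda>j. C (\<pi> (p + j))) = minor p M (\<lambda>j. C (\<tau> (p + j)))"
    by (intro minor_cong) simp
  then have 2: "minor p M (\<lambda>j. C (\<pi> (p + j))) = signof \<tau> * minor p M (\<lambda>j. C (p + j))"
    by (simp only: minor_permute_upper[OF \<tau>])
  show ?thesis
    unfolding 1 2 sgn signof_mult_nth by (simp add: sign_def)
qed


text \<open>For a violated inequality \<open>I' ! i' < I ! i\<close>, the antisymmetrization runs
  over the entries of I from i on (positions T) and those of I' up to i' (positions U); every column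
  in U is smaller than every column in T. In the window relation the permutations preserving T
  reproduce the given product, the others with exponents k and k + d lower the column sum of the
  first factor, and all remaining exponents put one superscript below k.\<close>

lemma straighten:
  assumes A: "(I, k) \<in> ss_index_set p n" and B: "(I', k') \<in> ss_index_set p n"
    and kk': "k \<le> k'" and nle: "\<not> ss_le p (I, k) (I', k')"
  shows "D_coeff p I k * D_coeff p I' k' \<in>
    cp.span (smaller_pairs p n (wt p n (I, k) + wt p n (I', k')) (wt p n (I, k)))"
proof -
  define S where "S = cp.span (smaller_pairs p n (wt p n (I, k) + wt p n (I', k')) (wt p n (I, k)))"
  obtain i i' where i: "i < p" "i' < p" "i' + k = i + k'" "I' ! i' < I ! i"
    using nle kk' by (auto simp: not_le)
  define d where "d = k' - k"
  have i': "i' = i + d" and k': "k' = k + d" using i kk' by (simp_all add: d_def)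
  have len: "length I = p" "length I' = p" and srt: "sorted_wrt (<) I" "sorted_wrt (<) I'"
    and rng: "set I \<subseteq> {1..n}" "set I' \<subseteq> {1..n}"
    using A B by (auto simp: ss_index_set_def)
  \<comment> \<open>Both tuples form one sequence of 2p columns; positions from p on belong to
    I'.\<close>
  define C where "C = (\<lambda>j. if j < p then I ! j else I' ! (j - p))"
  define T where "T = {i..<p}"
  define U where "U = {p..p + i'}"
  have X: "T \<union> U \<subseteq> {0..<2 * p}" using i by (auto simp: T_def U_def)
  have T: "T \<subseteq> {0..<p}" and U: "U \<subseteq> {p..<2 * p}" using i by (auto simp: T_def U_def)
  have TU: "T \<union> U = {i..p + i'}" using i by (auto simp: T_def U_def)
  \<comment> \<open>The stretch has p + i' - i + 1 positions, and i' = i + d makes this exactly p +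
    d + 1.\<close>
  have card: "p + d < card (T \<union> U)" using i i' unfolding TU by simp
  define Z :: "nat \<Rightarrow> nat \<Rightarrow> zvar cpoly fps" where "Z = (\<lambda>i. z_series (i + 1))"
  define L where "L = (\<lambda>\<pi> :: nat \<Rightarrow> nat. map (\<lambda>j. C (\<pi> j)) [0..<p])"
  define L' where "L' = (\<lambda>\<pi> :: nat \<Rightarrow> nat. map (\<lambda>j. C (\<pi> (p + j))) [0..<p])"
  define tm where "tm = (\<lambda>\<pi> a b. signof \<pi> * (D_coeff p (L \<pi>) a * D_coeff p (L' \<pi>) b))"
  have mL: "fps_nth (minor p Z (\<lambda>j. C (\<pi> j))) a = D_coeff p (L \<pi>) a" for \<pi> a
    unfolding D_coeff_eq_minor Z_def
    by (intro arg_cong2[where f = fps_nth] refl minor_cong) (simp add: L_def)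
  have mL': "fps_nth (minor p Z (\<lambda>j. C (\<pi> (p + j)))) a = D_coeff p (L' \<pi>) a" for \<pi> a
    unfolding D_coeff_eq_minor Z_def
    by (intro arg_cong2[where f = fps_nth] refl minor_cong) (simp add: L'_def)
  have mI: "fps_nth (minor p Z C) a = D_coeff p I a" for a
    unfolding D_coeff_eq_minor Z_def
    by (intro arg_cong2[where f = fps_nth] refl minor_cong) (simp add: C_def)
  have mI': "fps_nth (minor p Z (\<lambda>j. C (p + j))) a = D_coeff p I' a" for a
    unfolding D_coeff_eq_minor Z_def
    by (intro arg_cong2[where f = fps_nth] refl minor_cong) (simp add: C_def)
  have CI: "C j \<in> {1..n}" if "j < 2 * p" for j
  proof (cases "j < p")
    case True
    then have "I ! j \<in> set I" using len by simp
    then show ?thesis using True subsetD[OF rng(1)] by (simp add: C_def)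
  next
    case False
    then have "I' ! (j - p) \<in> set I'" using len that by simp
    then show ?thesis using False subsetD[OF rng(2)] by (simp add: C_def)
  qed
  have sumI: "sum_list I = (\<Sum>j = 0..<p. C j)"
    using len(1) by (simp add: sum_list_sum_nth C_def)
  have sumI': "sum_list I' = (\<Sum>j = 0..<p. C (p + j))"
    using len(2) by (simp add: sum_list_sum_nth C_def)
  have split: "(\<Sum>j = 0..<p. h j) + (\<Sum>j = 0..<p. h (p + j)) = (\<Sum>j = 0..<2 * p. h j)" for h :: "nat \<Rightarrow> nat"
    using sum.atLeastLessThan_concat[of 0 p "2 * p" h] sum.shift_bounds_nat_ivl[of h 0 p p]
    by (simp add: mult_2 add.commute)
  have Lprops: "length (L \<pi>) = p" "set (L \<pi>) \<subseteq> {1..n}" "length (L' \<pi>) = p" "set (L' \<pi>) \<subseteq> {1..n}"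
    "sum_list (L \<pi>) + sum_list (L' \<pi>) = sum_list I + sum_list I'"
    "sum_list (L \<pi>) = (\<Sum>j = 0..<p. C (\<pi> j))"
    if \<pi>: "\<pi> permutes (T \<union> U)" for \<pi>
  proof -
    have \<pi>': "\<pi> permutes {0..<2 * p}" by (rule permutes_subset[OF \<pi> X])
    have lt: "\<pi> j < 2 * p" if "j < 2 * p" for j
      using permutes_in_image[OF \<pi>', of j] that by simp
    show "length (L \<pi>) = p" "length (L' \<pi>) = p" by (simp_all add: L_def L'_def)
    show "set (L \<pi>) \<subseteq> {1..n}"
    proof
      fix x assume "x \<in> set (L \<pi>)"
      then obtain j where "j < p" "x = C (\<pi> j)" by (auto simp: L_def)
      then show "x \<in> {1..n}" using CI[OF lt[of j]] by simp
    qed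
    show "set (L' \<pi>) \<subseteq> {1..n}"
    proof
      fix x assume "x \<in> set (L' \<pi>)"
      then obtain j where "j < p" "x = C (\<pi> (p + j))" by (auto simp: L'_def)
      then show "x \<in> {1..n}" using CI[OF lt[of "p + j"]] by simp
    qed
    show sL: "sum_list (L \<pi>) = (\<Sum>j = 0..<p. C (\<pi> j))"
      by (simp add: L_def interv_sum_list_conv_sum_set_nat)
    have "sum_list (L' \<pi>) = (\<Sum>j = 0..<p. C (\<pi> (p + j)))"
      by (simp add: L'_def interv_sum_list_conv_sum_set_nat)
    then have "sum_list (L \<pi>) + sum_list (L' \<pi>) = (\<Sum>j = 0..<2 * p. C (\<pi> j))"
      using split[of "\<lambda>j. C (\<pi> j)"] sL by simp
    also have "\<dots> = (\<Sum>j = 0..<2 * p. C j)"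
      using sum.permute[OF \<pi>', of C] by (simp add: o_def)
    also have "\<dots> = sum_list I + sum_list I'"
      using split[of C] sumI sumI' by simp
    finally show "sum_list (L \<pi>) + sum_list (L' \<pi>) = sum_list I + sum_list I'" .
  qed
  have sgnS: "signof \<pi> * f \<in> S" if "f \<in> S" for \<pi> :: "nat \<Rightarrow> nat" and f
  proof -
    have "signof \<pi> * f = f \<or> signof \<pi> * f = - f" by (simp add: sign_def)
    then show ?thesis using that cp.span_neg unfolding S_def by metis
  qed
  have outer: "tm \<pi> a (2 * k + d - a) \<in> S"
    if \<pi>: "\<pi> permutes (T \<union> U)" and a: "a \<in> {0..2 * k + d} - {k..k + d}" for \<pi> a
    unfolding tm_def S_def
  proof (rule sgnS[unfolded S_def], rule D_coeff_product_in_span)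
    note P = Lprops[OF \<pi>]
    show "length (L \<pi>) = p" "set (L \<pi>) \<subseteq> {1..n}" "length (L' \<pi>) = p" "set (L' \<pi>) \<subseteq> {1..n}" by (fact P)+
    have "(p * n + 1) * a + (p * n + 1) * (2 * k + d - a) = (p * n + 1) * k + (p * n + 1) * k'"
      using a unfolding add_mult_distrib2[symmetric] k' by simp
    then show "wt p n (L \<pi>, a) + wt p n (L' \<pi>, 2 * k + d - a) = wt p n (I, k) + wt p n (I', k')"
      using P(5) by (simp only: wt.simps)
    show "wt p n (L \<pi>, a) < wt p n (I, k) \<or> wt p n (L' \<pi>, 2 * k + d - a) < wt p n (I, k)"
    proof (cases "a < k")
      case True
      then show ?thesis using wt_mono[OF P(1,2)] by blast
    next
      case False
      then have "2 * k + d - a < k" using a by auto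
      then show ?thesis using wt_mono[OF P(3,4)] by blast
    qed
  qed
  have moving: "tm \<pi> k (k + d) \<in> S" if \<pi>: "\<pi> permutes (T \<union> U)" and img: "\<pi> ` T \<noteq> T" for \<pi>
    unfolding tm_def S_def
  proof (rule sgnS[unfolded S_def], rule D_coeff_product_in_span)
    note P = Lprops[OF \<pi>]
    show "length (L \<pi>) = p" "set (L \<pi>) \<subseteq> {1..n}" "length (L' \<pi>) = p" "set (L' \<pi>) \<subseteq> {1..n}" by (fact P)+
    show "wt p n (L \<pi>, k) + wt p n (L' \<pi>, k + d) = wt p n (I, k) + wt p n (I', k')"
      using P(5) by (simp add: k')
    have inj: "inj_on \<pi> T" using permutes_inj[OF \<pi>] by (rule inj_on_subset) simp
    \<comment> \<open>The separating value is \<open>I ! i\<close>, the least column in T; whatever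
      enters T comes from U.\<close>
    have "sum C (\<pi> ` T) < sum C T"
    proof (rule sum_lt_of_separated[where b = "I ! i"])
      show "finite (\<pi> ` T)" "finite T" by (simp_all add: T_def)
      show "card (\<pi> ` T) = card T" by (rule card_image[OF inj])
      show "\<pi> ` T \<noteq> T" by (rule img)
      fix x y assume x: "x \<in> \<pi> ` T - T" and y: "y \<in> T"
      have "x \<in> T \<union> U" using x permutes_image[OF \<pi>] by blast
      then have "x \<in> U" using x by blast
      then have "x - p \<le> i'" "p \<le> x" by (auto simp: U_def)
      then have "I' ! (x - p) \<le> I' ! i'"
        using sorted_wrt_nth_less[OF srt(2), of "x - p" i'] i len by (cases "x - p = i'") auto
      moreover have "I ! i \<le> I ! y"
        using sorted_wrt_nth_less[OF srt(1), of i y] y len by (cases "y = i") (auto simp: T_def)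
      ultimately show "C x < I ! i \<and> I ! i \<le> C y"
        using i(4) y \<open>p \<le> x\<close> by (auto simp: C_def T_def)
    qed
    then have "(\<Sum>j\<in>T. C (\<pi> j)) < sum C T" by (simp add: sum.reindex[OF inj])
    moreover have "(\<Sum>j = 0..<i. C (\<pi> j)) = (\<Sum>j = 0..<i. C j)"
    proof (rule sum.cong[OF refl])
      fix j assume "j \<in> {0..<i}"
      then have "j \<notin> T \<union> U" using i by (auto simp: T_def U_def)
      then show "C (\<pi> j) = C j" using permutes_not_in[OF \<pi>] by simp
    qed
    moreover have "sum h {0..<p} = sum h {0..<i} + sum h T" for h :: "nat \<Rightarrow> nat"
      using sum.atLeastLessThan_concat[of 0 i p h] i by (simp add: T_def)
    ultimately have "sum_list (L \<pi>) < sum_list I" using P(6) sumI by simp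
    then show "wt p n (L \<pi>, k) < wt p n (I, k) \<or> wt p n (L' \<pi>, k + d) < wt p n (I, k)" by simp
  qed
  obtain w where w: "(\<Sum>\<pi> | \<pi> permutes (T \<union> U). signof \<pi> *
      (fps_nth (minor p Z (\<lambda>j. C (\<pi> j))) k * fps_nth (minor p Z (\<lambda>j. C (\<pi> (p + j)))) (k + d))) =
    (\<Sum>a \<in> {0..2 * k + d} - {k..k + d}. cconst (w a) * (\<Sum>\<pi> | \<pi> permutes (T \<union> U). signof \<pi> *
      (fps_nth (minor p Z (\<lambda>j. C (\<pi> j))) a * fps_nth (minor p Z (\<lambda>j. C (\<pi> (p + j)))) (2 * k + d - a))))"
    by (rule exchange_window[OF X card])
  define P0 where "P0 = {\<pi>. \<pi> permutes (T \<union> U) \<and> \<pi> ` T = T}"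
  define P1 where "P1 = {\<pi>. \<pi> permutes (T \<union> U) \<and> \<pi> ` T \<noteq> T}"
  have finP: "finite {\<pi>. \<pi> permutes (T \<union> U)}" unfolding TU by (rule finite_permutations) simp
  have fin: "finite P0" "finite P1" by (rule finite_subset[OF _ finP], force simp: P0_def P1_def)+
  have un: "{\<pi>. \<pi> permutes (T \<union> U)} = P0 \<union> P1" "P0 \<inter> P1 = {}" by (auto simp: P0_def P1_def)
  have "(\<Sum>\<pi>\<in>P0. tm \<pi> k (k + d)) + (\<Sum>\<pi>\<in>P1. tm \<pi> k (k + d)) =
    (\<Sum>\<pi> | \<pi> permutes (T \<union> U). tm \<pi> k (k + d))"
    unfolding un(1) by (rule sum.union_disjoint[OF fin un(2), symmetric])
  also have "\<dots> = (\<Sum>a \<in> {0..2 * k + d} - {k..k + d}. cconst (w a) *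
      (\<Sum>\<pi> | \<pi> permutes (T \<union> U). tm \<pi> a (2 * k + d - a)))"
    using w unfolding mL' unfolding mL by (simp only: tm_def)
  also have "\<dots> \<in> S"
    unfolding S_def
    by (intro cp.span_sum cp.span_scale) (use outer in \<open>simp add: S_def\<close>)
  finally have *: "(\<Sum>\<pi>\<in>P0. tm \<pi> k (k + d)) + (\<Sum>\<pi>\<in>P1. tm \<pi> k (k + d)) \<in> S" .
  have "(\<Sum>\<pi>\<in>P1. tm \<pi> k (k + d)) \<in> S"
    unfolding S_def by (intro cp.span_sum) (use moving in \<open>simp add: S_def P1_def\<close>)
  then have "(\<Sum>\<pi>\<in>P0. tm \<pi> k (k + d)) \<in> S"
    using cp.span_diff[OF *[unfolded S_def]] unfolding S_def by fastforce
  moreover have "(\<Sum>\<pi>\<in>P0. tm \<pi> k (k + d)) = (\<Sum>\<pi>\<in>P0. D_coeff p I k * D_coeff p I' k')"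
  proof (rule sum.cong[OF refl])
    fix \<pi> assume "\<pi> \<in> P0"
    then have "\<pi> permutes (T \<union> U)" "\<pi> ` T = T" by (simp_all add: P0_def)
    then show "tm \<pi> k (k + d) = D_coeff p I k * D_coeff p I' k'"
      unfolding tm_def mL[symmetric] mL'[symmetric] mI[symmetric] mI'[symmetric] k'
      by (rule minor_pair_block_permute[OF T U])
  qed
  \<comment> \<open>All permutations preserving T contribute the same product without a sign, so
    their number can be divided out; it is nonzero because of the identity.\<close>
  ultimately have "of_nat (card P0) * (D_coeff p I k * D_coeff p I' k') \<in> S" by simp
  then have "cconst (1 / of_nat (card P0)) * (of_nat (card P0) * (D_coeff p I k * D_coeff p I' k')) \<in> S"
    unfolding S_def by (rule cp.span_scale)
  moreover have "id \<in> P0" by (simp add: P0_def permutes_id)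
  then have "card P0 \<noteq> 0" using fin(1) by auto
  then have "cconst (1 / of_nat (card P0)) * of_nat (card P0) = (1 :: zvar cpoly)"
    unfolding cconst_of_nat[symmetric] cconst_mult[symmetric] by simp
  ultimately show ?thesis unfolding S_def by (simp add: mult.assoc[symmetric])
qed


section \<open>Products of generators and multichains\<close>

definition Dprod :: "nat \<Rightarrow> (nat list \<times> nat) multiset \<Rightarrow> zvar cpoly" where
  "Dprod p M = (\<Prod>A\<in>#M. Dgen p A)"

lemma Dprod_empty [simp]: "Dprod p {#} = 1"
  and Dprod_add_mset [simp]: "Dprod p (add_mset A M) = Dgen p A * Dprod p M"
  and Dprod_union: "Dprod p (M + N) = Dprod p M * Dprod p N"
  by (simp_all add: Dprod_def)

text \<open>The multichains of the lattice. Comparability of all pairs replaces an increasing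
  arrangement of the members.\<close>

definition standard :: "nat \<Rightarrow> nat \<Rightarrow> (nat list \<times> nat) multiset \<Rightarrow> bool" where
  "standard p n M \<longleftrightarrow> set_mset M \<subseteq> ss_index_set p n \<and>
    (\<forall>A\<in>#M. \<forall>B\<in>#M. ss_le p A B \<or> ss_le p B A)"

lemma ss_le_refl: "ss_le p A A"
  by (cases A) auto

text \<open>With a = c + x and b = c + y, equal sums force e = c + x + y, and the sums of squares
  then differ by 2xy.\<close>

lemma spread_squares:
  fixes a b c e :: nat
  assumes "c + e = a + b" "c < a" "a \<le> b"
  shows "a ^ 2 + b ^ 2 < c ^ 2 + e ^ 2"
proof -
  obtain x where x: "a = c + x" "0 < x" using assms(2) less_imp_add_positive by blast
  obtain y where y: "b = c + y" using assms le_iff_add by (metis less_imp_le order.trans)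
  have e: "e = c + x + y" "0 < y" using assms x y by auto
  have "c ^ 2 + e ^ 2 = a ^ 2 + b ^ 2 + 2 * (x * y)"
    unfolding x(1) y e(1) by (simp add: power2_eq_square algebra_simps)
  moreover have "0 < x * y" using x e by simp
  ultimately show ?thesis by linarith
qed

definition wsum where "wsum p n M = (\<Sum>A\<in>#M. wt p n A)"
definition wsq where "wsq p n M = (\<Sum>A\<in>#M. (wt p n A)\<^sup>2)"

lemma wsq_le: "wsq p n M \<le> (wsum p n M)\<^sup>2"
proof (induction M)
  case empty
  then show ?case by (simp add: wsq_def)
next
  case (add A M)
  then show ?case by (simp add: wsq_def wsum_def power2_eq_square algebra_simps)
qed

lemma mset_two:
  assumes "A \<in># M" "B \<in># M" "A \<noteq> B"
  obtains R where "M = {#A, B#} + R"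
proof -
  obtain M' where M': "M = add_mset A M'" using assms(1) by (rule mset_add)
  then have "B \<in># M'" using assms by simp
  then obtain R where "M' = add_mset B R" by (rule mset_add)
  then show ?thesis using that M' by simp
qed

text \<open>
  Straightening an incomparable pair spreads the weights of its two members apart without changing
  their sum, so the sum of the squared weights grows; it is bounded by the square of the sum.
\<close>

lemma Dprod_in_span_standard:
  assumes "set_mset M \<subseteq> ss_index_set p n"
  shows "Dprod p M \<in> cp.span {Dprod p N | N. standard p n N}"
  using assms
proof (induction "(wsum p n M)\<^sup>2 - wsq p n M" arbitrary: M rule: less_induct)
  case less
  define S where "S = cp.span {Dprod p N | N. standard p n N}"
  show ?case
  proof (cases "standard p n M")
    case True
    then show ?thesis by (intro cp.span_base) blast
  next
    case False
    then obtain A0 B0 where AB0: "A0 \<in># M" "B0 \<in># M" "\<not> ss_le p A0 B0" "\<not> ss_le p B0 A0"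
      using less.prems by (auto simp: standard_def)
    \<comment> \<open>Neither comparison holds, so the lighter of the two can be called A.\<close>
    obtain A B where AB: "A \<in># M" "B \<in># M" "\<not> ss_le p A B" "wt p n A \<le> wt p n B"
        by (metis AB0 nat_le_linear)
    have mem: "A \<in> ss_index_set p n" "B \<in> ss_index_set p n" using AB less.prems by auto
    obtain I k where A: "A = (I, k)" by (cases A)
    obtain I' k' where B: "B = (I', k')" by (cases B)
    \<comment> \<open>Superscripts dominate weights, so the order of the weights gives the order of
      superscripts that \<open>straighten\<close> expects.\<close>
    have "k \<le> k'"
    proof (rule ccontr)
      assume "\<not> k \<le> k'"
      then have "wt p n (I', k') < wt p n (I, k)"
        using mem(2) unfolding B by (intro wt_mono) (auto simp: ss_index_set_def)
      then show False using AB(4) by (simp add: A B)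
    qed
    then have str: "Dgen p A * Dgen p B \<in> cp.span (smaller_pairs p n (wt p n A + wt p n B) (wt p n A))"
      using straighten[of I k p n I' k'] mem AB(3) by (simp add: A B)
    have "A \<noteq> B" using AB(3) ss_le_refl[of p A] by auto
    then obtain R where R: "M = {#A, B#} + R" using mset_two AB(1,2) by metis
    have RI: "set_mset R \<subseteq> ss_index_set p n" using less.prems R by auto
    \<comment> \<open>Induction over the span carries the remaining factors R along.\<close>
    have "g * Dprod p R \<in> S"
      if "g \<in> cp.span (smaller_pairs p n (wt p n A + wt p n B) (wt p n A))" for g
      using that
    proof (induction rule: cp.span_induct)
      show "cp.subspace {g. g * Dprod p R \<in> S}"
      proof (rule cp.subspaceI)
        show "0 \<in> {g. g * Dprod p R \<in> S}" by (simp add: S_def cp.span_zero)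
        show "x + y \<in> {g. g * Dprod p R \<in> S}" if "x \<in> {g. g * Dprod p R \<in> S}" "y \<in> {g. g * Dprod p R \<in> S}" for x y
          using that cp.span_add by (simp add: S_def distrib_right)
        show "cconst c * x \<in> {g. g * Dprod p R \<in> S}" if "x \<in> {g. g * Dprod p R \<in> S}" for c x
          using that cp.span_scale by (simp add: S_def mult.assoc)
      qed
      fix g assume "g \<in> smaller_pairs p n (wt p n A + wt p n B) (wt p n A)"
      then obtain C E where CE: "g = Dgen p C * Dgen p E" "C \<in> ss_index_set p n" "E \<in> ss_index_set p n"
        "wt p n C + wt p n E = wt p n A + wt p n B" "wt p n C < wt p n A \<or> wt p n E < wt p n A"
        unfolding smaller_pairs_def by blast
      define N where "N = {#C, E#} + R"
      have eq: "wsum p n N = wsum p n M" using CE(4) by (simp add: wsum_def N_def R)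
      have "(wt p n A)\<^sup>2 + (wt p n B)\<^sup>2 < (wt p n C)\<^sup>2 + (wt p n E)\<^sup>2"
        using CE(5)
      proof
        assume "wt p n C < wt p n A"
        then show ?thesis by (rule spread_squares[OF CE(4) _ AB(4)])
      next
        assume "wt p n E < wt p n A"
        moreover have "wt p n E + wt p n C = wt p n A + wt p n B" using CE(4) by simp
        ultimately have "(wt p n A)\<^sup>2 + (wt p n B)\<^sup>2 < (wt p n E)\<^sup>2 + (wt p n C)\<^sup>2"
          using spread_squares AB(4) by blast
        then show ?thesis by simp
      qed
      then have "wsq p n M < wsq p n N" by (simp add: wsq_def N_def R)
      then have "(wsum p n N)\<^sup>2 - wsq p n N < (wsum p n M)\<^sup>2 - wsq p n M"
        using wsq_le[of p n N] unfolding eq by linarith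
      moreover have "set_mset N \<subseteq> ss_index_set p n" using CE RI by (simp add: N_def)
      ultimately have "Dprod p N \<in> S" unfolding S_def by (rule less.hyps)
      then show "g * Dprod p R \<in> S" by (simp add: N_def CE(1) mult.assoc)
    qed
    then have "(Dgen p A * Dgen p B) * Dprod p R \<in> S" using str by blast
    then show ?thesis by (simp add: S_def R mult.assoc)
  qed
qed

lemma span_mult_closed:
  assumes "\<And>x y. x \<in> S \<Longrightarrow> y \<in> S \<Longrightarrow> x * y \<in> cp.span S"
    and f: "f \<in> cp.span S" and g: "g \<in> cp.span S"
  shows "f * g \<in> cp.span S"
  using f
proof (induction rule: cp.span_induct)
  show "cp.subspace {f. f * g \<in> cp.span S}"
    using cp.span_add cp.span_scale by (intro cp.subspaceI) (auto simp: cp.span_zero distrib_right mult.assoc)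
  fix x assume x: "x \<in> S"
  show "x * g \<in> cp.span S"
    using g
  proof (induction rule: cp.span_induct)
    show "cp.subspace {g. x * g \<in> cp.span S}"
    proof (rule cp.subspaceI)
      show "0 \<in> {g. x * g \<in> cp.span S}" by (simp add: cp.span_zero)
      show "a + b \<in> {g. x * g \<in> cp.span S}"
        if "a \<in> {g. x * g \<in> cp.span S}" "b \<in> {g. x * g \<in> cp.span S}" for a b
        using that cp.span_add by (simp add: distrib_left)
      show "cconst c * a \<in> {g. x * g \<in> cp.span S}" if "a \<in> {g. x * g \<in> cp.span S}" for c a
        using that cp.span_scale[of "x * a" S c] by (simp only: mem_Collect_eq mult.left_commute[of x])
    qed
    show "x * y \<in> cp.span S" if "y \<in> S" for y using assms(1) x that .
  qed
qed

lemma plucker_carrier: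
  "carrier (plucker_alg p n) = subalg_gen cconst {D_coeff p I k |I k. length I = p \<and> set I \<subseteq> {1..n}}"
  by (simp add: plucker_alg_def graded_subalg_def)

lemma Dprod_in_plucker:
  assumes "set_mset M \<subseteq> ss_index_set p n"
  shows "Dprod p M \<in> carrier (plucker_alg p n)"
  using assms
proof (induction M)
  case empty
  show ?case using subalg_gen.scalar[of cconst 1] by (simp add: plucker_carrier)
next
  case (add A M)
  obtain I k where A: "A = (I, k)" by (cases A)
  then have "D_coeff p I k \<in> carrier (plucker_alg p n)"
    using add.prems unfolding plucker_carrier by (intro subalg_gen.gen) (auto simp: ss_index_set_def)
  then show ?case using add by (simp add: A plucker_carrier subalg_gen.mult)
qed

theorem plucker_span_standard:
  "carrier (plucker_alg p n) \<subseteq> cp.span {Dprod p M | M. standard p n M}"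
proof
  \<comment> \<open>Products of multichains need not be multichains, so closure under multiplication
    is shown for the span of all products; straightening is applied once, at the end.\<close>
  define S where "S = {Dprod p M | M. set_mset M \<subseteq> ss_index_set p n}"
  fix f assume "f \<in> carrier (plucker_alg p n)"
  then have "f \<in> cp.span S"
    unfolding plucker_carrier
  proof induction
    case (scalar c)
    have "Dprod p {#} \<in> S" unfolding S_def by (intro CollectI exI[of _ "{#}"]) simp
    then have "cconst c * Dprod p {#} \<in> cp.span S" by (rule cp.span_scale[OF cp.span_base])
    then show ?case by simp
  next
    case (gen x)
    then obtain I k where I: "x = D_coeff p I k" "length I = p" "set I \<subseteq> {1..n}" by blast
    show ?case
    proof (cases "x = 0")
      case True
      then show ?thesis by (simp add: cp.span_zero)
    next
      case False
      then obtain e where e: "(sort I, k) \<in> ss_index_set p n" "x = cconst e * D_coeff p (sort I) k"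
        using D_coeff_sort[OF I(2,3), of k] unfolding I(1) by blast
      have "Dprod p {#(sort I, k)#} \<in> S"
        unfolding S_def using e(1) by (intro CollectI exI[of _ "{#(sort I, k)#}"]) simp
      then have "cconst e * Dprod p {#(sort I, k)#} \<in> cp.span S"
        by (rule cp.span_scale[OF cp.span_base])
      moreover have "cconst e * Dprod p {#(sort I, k)#} = x" unfolding e(2) by simp
      ultimately show ?thesis by simp
    qed
  next
    case (add x y)
    then show ?case by (simp add: cp.span_add)
  next
    case (mult x y)
    show ?case
    proof (rule span_mult_closed[OF _ mult.IH])
      fix a b assume "a \<in> S" "b \<in> S"
      then obtain M N where "a = Dprod p M" "b = Dprod p N"
        "set_mset M \<subseteq> ss_index_set p n" "set_mset N \<subseteq> ss_index_set p n"
        unfolding S_def by blast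
      then have "a * b \<in> S" unfolding S_def
        by (intro CollectI exI[of _ "M + N"]) (simp add: Dprod_union)
      then show "a * b \<in> cp.span S" by (rule cp.span_base)
    qed
  qed
  moreover have "cp.span S \<subseteq> cp.span {Dprod p M | M. standard p n M}"
    by (rule cp.span_minimal) (auto simp: S_def Dprod_in_span_standard)
  ultimately show "f \<in> cp.span {Dprod p M | M. standard p n M}" by blast
qed


section \<open>Leading terms\<close>

abbreviation (input) lookup :: "('a \<Rightarrow>\<^sub>0 'b::zero) \<Rightarrow> 'a \<Rightarrow> 'b" where
  "lookup \<equiv> Poly_Mapping.lookup"

lemma finite_greatest:
  fixes lt :: "'a \<Rightarrow> 'a \<Rightarrow> bool"
  assumes "finite S" "S \<noteq> {}"
    and trans: "\<And>x y z. lt x y \<Longrightarrow> lt y z \<Longrightarrow> lt x z"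
    and total: "\<And>x y. x \<noteq> y \<Longrightarrow> lt x y \<or> lt y x"
  shows "\<exists>m\<in>S. \<forall>x\<in>S. x \<noteq> m \<longrightarrow> lt x m"
  using assms(1,2)
proof (induction S rule: finite_ne_induct)
    case (singleton x)
    then show ?case by simp
  next
    case (insert x F)
    then obtain m where m: "m \<in> F" "\<forall>y\<in>F. y \<noteq> m \<longrightarrow> lt y m" by blast
    show ?case
    proof (cases "lt x m")
      case True
      then show ?thesis using m by blast
    next
      case False
      have "x \<noteq> m" using m(1) insert(3) by blast
      then have mx: "lt m x" using total[of x m] False by blast
      have "lt y x" if "y \<in> F" for y
        using m(2) that mx trans[of y m x] by (cases "y = m") auto
      then show ?thesis by (intro bexI[of _ x]) auto
    qed
qed

section \<open>Degree reverse lexicographic orders\<close>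

lemma mdeg_add: "mdeg (a + b) = mdeg a + mdeg b"
  unfolding mdeg_def by (rule setsum_keys_plus_distrib) simp_all

lemma mdeg_0 [simp]: "mdeg 0 = 0"
  by (simp add: mdeg_def)

lemma mdeg_single [simp]: "mdeg (Poly_Mapping.single v k) = k"
  by (simp add: mdeg_def)

locale var_order =
  fixes vless :: "'v \<Rightarrow> 'v \<Rightarrow> bool"
  assumes vless_irrefl: "\<not> vless v v"
    and vless_trans: "vless u v \<Longrightarrow> vless v w \<Longrightarrow> vless u w"
    and vless_total: "u \<noteq> v \<Longrightarrow> vless u v \<or> vless v u"
begin

abbreviation mless where "mless \<equiv> degrevlex vless"

lemma mless_irrefl: "\<not> mless a a"
  by (simp add: degrevlex_def)

lemma mless_trans:
  assumes "mless a b" "mless b c"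
  shows "mless a c"
proof (cases "mdeg a < mdeg b \<or> mdeg b < mdeg c")
  case True
  then have "mdeg a < mdeg c" using assms by (auto simp: degrevlex_def)
  then show ?thesis by (simp add: degrevlex_def)
next
  case False
  then have deg: "mdeg a = mdeg b" "mdeg b = mdeg c" using assms by (auto simp: degrevlex_def)
  obtain v where v: "lookup b v < lookup a v"
    "\<And>w. vless v w \<Longrightarrow> lookup a w = lookup b w"
    using assms(1) deg by (auto simp: degrevlex_def)
  obtain u where u: "lookup c u < lookup b u"
    "\<And>w. vless u w \<Longrightarrow> lookup b w = lookup c w"
    using assms(2) deg by (auto simp: degrevlex_def)
  consider "u = v" | "vless u v" | "vless v u" using vless_total by blast
  then have "\<exists>x. lookup c x < lookup a x \<and>
      (\<forall>w. vless x w \<longrightarrow> lookup a w = lookup c w)"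
  proof cases
    case 1
    then show ?thesis using u v by (intro exI[of _ u]) auto
  next
    case 2
    then have "lookup c w = lookup a w" if "vless v w" for w
      using u(2)[of w] v(2)[of w] vless_trans[of u v w] that by simp
    then show ?thesis using u(2)[of v] v(1) 2 by (intro exI[of _ v]) auto
  next
    case 3
    then have "lookup c w = lookup a w" if "vless u w" for w
      using u(2)[of w] v(2)[of w] vless_trans[of v u w] that by simp
    then show ?thesis using v(2)[of u] u(1) 3 by (intro exI[of _ u]) auto
  qed
  then show ?thesis using deg by (simp add: degrevlex_def)
qed

text \<open>Finite supports guarantee a last variable at which two distinct monomials differ, even
  if there are infinitely many variables.\<close>

lemma mless_total:
  assumes "a \<noteq> b"
  shows "mless a b \<or> mless b a"
proof (cases "mdeg a = mdeg b")
  case False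
  then show ?thesis by (auto simp: degrevlex_def)
next
  case deg: True
  define D where "D = {v \<in> Poly_Mapping.keys a \<union> Poly_Mapping.keys b. lookup a v \<noteq> lookup b v}"
  have D: "v \<in> D \<longleftrightarrow> lookup a v \<noteq> lookup b v" for v
    by (auto simp: D_def in_keys_iff)
  have "finite D" by (simp add: D_def)
  moreover have "D \<noteq> {}"
  proof
    assume "D = {}"
    then have "lookup a v = lookup b v" for v using D by blast
    then show False using assms by (auto intro: poly_mapping_eqI)
  qed
  ultimately have "\<exists>v\<in>D. \<forall>w\<in>D. w \<noteq> v \<longrightarrow> vless w v"
    using vless_trans vless_total by (rule finite_greatest[of D vless])
  then obtain v where v: "v \<in> D" "\<And>w. w \<in> D \<Longrightarrow> w \<noteq> v \<Longrightarrow> vless w v" by blast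
  have above: "lookup a w = lookup b w" if "vless v w" for w
  proof (rule ccontr)
    assume "lookup a w \<noteq> lookup b w"
    moreover have "w \<noteq> v" using that vless_irrefl by blast
    ultimately have "vless w v" using v(2) D by blast
    then show False using vless_trans[OF that] vless_irrefl by blast
  qed
  have "lookup a v \<noteq> lookup b v" using v(1) D by blast
  then consider "lookup b v < lookup a v" | "lookup a v < lookup b v"
    by linarith
  then show ?thesis
  proof cases
    case 1
    then have "mless a b" using deg above unfolding degrevlex_def by blast
    then show ?thesis ..
  next
    case 2
    have "\<forall>w. vless v w \<longrightarrow> lookup b w = lookup a w" using above by auto
    then have "mless b a" using deg 2 unfolding degrevlex_def by auto
    then show ?thesis ..
  qed
qed

lemma mless_add: "mless a b \<Longrightarrow> mless (a + c) (b + c)"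
  by (auto simp: degrevlex_def mdeg_add lookup_add)

section \<open>Leading terms\<close>

definition below :: "'v cpoly \<Rightarrow> 'v monomial \<Rightarrow> bool" where
  "below f m \<longleftrightarrow> (\<forall>x\<in>Poly_Mapping.keys f. mless x m)"

text \<open>An explicit splitting into a leading term and a smaller remainder replaces the definite
  description in \<open>initial_term\<close>. It multiplies directly;
  \<open>initial_term_leads\<close> links the two notions.\<close>

definition leads :: "'v cpoly \<Rightarrow> 'v monomial \<Rightarrow> complex \<Rightarrow> bool" where
  "leads f m c \<longleftrightarrow> c \<noteq> 0 \<and> (\<exists>r. f = Poly_Mapping.single m c + r \<and> below r m)"

lemma below_0 [simp]: "below 0 m"
  by (simp add: below_def)

lemma below_add: "below f m \<Longrightarrow> below g m \<Longrightarrow> below (f + g) m"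
  using keys_add[of f g] by (auto simp: below_def)

lemma below_sum: "(\<And>x. x \<in> A \<Longrightarrow> below (f x) m) \<Longrightarrow> below (sum f A) m"
  by (induction A rule: infinite_finite_induct) (auto intro: below_add)

lemma below_single_mult:
  assumes "below r m"
  shows "below (Poly_Mapping.single m' c * r) (m' + m)"
  unfolding below_def
proof
  fix x assume "x \<in> Poly_Mapping.keys (Poly_Mapping.single m' c * r)"
  then obtain a b where ab: "a \<in> Poly_Mapping.keys (Poly_Mapping.single m' c)" "b \<in> Poly_Mapping.keys r" "x = a + b"
    using keys_mult by blast
  then have "a = m'" by (simp split: if_splits)
  then show "mless x (m' + m)"
    using ab assms mless_add[of b m m'] by (simp add: below_def add.commute)
qed

lemma below_mult:
  assumes "below f m" "below g m'"
  shows "below (f * g) (m + m')"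
  unfolding below_def
proof
  fix x assume "x \<in> Poly_Mapping.keys (f * g)"
  then obtain a b where ab: "a \<in> Poly_Mapping.keys f" "b \<in> Poly_Mapping.keys g" "x = a + b"
    using keys_mult by blast
  then have "mless (a + b) (m + b)" "mless (m + b) (m + m')"
    using assms mless_add[of a m b] mless_add[of b m' m] by (auto simp: below_def add.commute)
  then show "mless x (m + m')" using mless_trans ab(3) by blast
qed

lemma leads_mult:
  assumes "leads f m c" "leads g m' c'"
  shows "leads (f * g) (m + m') (c * c')"
proof -
  obtain r r' where r: "f = Poly_Mapping.single m c + r" "below r m"
    "g = Poly_Mapping.single m' c' + r'" "below r' m'" and c: "c \<noteq> 0" "c' \<noteq> 0"
    using assms unfolding leads_def by blast
  have "f * g = Poly_Mapping.single (m + m') (c * c') +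
      (Poly_Mapping.single m c * r' + Poly_Mapping.single m' c' * r + r * r')"
    unfolding r(1,3) mult_single[symmetric] by (simp add: algebra_simps)
  moreover have "below (Poly_Mapping.single m c * r' + Poly_Mapping.single m' c' * r + r * r') (m + m')"
    using below_single_mult[OF r(4), of m c] below_single_mult[OF r(2), of m' c'] below_mult[OF r(2,4)]
    by (intro below_add) (simp_all add: add.commute)
  ultimately show ?thesis using c unfolding leads_def by (metis mult_eq_0_iff)
qed

lemma leads_one: "leads 1 0 1"
  unfolding leads_def by (intro conjI exI[of _ 0]) (simp_all flip: single_one)

lemma leads_scale: "leads f m c \<Longrightarrow> a \<noteq> 0 \<Longrightarrow> leads (cconst a * f) m (a * c)"
proof -
  assume f: "leads f m c" and a: "a \<noteq> 0"
  have "leads (cconst a) 0 a"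
    unfolding leads_def using a by (intro conjI exI[of _ 0]) (simp_all add: cconst_def)
  from leads_mult[OF this f] show ?thesis by simp
qed

lemma lookup_below: "below r m \<Longrightarrow> lookup r m = 0"
proof (rule ccontr)
  assume "below r m" "lookup r m \<noteq> 0"
  then have "mless m m" by (simp add: below_def in_keys_iff)
  then show False using mless_irrefl by blast
qed

lemma leads_lookup: "leads f m c \<Longrightarrow> lookup f m = c"
  by (auto simp: leads_def lookup_add lookup_below)

lemma leads_below:
  assumes "leads f m c" "mless m m'"
  shows "below f m'"
proof -
  obtain r where r: "f = Poly_Mapping.single m c + r" "below r m" using assms by (auto simp: leads_def)
  have "below (Poly_Mapping.single m c) m'" using assms(2) by (simp add: below_def)
  moreover have "below r m'" using r(2) assms(2) mless_trans unfolding below_def by blast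
  ultimately show ?thesis unfolding r(1) by (rule below_add)
qed

lemma leads_unique:
  assumes "leads f m c" "leads f m' c'"
  shows "m = m'"
proof (rule ccontr)
  assume "m \<noteq> m'"
  then consider "mless m m'" | "mless m' m" using mless_total by blast
  then show False
  proof cases
    case 1
    then have "lookup f m' = 0" using leads_below[OF assms(1)] lookup_below by blast
    then show False using leads_lookup[OF assms(2)] assms(2) by (simp add: leads_def)
  next
    case 2
    then have "lookup f m = 0" using leads_below[OF assms(2)] lookup_below by blast
    then show False using leads_lookup[OF assms(1)] assms(1) by (simp add: leads_def)
  qed
qed

lemma leads_add_below: "leads f m c \<Longrightarrow> below g m \<Longrightarrow> leads (f + g) m c"
  unfolding leads_def using below_add by (metis add.assoc)

lemma initial_term_leads:
  assumes "leads f m c"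
  shows "initial_term mless f = Poly_Mapping.single m c"
proof -
  obtain r where r: "f = Poly_Mapping.single m c + r" "below r m" and c: "c \<noteq> 0"
    using assms by (auto simp: leads_def)
  have max: "m \<in> Poly_Mapping.keys f" "\<And>x. x \<in> Poly_Mapping.keys f \<Longrightarrow> x \<noteq> m \<Longrightarrow> mless x m"
  proof -
    show "m \<in> Poly_Mapping.keys f" using leads_lookup[OF assms] c by (simp add: in_keys_iff)
    fix x assume "x \<in> Poly_Mapping.keys f" "x \<noteq> m"
    then have "x \<in> Poly_Mapping.keys r"
      by (simp add: in_keys_iff r(1) lookup_add lookup_single_not_eq)
    then show "mless x m" using r(2) by (simp add: below_def)
  qed
  have "(THE m. m \<in> Poly_Mapping.keys f \<and> (\<forall>m'\<in>Poly_Mapping.keys f. m' \<noteq> m \<longrightarrow> mless m' m)) = m"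
  proof (rule the_equality)
    fix x assume x: "x \<in> Poly_Mapping.keys f \<and> (\<forall>m'\<in>Poly_Mapping.keys f. m' \<noteq> x \<longrightarrow> mless m' x)"
    show "x = m"
    proof (rule ccontr)
      assume "x \<noteq> m"
      then have "mless x m" "mless m x" using x max by auto
      then show False using mless_trans mless_irrefl by blast
    qed
  qed (use max in blast)
  then show ?thesis using leads_lookup[OF assms] by (simp add: initial_term_def)
qed

text \<open>Among the terms with nonzero coefficients of a linear combination, the largest leading
  monomial occurs only once, so nothing cancels it.\<close>

lemma span_leads:
  assumes lead: "\<And>i. i \<in> J \<Longrightarrow> leads (P i) (e i) (c i)" and inj: "inj_on e J"
    and f: "f \<in> cp.span (P ` J)" "f \<noteq> 0"
  obtains i a where "i \<in> J" "leads f (e i) a"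
proof -
  obtain t r where t: "finite t" "t \<subseteq> P ` J" "f = (\<Sum>a\<in>t. cconst (r a) * a)"
    using f(1) unfolding cp.span_explicit by blast
  define t' where "t' = {a \<in> t. r a \<noteq> 0}"
  have f': "f = (\<Sum>a\<in>t'. cconst (r a) * a)"
    unfolding t(3) t'_def using t(1) by (intro sum.mono_neutral_right) auto
  have fin: "finite t'" using t(1) by (simp add: t'_def)
  \<comment> \<open>The span is that of a set, so an index has to be chosen for each of the elements
    that occur.\<close>
  have "\<exists>i. i \<in> J \<and> P i = a" if "a \<in> t'" for a using that t(2) by (auto simp: t'_def)
  then obtain ix where ix: "\<And>a. a \<in> t' \<Longrightarrow> ix a \<in> J \<and> P (ix a) = a" by metis
  have "finite (e ` ix ` t')" using fin by simp
  moreover have "e ` ix ` t' \<noteq> {}" using f(2) f' by auto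
  ultimately have "\<exists>m\<in>e ` ix ` t'. \<forall>x\<in>e ` ix ` t'. x \<noteq> m \<longrightarrow> mless x m"
    using mless_trans mless_total by (rule finite_greatest[of "e ` ix ` t'" mless])
  then obtain m where m: "m \<in> e ` ix ` t'" "\<And>x. x \<in> e ` ix ` t' \<Longrightarrow> x \<noteq> m \<Longrightarrow> mless x m"
    by blast
  then obtain b where b: "b \<in> t'" "m = e (ix b)" by blast
  have "leads b m (c (ix b))" using lead[of "ix b"] ix[OF b(1)] b(2) by simp
  then have 1: "leads (cconst (r b) * b) m (r b * c (ix b))"
    using b(1) by (intro leads_scale) (simp_all add: t'_def)
  have "below (cconst (r a) * a) m" if a: "a \<in> t' - {b}" for a
  proof -
    have ra: "r a \<noteq> 0" "ix a \<in> J" "P (ix a) = a" using a ix by (auto simp: t'_def)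
    have "ix a \<noteq> ix b" using ra(3) ix[OF b(1)] a by auto
    then have "e (ix a) \<noteq> m" using inj ra(2) ix[OF b(1)] unfolding b(2) by (meson inj_onD)
    then have "mless (e (ix a)) m" using m(2) a by blast
    moreover have "leads (cconst (r a) * a) (e (ix a)) (r a * c (ix a))"
      using lead[OF ra(2)] ra by (intro leads_scale) simp_all
    ultimately show ?thesis using leads_below by blast
  qed
  then have "below (\<Sum>a\<in>t' - {b}. cconst (r a) * a) m" by (rule below_sum)
  then have "leads (cconst (r b) * b + (\<Sum>a\<in>t' - {b}. cconst (r a) * a)) m (r b * c (ix b))"
    by (rule leads_add_below[OF 1])
  moreover have "f = cconst (r b) * b + (\<Sum>a\<in>t' - {b}. cconst (r a) * a)"
    unfolding f' by (rule sum.remove[OF fin b(1)])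
  ultimately show ?thesis using that[of "ix b"] ix[OF b(1)] b(2) by simp
qed

end

interpretation zo: var_order zvar_less
proof
  show "\<not> zvar_less v v" for v by (cases v) auto
  show "zvar_less u w" if "zvar_less u v" "zvar_less v w" for u v w
    using that by (cases u; cases v; cases w) auto
  show "zvar_less u v \<or> zvar_less v u" if "u \<noteq> v" for u v
    using that by (cases u; cases v) auto
qed


section \<open>The leading monomial of a minor coefficient\<close>

text \<open>
  With rows (i, k) numbered consecutively as k p + i (i counted from 0), the leading monomial of
  $D_I^{(k)}$ is the antidiagonal of the minor with the rows k, ..., k + p - 1. Row i of this
  window lies in block \<open>lblk p k i\<close> and meets the antidiagonal in column position \<open>lpos p k i\<close>.
\<close>

definition lblk :: "nat \<Rightarrow> nat \<Rightarrow> nat \<Rightarrow> nat" where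
  "lblk p k i = (k + p - 1 - i) div p"

definition lpos :: "nat \<Rightarrow> nat \<Rightarrow> nat \<Rightarrow> nat" where
  "lpos p k i = (if i < p then k + p - 1 - (lblk p k i * p + i) else i)"

text \<open>The monomial of one term of the fully expanded coefficient: \<sigma> is the Leibniz
  permutation and v distributes the superscript over the rows.\<close>

definition zmon :: "nat \<Rightarrow> nat list \<Rightarrow> (nat \<Rightarrow> nat) \<Rightarrow> (nat \<Rightarrow> nat) \<Rightarrow> zvar monomial" where
  "zmon p I \<sigma> v = (\<Sum>i = 0..<p. Poly_Mapping.single (i + 1, I ! \<sigma> i, v i) 1)"

definition lmon :: "nat \<Rightarrow> nat list \<times> nat \<Rightarrow> zvar monomial" where
  "lmon p A = zmon p (fst A) (lpos p (snd A)) (lblk p (snd A))"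

lemma lblk_bounds:
  assumes "i < p"
  shows "k \<le> lblk p k i * p + i" "lblk p k i * p + i < k + p"
proof -
  define x where "x = k + p - 1 - i"
  have "x = x div p * p + x mod p" by simp
  moreover have "x mod p < p" using assms by simp
  ultimately show "k \<le> lblk p k i * p + i" "lblk p k i * p + i < k + p"
    using assms unfolding lblk_def x_def by linarith+
qed

lemma lblk_greatest:
  assumes "i < p" "v * p + i < k + p"
  shows "v \<le> lblk p k i"
proof -
  have "v * p \<le> k + p - 1 - i" using assms by simp
  then have "v * p div p \<le> lblk p k i" unfolding lblk_def by (rule div_le_mono)
  then show ?thesis using assms(1) by simp
qed

lemma lpos_row:
  assumes "i < p"
  shows "lpos p k i < p" "lblk p k i * p + i + lpos p k i = k + p - 1"
  using lblk_bounds[OF assms, of k] assms by (auto simp: lpos_def)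

text \<open>Equal positions mean equal row numbers in the window, and a row number modulo p
  determines the row. The identity outside \<open>{0..<p}\<close> is what \<open>permutes\<close>
  demands.\<close>

lemma lpos_permutes: "lpos p k permutes {0..<p}"
proof (rule bij_imp_permutes)
  have inj: "inj_on (lpos p k) {0..<p}"
  proof (rule inj_onI)
    fix i j assume "i \<in> {0..<p}" "j \<in> {0..<p}" and eq: "lpos p k i = lpos p k j"
    then have ij: "i < p" "j < p" by auto
    then have "lblk p k i * p + i = lblk p k j * p + j"
      using lpos_row(2)[OF ij(1), of k] lpos_row(2)[OF ij(2), of k] eq by linarith
    then have "(lblk p k i * p + i) mod p = (lblk p k j * p + j) mod p" by simp
    then show "i = j" using ij by simp
  qed
  moreover have "lpos p k ` {0..<p} \<subseteq> {0..<p}" using lpos_row(1) by auto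
  ultimately show "bij_betw (lpos p k) {0..<p} {0..<p}"
    by (simp add: bij_betw_def endo_inj_surj)
qed (simp add: lpos_def)

text \<open>The antidiagonal equation in \<open>lpos_row\<close> is summed over all rows; since
  \<open>lpos\<close> is a permutation, rows and positions contribute p (p - 1) / 2 each.\<close>

lemma sum_lblk:
  assumes "0 < p"
  shows "(\<Sum>i = 0..<p. lblk p k i) = k"
proof -
  have "(\<Sum>i = 0..<p. lpos p k i) = (\<Sum>i = 0..<p. i)"
    using sum.permute[OF lpos_permutes[of p k], of "\<lambda>i. i"] by (simp add: o_def)
  moreover have "(\<Sum>i = 0..<p. lblk p k i * p + i + lpos p k i) = (\<Sum>i = 0..<p. k + p - 1)"
    by (intro sum.cong refl lpos_row(2)) simp
  ultimately have "(\<Sum>i = 0..<p. lblk p k i) * p + 2 * (\<Sum>i = 0..<p. i) = p * (k + p - 1)"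
    by (simp add: sum.distrib sum_distrib_right)
  moreover have "2 * (\<Sum>i = 0..<p. i) = p * (p - 1)"
  proof -
    have "2 * (\<Sum>i = 0..<q. i) = q * (q - 1)" for q :: nat
    proof (induction q)
      case (Suc q)
      then show ?case by (cases q) (simp_all add: algebra_simps)
    qed simp
    then show ?thesis .
  qed
  moreover have "p * (k + p - 1) = p * (p - 1) + k * p"
    using assms by (cases p) (simp_all add: algebra_simps)
  ultimately show ?thesis using assms by simp
qed

lemma prod_cvar: "(\<Prod>i\<in>A. cvar (f i)) = Poly_Mapping.single (\<Sum>i\<in>A. Poly_Mapping.single (f i) 1) 1"
  by (induction A rule: infinite_finite_induct) (simp_all add: cvar_def mult_single)

lemma mdeg_sum: "mdeg (sum f A) = (\<Sum>x\<in>A. mdeg (f x))"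
  by (induction A rule: infinite_finite_induct) (simp_all add: mdeg_add)

lemma mdeg_zmon: "mdeg (zmon p I \<sigma> v) = p"
  by (simp add: zmon_def mdeg_sum)

lemma lookup_zmon:
  "lookup (zmon p I \<sigma> v) x = (if \<exists>i<p. x = (i + 1, I ! \<sigma> i, v i) then 1 else 0)"
proof (cases "\<exists>i<p. x = (i + 1, I ! \<sigma> i, v i)")
  case True
  then obtain i where i: "i < p" "x = (i + 1, I ! \<sigma> i, v i)" by blast
  have "lookup (zmon p I \<sigma> v) x = (\<Sum>j = 0..<p. if j = i then 1 else 0)"
    unfolding zmon_def lookup_sum i(2) by (intro sum.cong refl) (auto simp: lookup_single when_def)
  then show ?thesis using True i(1) by simp
next
  case False
  have "lookup (zmon p I \<sigma> v) x = (\<Sum>j = 0..<p. 0)"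
    unfolding zmon_def lookup_sum
    by (intro sum.cong refl) (use False in \<open>auto simp: lookup_single when_def\<close>)
  then show ?thesis using False by simp
qed

text \<open>Large superscripts come late in the order of the variables and make a monomial small, so
  the largest term spreads k evenly over the rows; among columns, later rows of the window prefer
  those further left. The proof assumes the opposite comparison and studies its deciding variable x,
  which lies on the antidiagonal in some row i0.\<close>

lemma zmon_less_lmon:
  assumes I: "length I = p" "sorted_wrt (<) I" and \<sigma>: "\<sigma> permutes {0..<p}"
    and v: "(\<Sum>i = 0..<p. v i) = k" and ne: "\<exists>i<p. \<sigma> i \<noteq> lpos p k i \<or> v i \<noteq> lblk p k i"
  shows "ss_less (zmon p I \<sigma> v) (lmon p (I, k))"
proof -
  have p: "0 < p" using ne by auto
  have nth_less: "I ! a < I ! b \<longleftrightarrow> a < b" if "a < p" "b < p" for a b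
    using sorted_wrt_nth_less[OF I(2), of a b] sorted_wrt_nth_less[OF I(2), of b a] that I(1)
    by (cases a b rule: linorder_cases) auto
  have nth_eq: "I ! a = I ! b \<longleftrightarrow> a = b" if "a < p" "b < p" for a b
    using nth_less[of a b] nth_less[of b a] that by (cases a b rule: linorder_cases) auto
  have \<sigma>p: "\<sigma> i < p" if "i < p" for i using permutes_in_image[OF \<sigma>, of i] that by simp
  note lp = lpos_row(1)[of _ p k]
  have mem: "lookup (lmon p (I, k)) x = (if \<exists>i<p. x = (i + 1, I ! lpos p k i, lblk p k i) then 1 else 0)" for x
    unfolding lmon_def by (simp add: lookup_zmon)
  have "zmon p I \<sigma> v \<noteq> lmon p (I, k)"
  proof
    assume eq: "zmon p I \<sigma> v = lmon p (I, k)"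
    obtain i where i: "i < p" "\<sigma> i \<noteq> lpos p k i \<or> v i \<noteq> lblk p k i" using ne by blast
    have "lookup (zmon p I \<sigma> v) (i + 1, I ! \<sigma> i, v i) = 1"
      unfolding lookup_zmon using i(1) by auto
    then have "\<exists>j<p. (i + 1, I ! \<sigma> i, v i) = (j + 1, I ! lpos p k j, lblk p k j)"
      unfolding eq mem by (simp split: if_splits)
    then show False using i nth_eq[OF \<sigma>p[OF i(1)] lp[OF i(1)]] by auto
  qed
  moreover have "\<not> ss_less (lmon p (I, k)) (zmon p I \<sigma> v)"
  proof
    assume "ss_less (lmon p (I, k)) (zmon p I \<sigma> v)"
    moreover have "mdeg (lmon p (I, k)) = mdeg (zmon p I \<sigma> v)"
      by (simp only: lmon_def mdeg_zmon)
    ultimately have "\<exists>x. lookup (zmon p I \<sigma> v) x < lookup (lmon p (I, k)) x \<and>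
        (\<forall>w. zvar_less x w \<longrightarrow> lookup (lmon p (I, k)) w = lookup (zmon p I \<sigma> v) w)"
      unfolding ss_less_def degrevlex_def by (simp only: less_irrefl simp_thms)
    then obtain x where x: "lookup (zmon p I \<sigma> v) x < lookup (lmon p (I, k)) x"
      and above: "\<And>w. zvar_less x w \<Longrightarrow> lookup (lmon p (I, k)) w = lookup (zmon p I \<sigma> v) w"
      by blast
    from x have "\<exists>i<p. x = (i + 1, I ! lpos p k i, lblk p k i)"
      unfolding mem by (simp split: if_splits)
    then obtain i0 where i0: "i0 < p" "x = (i0 + 1, I ! lpos p k i0, lblk p k i0)" by blast
    have xV: "x \<noteq> (i + 1, I ! \<sigma> i, v i)" if "i < p" for i
      using x that unfolding lookup_zmon mem by (auto split: if_splits)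
    define gr where "gr = (\<lambda>i. lblk p k i * p + i)"
    have gr: "gr i + lpos p k i = k + p - 1" if "i < p" for i
      using lpos_row(2)[OF that] by (simp add: gr_def)
    have block: "a * p + i < b * p + j \<longleftrightarrow> a < b \<or> a = b \<and> i < j" if "i < p" "j < p" for a b i j :: nat
    proof (cases a b rule: linorder_cases)
      case less
      then have "Suc a * p \<le> b * p" by (intro mult_le_mono1) simp
      then show ?thesis using less that by simp
    next
      case greater
      then have "Suc b * p \<le> a * p" by (intro mult_le_mono1) simp
      then show ?thesis using greater that by simp
    qed simp
    \<comment> \<open>Window rows after i0 have their antidiagonal variables later than x, where
      both monomials agree.\<close>
    have hi: "\<sigma> i = lpos p k i \<and> v i = lblk p k i" if i: "i < p" "gr i0 < gr i" for i
    proof -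
      have "zvar_less x (i + 1, I ! lpos p k i, lblk p k i)"
        using i block[OF i0(1) i(1)] by (auto simp: i0(2) gr_def)
      moreover have "lookup (lmon p (I, k)) (i + 1, I ! lpos p k i, lblk p k i) = 1"
        unfolding mem using i(1) by auto
      ultimately have "lookup (zmon p I \<sigma> v) (i + 1, I ! lpos p k i, lblk p k i) = 1"
        using above by simp
      then have "\<exists>j<p. (i + 1, I ! lpos p k i, lblk p k i) = (j + 1, I ! \<sigma> j, v j)"
        unfolding lookup_zmon by (simp split: if_splits)
      then show ?thesis using nth_eq[OF \<sigma>p[OF i(1)] lp[OF i(1)]] by auto
    qed
    \<comment> \<open>In the other rows, a variable later than x would occur in both monomials and
      hence be the antidiagonal one of its row, which is not later than x.\<close>
    have lo: "zvar_less (i + 1, I ! \<sigma> i, v i) x" if i: "i < p" "\<not> gr i0 < gr i" for i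
    proof (rule ccontr)
      assume "\<not> zvar_less (i + 1, I ! \<sigma> i, v i) x"
      then have less: "zvar_less x (i + 1, I ! \<sigma> i, v i)"
        using zo.vless_total[OF xV[OF i(1)]] by blast
      moreover have "lookup (zmon p I \<sigma> v) (i + 1, I ! \<sigma> i, v i) = 1"
        unfolding lookup_zmon using i(1) by auto
      ultimately have "lookup (lmon p (I, k)) (i + 1, I ! \<sigma> i, v i) = 1"
        using above by simp
      then have "\<exists>j<p. (i + 1, I ! \<sigma> i, v i) = (j + 1, I ! lpos p k j, lblk p k j)"
        unfolding mem by (simp split: if_splits)
      then have eq: "(i + 1, I ! \<sigma> i, v i) = (i + 1, I ! lpos p k i, lblk p k i)" by auto
      then have "zvar_less x (i + 1, I ! lpos p k i, lblk p k i)" using less by simp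
      then have "lblk p k i0 < lblk p k i \<or> lblk p k i0 = lblk p k i \<and> i0 < i \<or>
          i = i0 \<and> I ! lpos p k i0 < I ! lpos p k i"
        by (auto simp: i0(2))
      then show False using i(2) block[OF i0(1) i(1)] unfolding gr_def by auto
    qed
    have le: "v i \<le> lblk p k i" if i: "i < p" for i
    proof (cases "gr i0 < gr i")
      case True
      then show ?thesis using hi[OF i] by simp
    next
      case False
      then have "v i < lblk p k i0 \<or> v i = lblk p k i0 \<and> i \<le> i0"
        using lo[OF i] by (auto simp: i0(2))
      then have "v i * p + i \<le> gr i0"
        using block[OF i i0(1), of "v i" "lblk p k i0"] unfolding gr_def by (cases "i = i0") auto
      also have "\<dots> < k + p" using lblk_bounds(2)[OF i0(1)] by (simp add: gr_def)
      finally show ?thesis by (rule lblk_greatest[OF i])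
    qed
    \<comment> \<open>Each superscript is bounded by that of the antidiagonal, and both families add
      up to k.\<close>
    have "v i = lblk p k i" if i: "i < p" for i
    proof (rule ccontr)
      assume "v i \<noteq> lblk p k i"
      then have "(\<Sum>i = 0..<p. v i) < (\<Sum>i = 0..<p. lblk p k i)"
        using le i by (intro sum_strict_mono_ex1) (auto intro!: bexI[of _ i] simp: order.strict_iff_order)
      then show False using v sum_lblk[OF p] by simp
    qed
    then have "I ! \<sigma> i0 < I ! lpos p k i0"
      using lo[OF i0(1)] i0(1) by (simp add: i0(2))
    then have lt: "\<sigma> i0 < lpos p k i0" using nth_less \<sigma>p lp i0(1) by simp
    \<comment> \<open>Row i0 would need a column further left, but those are taken by the later rows
      of the window.\<close>
    have "\<sigma> i0 \<in> lpos p k ` {0..<p}" using permutes_image[OF lpos_permutes] \<sigma>p[OF i0(1)] by simp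
    then obtain i where i: "i < p" "\<sigma> i0 = lpos p k i" by auto
    then have "gr i0 < gr i" using gr[OF i(1)] gr[OF i0(1)] lt by linarith
    then have "\<sigma> i = \<sigma> i0" using hi[OF i(1)] i(2) by simp
    then have "i = i0" using permutes_inj[OF \<sigma>] by (simp add: inj_eq)
    then show False using \<open>gr i0 < gr i\<close> by simp
  qed
  ultimately show ?thesis using zo.mless_total unfolding ss_less_def by blast
qed

text \<open>The lists in \<open>natpermute k p\<close> distribute the exponent k over the p series
  in a Leibniz product.\<close>

lemma D_coeff_expand:
  assumes "0 < p"
  shows "D_coeff p I k = (\<Sum>\<sigma> | \<sigma> permutes {0..<p}. \<Sum>v\<in>natpermute k p.
    signof \<sigma> * Poly_Mapping.single (zmon p I \<sigma> (\<lambda>i. v ! i)) 1)"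
proof -
  obtain m where m: "p = Suc m" using assms by (cases p) auto
  have "fps_nth (\<Prod>i = 0..<p. z_series (i + 1) (I ! \<sigma> i)) k =
      (\<Sum>v\<in>natpermute k p. Poly_Mapping.single (zmon p I \<sigma> (\<lambda>i. v ! i)) 1)" for \<sigma>
    unfolding zmon_def prod_cvar[symmetric] m atLeastLessThanSuc_atLeastAtMost
    by (subst fps_prod_nth) (simp add: z_series_def)
  then show ?thesis
    unfolding D_coeff_eq_minor minor_def fps_sum_nth signof_mult_nth by (simp only: sum_distrib_left)
qed

text \<open>Only the antidiagonal permutation with the superscripts \<open>lblk\<close> yields this
  monomial. Every other term is strictly smaller, so the coefficient is a sign and nothing cancels
  it.\<close>

lemma leads_D_coeff:
  assumes "(I, k) \<in> ss_index_set p n" "0 < p"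
  shows "\<exists>c. zo.leads (D_coeff p I k) (lmon p (I, k)) c"
proof -
  have I: "length I = p" "sorted_wrt (<) I" using assms by (auto simp: ss_index_set_def)
  define v0 where "v0 = map (lblk p k) [0..<p]"
  define P where "P = {\<sigma>. \<sigma> permutes {0..<p}} \<times> natpermute k p"
  define t :: "(nat \<Rightarrow> nat) \<times> nat list \<Rightarrow> zvar cpoly" where
    "t = (\<lambda>(\<sigma>, v). signof \<sigma> * Poly_Mapping.single (zmon p I \<sigma> (\<lambda>i. v ! i)) 1)"
  have tsingle: "t (\<sigma>, v) = Poly_Mapping.single (zmon p I \<sigma> (\<lambda>i. v ! i)) (signof \<sigma>)" for \<sigma> v
    by (simp add: t_def sign_def single_uminus)
  have fin: "finite P" unfolding P_def by (simp add: finite_permutations natpermute_finite)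
  have "sum_list v0 = k" using sum_lblk[OF assms(2), of k] by (simp add: v0_def interv_sum_list_conv_sum_set_nat)
  then have mem: "(lpos p k, v0) \<in> P"
    by (simp add: P_def lpos_permutes natpermute_def v0_def)
  have "D_coeff p I k = sum t P"
    unfolding D_coeff_expand[OF assms(2)] P_def t_def by (simp add: sum.cartesian_product)
  also have "\<dots> = t (lpos p k, v0) + sum t (P - {(lpos p k, v0)})"
    by (rule sum.remove[OF fin mem])
  also have "t (lpos p k, v0) = Poly_Mapping.single (lmon p (I, k)) (signof (lpos p k))"
  proof -
    have "zmon p I (lpos p k) (\<lambda>i. v0 ! i) = lmon p (I, k)"
      unfolding lmon_def zmon_def by (simp add: v0_def)
    then show ?thesis by (simp add: tsingle)
  qed
  finally have D: "D_coeff p I k = Poly_Mapping.single (lmon p (I, k)) (signof (lpos p k)) + sum t (P - {(lpos p k, v0)})" .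
  have "zo.below (sum t (P - {(lpos p k, v0)})) (lmon p (I, k))"
  proof (rule zo.below_sum)
    fix x assume x: "x \<in> P - {(lpos p k, v0)}"
    obtain \<sigma> v where xv: "x = (\<sigma>, v)" by (cases x)
    have \<sigma>: "\<sigma> permutes {0..<p}" and v: "length v = p" "sum_list v = k"
      using x by (auto simp: xv P_def natpermute_def)
    have "\<exists>i<p. \<sigma> i \<noteq> lpos p k i \<or> v ! i \<noteq> lblk p k i"
    proof (rule ccontr)
      assume *: "\<not> (\<exists>i<p. \<sigma> i \<noteq> lpos p k i \<or> v ! i \<noteq> lblk p k i)"
      have "\<sigma> i = lpos p k i" for i
        using * permutes_not_in[OF \<sigma>, of i] by (cases "i < p") (auto simp: lpos_def)
      moreover have "v = v0" using * v(1) by (intro nth_equalityI) (auto simp: v0_def)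
      ultimately show False using x xv by auto
    qed
    moreover have "(\<Sum>i = 0..<p. v ! i) = k" using v by (simp add: sum_list_sum_nth)
    ultimately have "ss_less (zmon p I \<sigma> (\<lambda>i. v ! i)) (lmon p (I, k))"
      using zmon_less_lmon[OF I \<sigma>] by blast
    then show "zo.below (t x) (lmon p (I, k))"
      unfolding xv tsingle zo.below_def ss_less_def by (simp split: if_splits)
  qed
  moreover have "(signof (lpos p k) :: complex) \<noteq> 0" by (simp add: sign_def)
  ultimately show ?thesis unfolding zo.leads_def using D by blast
qed

lemma leads_Dprod:
  assumes "0 < p" "set_mset M \<subseteq> ss_index_set p n"
  shows "\<exists>c. zo.leads (Dprod p M) (\<Sum>A\<in>#M. lmon p A) c"
  using assms(2)
proof (induction M)
  case empty
  then show ?case using zo.leads_one by auto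
next
  case (add A M)
  then obtain c where c: "zo.leads (Dprod p M) (\<Sum>A\<in>#M. lmon p A) c" by auto
  obtain c' where c': "zo.leads (Dgen p A) (lmon p A) c'"
    using leads_D_coeff[of "fst A" "snd A" p n] add.prems assms(1) by auto
  show ?case using zo.leads_mult[OF c' c] by auto
qed


section \<open>Order ideals and generators\<close>

text \<open>
  The generator $I^{(k)}$ is encoded by the weakly decreasing function that is infinite (encoded
  as n + 1) in the rows up to k, runs through the entries of I backwards in the next p rows and
  vanishes afterwards. The relation \<open>ss_le\<close> is the pointwise order of these functions.
\<close>

fun row_entry :: "nat \<Rightarrow> nat \<Rightarrow> nat list \<times> nat \<Rightarrow> nat \<Rightarrow> nat" where
  "row_entry p n (I, k) r = (if r \<le> k then n + 1 else if r \<le> k + p then I ! (k + p - r) else 0)"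

text \<open>Row i is filled as long as the offset j - i is below the row entry. Since the entry in
  position a (from 0) of an increasing tuple is at least a + 1, cells with j \<le> p would be filled
  for every generator, which fits their absence from the poset; the tuple 1, ..., p with superscript
  0 yields the empty ideal.\<close>

definition ideal_of :: "nat \<Rightarrow> nat \<Rightarrow> nat list \<times> nat \<Rightarrow> (nat \<times> nat) set" where
  "ideal_of p n A = {(i, j) \<in> Q_set p n. j < i + row_entry p n A i}"

lemma strict_sorted_nth_diff:
  fixes I :: "nat list"
  assumes "sorted_wrt (<) I" "a \<le> b" "b < length I"
  shows "I ! a + (b - a) \<le> I ! b"
  using assms(2,3)
proof (induction b rule: dec_induct)
  case (step b)
  then have "I ! b < I ! Suc b" using sorted_wrt_nth_less[OF assms(1)] by simp
  then show ?case using step by simp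
qed simp

lemma ss_index_nth:
  assumes "(I, k) \<in> ss_index_set p n"
  shows "a < p \<Longrightarrow> a + 1 \<le> I ! a" "a < p \<Longrightarrow> I ! a + (p - 1 - a) \<le> n"
    "a \<le> b \<Longrightarrow> b < p \<Longrightarrow> I ! a + (b - a) \<le> I ! b"
proof -
  have I: "length I = p" "sorted_wrt (<) I" "set I \<subseteq> {1..n}" using assms by (auto simp: ss_index_set_def)
  have rng: "1 \<le> I ! a" "I ! a \<le> n" if "a < p" for a
    using subsetD[OF I(3) nth_mem[of a I]] that I(1) by auto
  show diff: "a \<le> b \<Longrightarrow> b < p \<Longrightarrow> I ! a + (b - a) \<le> I ! b" for a b
    using strict_sorted_nth_diff[OF I(2)] I(1) by simp
  show "a < p \<Longrightarrow> a + 1 \<le> I ! a" using diff[of 0 a] rng(1)[of 0] by simp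
  show "I ! a + (p - 1 - a) \<le> n" if a: "a < p"
  proof -
    have "a \<le> p - 1" "p - 1 < p" using a by auto
    then show ?thesis using diff[of a "p - 1"] rng(2)[of "p - 1"] by linarith
  qed
qed

lemma finite_Q_rows: "finite {(i, j) \<in> Q_set p n. i \<le> r}"
  by (rule finite_subset[of _ "{..r} \<times> {..<r + n}"]) (auto simp: Q_set_def)

lemma row_entry_pos: "0 < row_entry p n (I, k) r \<Longrightarrow> r \<le> k + p"
  by (simp split: if_splits)

text \<open>The clauses of \<open>Q_le\<close> are treated separately. Going down by p rows leads
  into the full rows, since nothing lies beyond row k + p. Going down by n - p columns leads to a
  column of at most k + p, and every partial row reaches that far. In the componentwise clause the
  entries of the tuple grow at least as fast as the row number decreases.\<close>

lemma ideal_of_in_finite_ideals: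
  assumes A: "A \<in> ss_index_set p n" and p: "0 < p" "p < n"
  shows "ideal_of p n A \<in> finite_ideals p n"
proof -
  obtain I k where Ik: "A = (I, k)" by (cases A)
  note nth = ss_index_nth[OF A[unfolded Ik]]
  have down: "(i1, j1) \<in> ideal_of p n A"
    if q2: "(i2, j2) \<in> ideal_of p n A" and q1: "(i1, j1) \<in> Q_set p n" and le: "Q_le p n (i1, j1) (i2, j2)"
    for i1 j1 i2 j2
  proof -
    have Q1: "1 \<le> i1" "p + 1 \<le> j1" "i1 \<le> j1" "j1 < i1 + n" using q1 by (auto simp: Q_set_def)
    have Q2: "1 \<le> i2" "p + 1 \<le> j2" "i2 \<le> j2" "j2 < i2 + n" and lt2: "j2 < i2 + row_entry p n (I, k) i2"
      using q2 by (auto simp: Q_set_def ideal_of_def Ik)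
    have i2: "i2 \<le> k + p" using lt2 Q2(3) by (intro row_entry_pos[of p n I]) linarith
    have "j1 < i1 + row_entry p n (I, k) i1"
    proof (cases "i1 \<le> k")
      case True
      then show ?thesis using Q1(4) by simp
    next
      case ki1: False
      \<comment> \<open>The entry in position k + p - i1 is at least k + p - i1 + 1, so row i1
        extends through column k + p.\<close>
      have low: "j1 < i1 + row_entry p n (I, k) i1" if "j1 \<le> k + p"
      proof -
        have "k + p - i1 < p" "i1 \<le> k + p" using ki1 Q1(3) that by auto
        then show ?thesis using nth(1)[of "k + p - i1"] that ki1 by simp
      qed
      have "\<not> i1 + p \<le> i2" using ki1 i2 by linarith
      then consider "i1 \<le> i2" "j1 \<le> j2" | "j1 + (n - p) \<le> j2" using le by auto
      then show ?thesis
      proof cases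
        case 1
        then have 2: "\<not> i2 \<le> k" using ki1 by simp
        have "I ! (k + p - i2) + ((k + p - i1) - (k + p - i2)) \<le> I ! (k + p - i1)"
          using 1 ki1 i2 by (intro nth(3)) auto
        then show ?thesis using 1 2 ki1 i2 lt2 by simp
      next
        case 2
        show ?thesis
        proof (rule low, cases "i2 \<le> k")
          case True
          then show "j1 \<le> k + p" using 2 Q2(4) p by linarith
        next
          case False
          then have a: "k + p - i2 < p" using p by auto
          have "j2 < i2 + I ! (k + p - i2)" using lt2 False i2 by simp
          moreover have "I ! (k + p - i2) + (p - 1 - (k + p - i2)) \<le> n" by (rule nth(2)[OF a])
          ultimately show "j1 \<le> k + p" using 2 False i2 p by linarith
        qed
      qed
    qed
    then show ?thesis using q1 by (simp add: ideal_of_def Ik)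
  qed
  have "ideal_of p n A \<subseteq> {(i, j) \<in> Q_set p n. i \<le> k + p}"
  proof
    fix q assume q: "q \<in> ideal_of p n A"
    obtain i j where ij: "q = (i, j)" by (cases q)
    then have "i \<le> j" "j < i + row_entry p n (I, k) i" using q by (auto simp: ideal_of_def Q_set_def Ik)
    then have "i \<le> k + p" by (intro row_entry_pos[of p n I]) linarith
    then show "q \<in> {(i, j) \<in> Q_set p n. i \<le> k + p}" using q by (auto simp: ij ideal_of_def)
  qed
  then have "finite (ideal_of p n A)" using finite_Q_rows by (rule finite_subset)
  moreover have "ideal_of p n A \<subseteq> Q_set p n" by (auto simp: ideal_of_def)
  ultimately show ?thesis using down unfolding finite_ideals_def by fast
qed

text \<open>The condition i' - i = k' - k says that both entries stand in the same row r = k + p -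
  i. For the converse, superscripts are tested on the diagonal cell (k + p, k + p) and entries on
  the last cell of the row.\<close>

lemma ss_le_iff_ideal_of:
  assumes A: "A \<in> ss_index_set p n" and B: "B \<in> ss_index_set p n" and p: "0 < p" "p < n"
  shows "ss_le p A B \<longleftrightarrow> ideal_of p n A \<subseteq> ideal_of p n B"
proof -
  obtain I k where Ik: "A = (I, k)" by (cases A)
  obtain I' k' where Ik': "B = (I', k')" by (cases B)
  note nth = ss_index_nth[OF A[unfolded Ik]]
  note nth' = ss_index_nth[OF B[unfolded Ik']]
  have bound: "row_entry p n (I, k) r \<le> n + 1" for r
  proof (cases "k < r \<and> r \<le> k + p")
    case True
    then have "k + p - r < p" by auto
    then show ?thesis using nth(2)[of "k + p - r"] True by simp
  qed auto
  show ?thesis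
  proof
    assume le: "ss_le p A B"
    have "row_entry p n (I, k) r \<le> row_entry p n (I', k') r" for r
    proof (cases "k' < r \<and> r \<le> k + p")
      case True
      have "k \<le> k'" using le by (simp add: Ik Ik')
      moreover have "I ! (k + p - r) \<le> I' ! (k' + p - r)"
        using le True \<open>k \<le> k'\<close> unfolding Ik Ik' ss_le.simps by auto
      ultimately show ?thesis using True by simp
    next
      case False
      have "k \<le> k'" using le by (simp add: Ik Ik')
      then show ?thesis using False bound[of r] by auto
    qed
    then show "ideal_of p n A \<subseteq> ideal_of p n B"
      unfolding ideal_of_def Ik Ik' by (auto intro: order.strict_trans2 add_left_mono)
  next
    assume sub: "ideal_of p n A \<subseteq> ideal_of p n B"
    have kk': "k \<le> k'"
    proof (rule ccontr)
      assume "\<not> k \<le> k'"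
      moreover have "1 \<le> I ! 0" using nth(1)[of 0] p by simp
      ultimately have "(k + p, k + p) \<in> ideal_of p n A"
        using p by (simp add: ideal_of_def Ik Q_set_def)
      then have "(k + p, k + p) \<in> ideal_of p n B" using sub by blast
      then have "0 < row_entry p n (I', k') (k + p)"
        by (simp add: ideal_of_def Ik' del: row_entry.simps)
      then have "k + p \<le> k' + p" by (rule row_entry_pos)
      then show False using \<open>\<not> k \<le> k'\<close> by simp
    qed
    have "I ! i \<le> I' ! i'" if i: "i < p" "i' < p" "i' + k = i + k'" for i i'
    proof (rule ccontr)
      assume nle: "\<not> I ! i \<le> I' ! i'"
      define r where "r = k + p - i"
      have r: "r = k' + p - i'" "k < r" "k' < r" "r \<le> k + p" "k + p - r = i" "k' + p - r = i'" "r \<le> k' + p"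
        using i kk' by (auto simp: r_def)
      have "i' + 1 \<le> I' ! i'" "1 \<le> I ! i" "I ! i \<le> n" using nth'(1)[of i'] nth(1)[of i] nth(2)[of i] i by auto
      then have "(r, I ! i + r - 1) \<in> Q_set p n"
        using nle r(1-4) i by (auto simp: Q_set_def)
      moreover have "row_entry p n (I, k) r = I ! i" "row_entry p n (I', k') r = I' ! i'"
        using r by auto
      ultimately have "(r, I ! i + r - 1) \<in> ideal_of p n A" "(r, I ! i + r - 1) \<notin> ideal_of p n B"
        using nle \<open>1 \<le> I ! i\<close> unfolding ideal_of_def Ik Ik' by auto
      then show False using sub by blast
    qed
    then show "ss_le p A B" using kk' by (auto simp: Ik Ik')
  qed
qed

lemma ss_le_antisym:
  assumes A: "A \<in> ss_index_set p n" and B: "B \<in> ss_index_set p n" and le: "ss_le p A B" "ss_le p B A"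
  shows "A = B"
proof -
  obtain I k where Ik: "A = (I, k)" by (cases A)
  obtain I' k' where Ik': "B = (I', k')" by (cases B)
  have k: "k = k'" using le by (simp add: Ik Ik')
  have "I ! i = I' ! i" if "i < p" for i
    using le that unfolding Ik Ik' k ss_le.simps by (auto intro: antisym)
  then have "I = I'" using A B unfolding Ik Ik' by (intro nth_equalityI) (auto simp: ss_index_set_def)
  then show ?thesis by (simp add: Ik Ik' k)
qed

lemma inj_on_ideal_of:
  assumes "0 < p" "p < n"
  shows "inj_on (ideal_of p n) (ss_index_set p n)"
proof (rule inj_onI)
  fix A B assume A: "A \<in> ss_index_set p n" and B: "B \<in> ss_index_set p n" and eq: "ideal_of p n A = ideal_of p n B"
  then show "A = B"
    using ss_le_iff_ideal_of[OF A B assms] ss_le_iff_ideal_of[OF B A assms] by (intro ss_le_antisym) auto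
qed

lemma down_closed_interval:
  fixes R :: "nat set"
  assumes "finite R" "\<And>j. j \<in> R \<Longrightarrow> lo \<le> j" "\<And>j j'. j \<in> R \<Longrightarrow> lo \<le> j' \<Longrightarrow> j' \<le> j \<Longrightarrow> j' \<in> R"
  shows "j \<in> R \<longleftrightarrow> lo \<le> j \<and> j < lo + card R"
proof (cases "R = {}")
  case False
  have "R = {lo..Max R}"
  proof (intro equalityI subsetI)
    fix x assume "x \<in> R"
    then show "x \<in> {lo..Max R}" using assms(2)[of x] Max_ge[OF assms(1), of x] by simp
  next
    fix x assume "x \<in> {lo..Max R}"
    then show "x \<in> R" using assms(3)[OF Max_in[OF assms(1) False], of x] by simp
  qed
  moreover have "lo \<le> Max R" using assms(2) Max_in[OF assms(1) False] by blast
  ultimately obtain m where m: "R = {lo..m}" "lo \<le> m" by blast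
  then show ?thesis by auto
qed simp

text \<open>The superscript is recovered as the number of diagonal cells of J, and the tuple from
  the lengths of the next p rows.\<close>

lemma ideal_of_surj:
  assumes J: "J \<in> finite_ideals p n" and p: "0 < p" "p < n"
  shows "\<exists>A\<in>ss_index_set p n. ideal_of p n A = J"
proof -
  have fin: "finite J" and sub: "J \<subseteq> Q_set p n"
    and down: "\<And>x y. x \<in> J \<Longrightarrow> y \<in> Q_set p n \<Longrightarrow> Q_le p n y x \<Longrightarrow> y \<in> J"
    using J by (auto simp: finite_ideals_def)
  define K where "K = {i. 1 \<le> i \<and> (i + p, i + p) \<in> J}"
  have "K \<subseteq> fst ` J"
  proof
    fix i assume "i \<in> K"
    then have "(i + p, i + p) \<in> J" by (simp add: K_def)
    then have "i + p \<in> fst ` J" by force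
    then have "(i, i + p) \<in> J"
      using down[OF \<open>(i + p, i + p) \<in> J\<close>, of "(i, i + p)"] \<open>i \<in> K\<close> p by (auto simp: Q_set_def K_def)
    then show "i \<in> fst ` J" by force
  qed
  then have finK: "finite K" using fin finite_surj by blast
  define k where "k = card K"
  have K: "i \<in> K \<longleftrightarrow> 1 \<le> i \<and> i \<le> k" for i
  proof -
    have "i \<in> K \<longleftrightarrow> 1 \<le> i \<and> i < 1 + card K"
    proof (rule down_closed_interval[OF finK])
      show "1 \<le> j" if "j \<in> K" for j using that by (simp add: K_def)
      show "j' \<in> K" if "j \<in> K" "1 \<le> j'" "j' \<le> j" for j j'
        using down[of "(j + p, j + p)" "(j' + p, j' + p)"] that p by (auto simp: K_def Q_set_def)
    qed
    then show ?thesis by (auto simp: k_def)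
  qed
  define row where "row = (\<lambda>r. {j. (r, j) \<in> J})"
  define lo where "lo = (\<lambda>r. max r (p + 1))"
  \<comment> \<open>Lengths are measured from the diagonal column r, not from \<open>lo r\<close>,
    because the entries of the tuple bound the offset j - i.\<close>
  define b where "b = (\<lambda>r. lo r + card (row r) - r)"
  have Qlo: "(r, j) \<in> Q_set p n \<longleftrightarrow> 1 \<le> r \<and> lo r \<le> j \<and> j < r + n" for r j
    by (auto simp: Q_set_def lo_def)
  have row: "(r, j) \<in> J \<longleftrightarrow> lo r \<le> j \<and> j < r + b r" for r j
  proof -
    have "finite (row r)"
      by (rule finite_subset[of _ "snd ` J"]) (use fin in \<open>force simp: row_def\<close>)+
    then have "j \<in> row r \<longleftrightarrow> lo r \<le> j \<and> j < lo r + card (row r)"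
    proof (rule down_closed_interval)
      show "lo r \<le> j" if "j \<in> row r" for j using that sub Qlo by (auto simp: row_def)
      show "j' \<in> row r" if "j \<in> row r" "lo r \<le> j'" "j' \<le> j" for j j'
        using down[of "(r, j)" "(r, j')"] that sub Qlo by (auto simp: row_def)
    qed
    moreover have "r + b r = lo r + card (row r)" by (simp add: b_def lo_def)
    ultimately show ?thesis by (simp add: row_def)
  qed
  have b_lo: "lo r \<le> r + b r" for r by (simp add: b_def lo_def)
  have b_le: "b r \<le> n" if "1 \<le> r" for r
  proof (rule ccontr)
    assume "\<not> b r \<le> n"
    then have "(r, r + n) \<in> J" using p that by (auto simp: row lo_def)
    then show False using sub by (auto simp: Q_set_def)
  qed
  \<comment> \<open>The diagonal cell of row k + p lies above the cells of column k + p in earlier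
    rows. For k = 0 it need not belong to J, but rows then start at column p + 1 or later
    anyway.\<close>
  have b_ge: "k + p + 1 \<le> r + b r" if r: "k < r" "r \<le> k + p" for r
  proof (cases "k = 0")
    case True
    then show ?thesis using b_lo[of r] by (simp add: lo_def)
  next
    case False
    then have "(k + p, k + p) \<in> J" using K[of k] by (simp add: K_def)
    moreover have "(r, k + p) \<in> Q_set p n" using r False p by (auto simp: Q_set_def)
    ultimately have "(r, k + p) \<in> J" using down[of "(k + p, k + p)" "(r, k + p)"] r by simp
    then show ?thesis by (simp add: row)
  qed
  \<comment> \<open>Otherwise J contains a cell of row r + 1 whose neighbour in row r and the same
    column lies beyond the end of that row. If \<open>b (Suc r) = n\<close>, this neighbour is
    outside the poset; the third clause of \<open>Q_le\<close> then yields (r + p, r + p) instead,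
    against the choice of k.\<close>
  have b_dec: "b (Suc r) < b r" if r: "k < r" "Suc r \<le> k + p" for r
  proof (rule ccontr)
    assume nlt: "\<not> b (Suc r) < b r"
    have br: "k + p + 1 \<le> r + b r" using b_ge r by simp
    have "lo (Suc r) \<le> r + b (Suc r)"
      using nlt br b_lo[of r] r by (auto simp: lo_def)
    then have mem: "(Suc r, r + b (Suc r)) \<in> J" by (simp add: row)
    show False
    proof (cases "b (Suc r) < n")
      case True
      have "(r, r + b (Suc r)) \<in> Q_set p n"
        using True mem sub r by (auto simp: Q_set_def)
      then have "(r, r + b (Suc r)) \<in> J" using down[OF mem] by simp
      then show False using nlt by (simp add: row)
    next
      case False
      then have n: "b (Suc r) = n" using b_le[of "Suc r"] by simp
      have "(r + p, r + p) \<in> J"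
        using down[OF mem, of "(r + p, r + p)"] n p r by (auto simp: Q_set_def)
      then have "r \<in> K" using r by (simp add: K_def)
      then show False using K r by simp
    qed
  qed
  define I where "I = map (\<lambda>a. b (k + p - a)) [0..<p]"
  have len: "length I = p" by (simp add: I_def)
  have nth: "I ! a = b (k + p - a)" if "a < p" for a using that by (simp add: I_def)
  have "sorted_wrt (<) I"
    unfolding sorted_wrt_iff_nth_Suc_transp[OF transp_on_less]
  proof (intro allI impI)
    fix a assume "Suc a < length I"
    then have a: "Suc a < p" by (simp add: len)
    then have "b (Suc (k + p - Suc a)) < b (k + p - Suc a)" by (intro b_dec) auto
    moreover have "Suc (k + p - Suc a) = k + p - a" using a by simp
    ultimately show "I ! a < I ! Suc a" using a by (simp add: nth)
  qed
  moreover have "set I \<subseteq> {1..n}"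
  proof
    fix x assume "x \<in> set I"
    then obtain a where a: "a < p" "x = b (k + p - a)" by (auto simp: I_def)
    define r where "r = k + p - a"
    have r: "k < r" "r \<le> k + p" using a(1) by (auto simp: r_def)
    then show "x \<in> {1..n}" using b_ge[OF r] b_le[of r] by (simp add: a(2) flip: r_def)
  qed
  ultimately have mem: "(I, k) \<in> ss_index_set p n" by (simp add: ss_index_set_def len)
  have "(i, j) \<in> ideal_of p n (I, k) \<longleftrightarrow> (i, j) \<in> J" for i j
  proof (cases "(i, j) \<in> Q_set p n")
    case False
    then show ?thesis using sub by (auto simp: ideal_of_def)
  next
    case Q: True
    then have Q': "1 \<le> i" "p + 1 \<le> j" "i \<le> j" "j < i + n" by (auto simp: Q_set_def)
    consider "i \<le> k" | "k < i" "i \<le> k + p" | "k + p < i" by linarith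
    then show ?thesis
    proof cases
      case 1
      then have "i \<in> K" using K Q' by simp
      then have "(i, j) \<in> J" using down[of "(i + p, i + p)" "(i, j)"] Q by (simp add: K_def)
      then show ?thesis using 1 Q Q' by (simp add: ideal_of_def)
    next
      case 2
      then have "row_entry p n (I, k) i = b i" by (simp add: nth)
      then show ?thesis using Q Qlo by (auto simp: ideal_of_def row)
    next
      case 3
      \<comment> \<open>A cell in a row beyond k + p would bring the diagonal cell of that row into
        J.\<close>
      have "(i, j) \<notin> J"
      proof
        assume ij: "(i, j) \<in> J"
        have "(i, i) \<in> J" using down[OF ij, of "(i, i)"] Q' 3 p by (auto simp: Q_set_def)
        then have "i - p \<in> K" using 3 by (simp add: K_def)
        then show False using K 3 by auto
      qed
      then show ?thesis using 3 Q' by (simp add: ideal_of_def)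
    qed
  qed
  then have "ideal_of p n (I, k) = J" by auto
  then show ?thesis using mem by blast
qed

lemma bij_betw_ideal_of:
  assumes "0 < p" "p < n"
  shows "bij_betw (ideal_of p n) (ss_index_set p n) (finite_ideals p n)"
  unfolding bij_betw_def
proof
  show "inj_on (ideal_of p n) (ss_index_set p n)" by (rule inj_on_ideal_of[OF assms])
  show "ideal_of p n ` ss_index_set p n = finite_ideals p n"
    using ideal_of_in_finite_ideals[OF _ assms] ideal_of_surj[OF _ assms] by (auto simp: image_iff) metis
qed

section \<open>Lattices of sets\<close>

text \<open>An order embedded into sets, with image closed under union and intersection. Joins and
  meets are then forced, and distributivity is inherited from sets.\<close>

locale set_lattice =
  fixes L :: "('a, 'm) gorder_scheme" and f :: "'a \<Rightarrow> 'b set"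
  assumes eq: "eq L = (=)" and inj: "inj_on f (carrier L)"
    and le_iff: "\<And>x y. x \<in> carrier L \<Longrightarrow> y \<in> carrier L \<Longrightarrow> x \<sqsubseteq>\<^bsub>L\<^esub> y \<longleftrightarrow> f x \<subseteq> f y"
    and Un_closed: "\<And>x y. x \<in> carrier L \<Longrightarrow> y \<in> carrier L \<Longrightarrow> \<exists>z\<in>carrier L. f z = f x \<union> f y"
    and Int_closed: "\<And>x y. x \<in> carrier L \<Longrightarrow> y \<in> carrier L \<Longrightarrow> \<exists>z\<in>carrier L. f z = f x \<inter> f y"
begin

lemma partial_order: "partial_order L"
proof -
  have anti: "x = y" if "f x \<subseteq> f y" "f y \<subseteq> f x" "x \<in> carrier L" "y \<in> carrier L" for x y
    using that by (intro inj_onD[OF inj]) auto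
  show ?thesis
    by unfold_locales (use anti in \<open>auto simp: eq le_iff\<close>)
qed

lemma least_Un:
  assumes "x \<in> carrier L" "y \<in> carrier L" "z \<in> carrier L" "f z = f x \<union> f y"
  shows "least L z (Upper L {x, y})"
  unfolding least_def
proof (intro conjI ballI)
  show "Upper L {x, y} \<subseteq> carrier L" by (simp add: Upper_def)
  have "x \<sqsubseteq>\<^bsub>L\<^esub> z" "y \<sqsubseteq>\<^bsub>L\<^esub> z" using assms(4) le_iff[OF assms(1,3)] le_iff[OF assms(2,3)] by simp_all
  then show "z \<in> Upper L {x, y}" using assms(3) by (auto simp: Upper_def)
  fix u assume "u \<in> Upper L {x, y}"
  then have u: "u \<in> carrier L" "x \<sqsubseteq>\<^bsub>L\<^esub> u" "y \<sqsubseteq>\<^bsub>L\<^esub> u" using assms(1,2) by (auto simp: Upper_def)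
  then show "z \<sqsubseteq>\<^bsub>L\<^esub> u"
    using le_iff[OF assms(1) u(1)] le_iff[OF assms(2) u(1)] le_iff[OF assms(3) u(1)] assms(4) by simp
qed

lemma greatest_Int:
  assumes "x \<in> carrier L" "y \<in> carrier L" "z \<in> carrier L" "f z = f x \<inter> f y"
  shows "greatest L z (Lower L {x, y})"
  unfolding greatest_def
proof (intro conjI ballI)
  show "Lower L {x, y} \<subseteq> carrier L" by (simp add: Lower_def)
  have "z \<sqsubseteq>\<^bsub>L\<^esub> x" "z \<sqsubseteq>\<^bsub>L\<^esub> y" using assms(4) le_iff[OF assms(3,1)] le_iff[OF assms(3,2)] by simp_all
  then show "z \<in> Lower L {x, y}" using assms(3) by (auto simp: Lower_def)
  fix u assume "u \<in> Lower L {x, y}"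
  then have u: "u \<in> carrier L" "u \<sqsubseteq>\<^bsub>L\<^esub> x" "u \<sqsubseteq>\<^bsub>L\<^esub> y" using assms(1,2) by (auto simp: Lower_def)
  then show "u \<sqsubseteq>\<^bsub>L\<^esub> z"
    using le_iff[OF u(1) assms(1)] le_iff[OF u(1) assms(2)] le_iff[OF u(1) assms(3)] assms(4) by simp
qed

lemma lattice: "lattice L"
proof -
  interpret partial_order L by (rule partial_order)
  show ?thesis
  proof
    show "\<exists>s. least L s (Upper L {x, y})" if "x \<in> carrier L" "y \<in> carrier L" for x y
      using Un_closed[OF that] least_Un[OF that] by blast
    show "\<exists>s. greatest L s (Lower L {x, y})" if "x \<in> carrier L" "y \<in> carrier L" for x y
      using Int_closed[OF that] greatest_Int[OF that] by blast
  qed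
qed

lemma join:
  assumes "x \<in> carrier L" "y \<in> carrier L"
  shows "x \<squnion>\<^bsub>L\<^esub> y \<in> carrier L" "f (x \<squnion>\<^bsub>L\<^esub> y) = f x \<union> f y"
proof -
  interpret partial_order L by (rule partial_order)
  obtain z where z: "z \<in> carrier L" "f z = f x \<union> f y" using Un_closed[OF assms] by blast
  have least: "least L z (Upper L {x, y})" by (rule least_Un[OF assms z])
  then have "x \<squnion>\<^bsub>L\<^esub> y = z"
    unfolding join_def sup_def using least_unique by blast
  then show "x \<squnion>\<^bsub>L\<^esub> y \<in> carrier L" "f (x \<squnion>\<^bsub>L\<^esub> y) = f x \<union> f y" using z by auto
qed

lemma meet:
  assumes "x \<in> carrier L" "y \<in> carrier L"
  shows "x \<sqinter>\<^bsub>L\<^esub> y \<in> carrier L" "f (x \<sqinter>\<^bsub>L\<^esub> y) = f x \<inter> f y"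
proof -
  interpret partial_order L by (rule partial_order)
  obtain z where z: "z \<in> carrier L" "f z = f x \<inter> f y" using Int_closed[OF assms] by blast
  have "greatest L z (Lower L {x, y})" by (rule greatest_Int[OF assms z])
  then have "x \<sqinter>\<^bsub>L\<^esub> y = z"
    unfolding meet_def inf_def using greatest_unique by blast
  then show "x \<sqinter>\<^bsub>L\<^esub> y \<in> carrier L" "f (x \<sqinter>\<^bsub>L\<^esub> y) = f x \<inter> f y" using z by auto
qed

lemma distributive: "distributive_lattice L"
  unfolding distributive_lattice_def
proof (intro conjI ballI)
  show "lattice L" by (rule lattice)
  fix x y z assume xyz: "x \<in> carrier L" "y \<in> carrier L" "z \<in> carrier L"
  show "x \<sqinter>\<^bsub>L\<^esub> (y \<squnion>\<^bsub>L\<^esub> z) = (x \<sqinter>\<^bsub>L\<^esub> y) \<squnion>\<^bsub>L\<^esub> (x \<sqinter>\<^bsub>L\<^esub> z)"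
    by (rule inj_onD[OF inj]) (simp_all add: xyz join meet Int_Un_distrib)
qed

end

section \<open>The two lattices\<close>

lemma finite_ideals_Un_Int:
  assumes "X \<in> finite_ideals p n" "Y \<in> finite_ideals p n"
  shows "X \<union> Y \<in> finite_ideals p n" "X \<inter> Y \<in> finite_ideals p n"
  using assms unfolding finite_ideals_def by (auto; blast)+

lemma set_lattice_ideal: "set_lattice (ideal_lattice p n) (\<lambda>X. X)"
  by unfold_locales (auto simp: ideal_lattice_def finite_ideals_Un_Int)

text \<open>Unions and intersections of finite ideals are finite ideals, and
  \<open>ideal_of_surj\<close> finds the elements of the index set that represent them.\<close>

lemma set_lattice_ss:
  assumes "0 < p" "p < n"
  shows "set_lattice (ss_lattice p n) (ideal_of p n)"
proof
  show "(.=\<^bsub>ss_lattice p n\<^esub>) = (=)" by (simp add: ss_lattice_def)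
  show "inj_on (ideal_of p n) (carrier (ss_lattice p n))"
    using inj_on_ideal_of[OF assms] by (simp add: ss_lattice_def)
  fix A B assume "A \<in> carrier (ss_lattice p n)" "B \<in> carrier (ss_lattice p n)"
  then have AB: "A \<in> ss_index_set p n" "B \<in> ss_index_set p n" by (simp_all add: ss_lattice_def)
  show "A \<sqsubseteq>\<^bsub>ss_lattice p n\<^esub> B \<longleftrightarrow> ideal_of p n A \<subseteq> ideal_of p n B"
    using ss_le_iff_ideal_of[OF AB assms] by (simp add: ss_lattice_def)
  note mem = finite_ideals_Un_Int[OF ideal_of_in_finite_ideals[OF AB(1) assms] ideal_of_in_finite_ideals[OF AB(2) assms]]
  show "\<exists>C\<in>carrier (ss_lattice p n). ideal_of p n C = ideal_of p n A \<union> ideal_of p n B"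
    using ideal_of_surj[OF mem(1) assms] by (simp add: ss_lattice_def)
  show "\<exists>C\<in>carrier (ss_lattice p n). ideal_of p n C = ideal_of p n A \<inter> ideal_of p n B"
    using ideal_of_surj[OF mem(2) assms] by (simp add: ss_lattice_def)
qed

lemma lattice_isomorphic_ss_ideal:
  assumes "0 < p" "p < n"
  shows "lattice_isomorphic (ss_lattice p n) (ideal_lattice p n)"
proof -
  interpret s: set_lattice "ss_lattice p n" "ideal_of p n" by (rule set_lattice_ss[OF assms])
  interpret i: set_lattice "ideal_lattice p n" "\<lambda>X. X" by (rule set_lattice_ideal)
  have bij: "bij_betw (ideal_of p n) (carrier (ss_lattice p n)) (carrier (ideal_lattice p n))"
    using bij_betw_ideal_of[OF assms] by (simp add: ss_lattice_def ideal_lattice_def)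
  show ?thesis
    unfolding lattice_isomorphic_def
  proof (intro exI conjI ballI)
    show "bij_betw (ideal_of p n) (carrier (ss_lattice p n)) (carrier (ideal_lattice p n))" by (rule bij)
    fix A B assume AB: "A \<in> carrier (ss_lattice p n)" "B \<in> carrier (ss_lattice p n)"
    then have im: "ideal_of p n A \<in> carrier (ideal_lattice p n)" "ideal_of p n B \<in> carrier (ideal_lattice p n)"
      using bij_betwE[OF bij] by auto
    show "A \<sqsubseteq>\<^bsub>ss_lattice p n\<^esub> B \<longleftrightarrow> ideal_of p n A \<sqsubseteq>\<^bsub>ideal_lattice p n\<^esub> ideal_of p n B"
      using s.le_iff[OF AB] i.le_iff[OF im] by simp
    show "ideal_of p n (A \<squnion>\<^bsub>ss_lattice p n\<^esub> B) = ideal_of p n A \<squnion>\<^bsub>ideal_lattice p n\<^esub> ideal_of p n B"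
      using s.join[OF AB] i.join[OF im] by simp
    show "ideal_of p n (A \<sqinter>\<^bsub>ss_lattice p n\<^esub> B) = ideal_of p n A \<sqinter>\<^bsub>ideal_lattice p n\<^esub> ideal_of p n B"
      using s.meet[OF AB] i.meet[OF im] by simp
  qed
qed


section \<open>The initial subalgebra is a monomial algebra\<close>

text \<open>
  The monomial substitution that takes the leading monomial of a generator to s times the product
  over its order ideal: the variable $z_{r,c}^{(k)}$ goes to the product of all $y_{i,j}$ in the
  rows i congruent to r modulo p that lie strictly below row k p + r, times the first entries of
  that row itself, and to a factor s if r = 1. Its exponents are given by \<open>umap\<close> and \<open>smap\<close>.
\<close>

fun cells :: "nat \<Rightarrow> nat \<Rightarrow> zvar \<Rightarrow> (nat \<times> nat) set" where
  "cells p n (r, c, k) = {(i, j) \<in> Q_set p n. i mod p = r mod p \<and>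
     (i < k * p + r \<or> i = k * p + r \<and> j < c + i)}"

definition umap :: "nat \<Rightarrow> nat \<Rightarrow> zvar monomial \<Rightarrow> (nat \<times> nat) monomial" where
  "umap p n m = (\<Sum>v\<in>Poly_Mapping.keys m. \<Sum>q\<in>cells p n v. Poly_Mapping.single q (lookup m v))"

text \<open>The degree in the variables of the first row. The leading monomial of a generator
  contains exactly one of them, so this degree counts factors.\<close>

definition smap :: "zvar monomial \<Rightarrow> nat" where
  "smap m = (\<Sum>v\<in>Poly_Mapping.keys m. if fst v = 1 then lookup m v else 0)"

lemma umap_add: "umap p n (a + b) = umap p n a + umap p n b"
  unfolding umap_def
  by (rule setsum_keys_plus_distrib[where f = "\<lambda>v x. \<Sum>q\<in>cells p n v. Poly_Mapping.single q x"])
    (simp_all add: single_add sum.distrib)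

lemma smap_add: "smap (a + b) = smap a + smap b"
  unfolding smap_def
  by (rule setsum_keys_plus_distrib[where f = "\<lambda>v x. if fst v = 1 then x else 0"]) simp_all

lemma umap_0 [simp]: "umap p n 0 = 0" and smap_0 [simp]: "smap 0 = 0"
  by (simp_all add: umap_def smap_def)

lemma umap_sum: "umap p n (sum f A) = (\<Sum>x\<in>A. umap p n (f x))"
  by (induction A rule: infinite_finite_induct) (simp_all add: umap_add)

lemma smap_sum: "smap (sum f A) = (\<Sum>x\<in>A. smap (f x))"
  by (induction A rule: infinite_finite_induct) (simp_all add: smap_add)

definition ymon :: "(nat \<times> nat) set \<Rightarrow> (nat \<times> nat) monomial" where
  "ymon J = (\<Sum>q\<in>J. Poly_Mapping.single q 1)"

lemma umap_single: "umap p n (Poly_Mapping.single v 1) = ymon (cells p n v)"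
  by (simp add: umap_def ymon_def)

lemma smap_single: "smap (Poly_Mapping.single v 1) = (if fst v = 1 then 1 else 0)"
  by (simp add: smap_def)

lemma lookup_ymon: "finite J \<Longrightarrow> lookup (ymon J) q = (if q \<in> J then 1 else 0)"
  by (simp add: ymon_def lookup_sum lookup_single when_def)

lemma mod_eq_window:
  fixes a b p :: nat
  assumes "a mod p = b mod p" "a < b + p" "b < a + p"
  shows "a = b"
proof (rule ccontr)
  assume "a \<noteq> b"
  then consider "a < b" | "b < a" by linarith
  then show False
  proof cases
    case 1
    then have "p dvd b - a" using assms(1) mod_eq_dvd_iff_nat[of a b p] by simp
    then have "p \<le> b - a" using 1 by (intro dvd_imp_le) auto
    then show False using assms(3) 1 by linarith
  next
    case 2
    then have "p dvd a - b" using assms(1) mod_eq_dvd_iff_nat[of b a p] by simp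
    then have "p \<le> a - b" using 2 by (intro dvd_imp_le) auto
    then show False using assms(2) 2 by linarith
  qed
qed

lemma finite_cells: "finite (cells p n v)"
proof -
  obtain r c k where v: "v = (r, c, k)" by (cases v)
  have "cells p n v \<subseteq> {(i, j) \<in> Q_set p n. i \<le> k * p + r}" by (auto simp: v)
  then show ?thesis using finite_Q_rows by (rule finite_subset)
qed

text \<open>The window k + 1, ..., k + p meets each residue class modulo p in one row. Within its
  class this is the partial row of the ideal; the rows before it are full and those after it empty.
  So the cells attached to the p variables partition the ideal.\<close>

lemma umap_lmon:
  assumes A: "A \<in> ss_index_set p n" and p: "0 < p"
  shows "umap p n (lmon p A) = ymon (ideal_of p n A)"
proof -
  obtain I k where Ik: "A = (I, k)" by (cases A)
  define vr where "vr = (\<lambda>i. (i + 1, I ! lpos p k i, lblk p k i))"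
  have iff: "(i', j') \<in> cells p n (vr i) \<longleftrightarrow> (i', j') \<in> ideal_of p n A"
    if i: "i < p" and cong: "i' mod p = (i + 1) mod p" for i i' j'
  proof (cases "(i', j') \<in> Q_set p n")
    case Q: True
    then have Q': "1 \<le> i'" "i' \<le> j'" "j' < i' + n" by (auto simp: Q_set_def)
    \<comment> \<open>The number of the window row, counted from 1 like the rows of the
      poset.\<close>
    define g where "g = lblk p k i * p + (i + 1)"
    have g: "k < g" "g \<le> k + p" "lpos p k i = k + p - g"
      using lblk_bounds[OF i, of k] lpos_row(2)[OF i, of k] by (simp_all add: g_def)
    have "(i', j') \<in> cells p n (vr i) \<longleftrightarrow> i' < g \<or> i' = g \<and> j' < I ! lpos p k i + i'"
      using Q cong by (simp add: vr_def g_def)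
    also have "\<dots> \<longleftrightarrow> j' < i' + row_entry p n (I, k) i'"
    proof -
      consider "i' \<le> k" | "k < i'" "i' \<le> k + p" | "k + p < i'" by linarith
      then show ?thesis
      proof cases
        case 1
        then show ?thesis using g Q' by simp
      next
        case 2
        have "g mod p = (i + 1) mod p" unfolding g_def by (rule mod_mult_self3)
        then have "i' = g" using cong g 2 by (intro mod_eq_window[of i' p g]) auto
        then show ?thesis using 2 g by (simp add: add.commute)
      next
        case 3
        then show ?thesis using g Q' by simp
      qed
    qed
    also have "\<dots> \<longleftrightarrow> (i', j') \<in> ideal_of p n A" using Q by (simp add: ideal_of_def Ik)
    finally show ?thesis .
  qed (simp add: vr_def ideal_of_def)
  have cellmod: "i' mod p = (i + 1) mod p" if "(i', j') \<in> cells p n (vr i)" for i i' j'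
    using that by (simp add: vr_def)
  have un: "ideal_of p n A = (\<Union>i\<in>{0..<p}. cells p n (vr i))"
  proof (intro equalityI subsetI)
    fix q assume q: "q \<in> ideal_of p n A"
    obtain i' j' where ij: "q = (i', j')" by (cases q)
    have "1 \<le> i'" using q by (auto simp: ij ideal_of_def Q_set_def)
    then have "i' mod p = ((i' - 1) mod p + 1) mod p" by (simp add: mod_simps)
    then have "q \<in> cells p n (vr ((i' - 1) mod p))" using iff q p by (simp add: ij)
    then show "q \<in> (\<Union>i\<in>{0..<p}. cells p n (vr i))" using p by (intro UN_I[of "(i' - 1) mod p"]) auto
  next
    fix q assume "q \<in> (\<Union>i\<in>{0..<p}. cells p n (vr i))"
    then obtain i where i: "i < p" "q \<in> cells p n (vr i)" by auto
    obtain i' j' where ij: "q = (i', j')" by (cases q)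
    have "(i', j') \<in> cells p n (vr i)" using i(2) by (simp only: ij)
    then show "q \<in> ideal_of p n A" using iff[OF i(1) cellmod, of i' j' j'] unfolding ij by blast
  qed
  have "umap p n (lmon p A) = (\<Sum>i = 0..<p. ymon (cells p n (vr i)))"
    by (simp only: lmon_def zmon_def Ik fst_conv snd_conv umap_sum umap_single vr_def)
  also have "\<dots> = ymon (\<Union>i\<in>{0..<p}. cells p n (vr i))"
    unfolding ymon_def
  proof (rule sum.UNION_disjoint[symmetric])
    show "\<forall>i\<in>{0..<p}. \<forall>j\<in>{0..<p}. i \<noteq> j \<longrightarrow> cells p n (vr i) \<inter> cells p n (vr j) = {}"
    proof (intro ballI impI)
      fix i j assume ij: "i \<in> {0..<p}" "j \<in> {0..<p}" "i \<noteq> j"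
      show "cells p n (vr i) \<inter> cells p n (vr j) = {}"
      proof (rule ccontr)
        assume "cells p n (vr i) \<inter> cells p n (vr j) \<noteq> {}"
        then obtain a b where "(a, b) \<in> cells p n (vr i)" "(a, b) \<in> cells p n (vr j)" by auto
        then have "(i + 1) mod p = (j + 1) mod p" using cellmod by metis
        then have "i + 1 = j + 1" using ij by (intro mod_eq_window[of "i + 1" p "j + 1"]) auto
        then show False using ij by simp
      qed
    qed
  qed (simp_all add: finite_cells)
  finally show ?thesis by (simp only: un)
qed

lemma smap_lmon:
  assumes "0 < p"
  shows "smap (lmon p A) = 1"
proof -
  have "smap (lmon p A) = (\<Sum>i = 0..<p. if i = 0 then 1 else 0)"
    unfolding lmon_def zmon_def smap_sum smap_single by (intro sum.cong refl) simp
  then show ?thesis using assms by simp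
qed

section \<open>Products of leading monomials\<close>

definition lsum :: "nat \<Rightarrow> (nat list \<times> nat) multiset \<Rightarrow> zvar monomial" where
  "lsum p M = (\<Sum>A\<in>#M. lmon p A)"

lemma lsum_empty [simp]: "lsum p {#} = 0"
  and lsum_add_mset [simp]: "lsum p (add_mset A M) = lmon p A + lsum p M"
  and lsum_union: "lsum p (M + N) = lsum p M + lsum p N"
  by (simp_all add: lsum_def)

lemma mdeg_lsum: "mdeg (lsum p M) = p * size M"
  by (induction M) (simp_all add: mdeg_add lmon_def mdeg_zmon)

lemma smap_lsum: "0 < p \<Longrightarrow> smap (lsum p M) = size M"
  by (induction M) (simp_all add: smap_add smap_lmon)

lemma umap_lsum:
  assumes "0 < p" "set_mset M \<subseteq> ss_index_set p n"
  shows "umap p n (lsum p M) = (\<Sum>A\<in>#M. ymon (ideal_of p n A))"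
  using assms(2) by (induction M) (simp_all add: umap_add umap_lmon[OF _ assms(1)])

text \<open>Members of a multichain are comparable, so one whose ideal has the fewest cells is
  contained in all others.\<close>

lemma standard_least:
  assumes p: "0 < p" "p < n" and M: "standard p n M" "M \<noteq> {#}"
  obtains A where "A \<in># M" "\<And>B. B \<in># M \<Longrightarrow> ideal_of p n A \<subseteq> ideal_of p n B"
proof -
  define f where "f = (\<lambda>A. card (ideal_of p n A))"
  have "Min (f ` set_mset M) \<in> f ` set_mset M" using M(2) by (intro Min_in) auto
  then obtain A where A: "A \<in># M" "f A = Min (f ` set_mset M)" by auto
  have sub: "C \<in> ss_index_set p n" if "C \<in># M" for C using that M(1) by (auto simp: standard_def)
  have "ideal_of p n A \<subseteq> ideal_of p n B" if B: "B \<in># M" for B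
  proof (cases "ss_le p A B")
    case True
    then show ?thesis using ss_le_iff_ideal_of[OF sub[OF A(1)] sub[OF B] p] by blast
  next
    case False
    then have "ss_le p B A" using M(1) A(1) B by (auto simp: standard_def)
    then have le: "ideal_of p n B \<subseteq> ideal_of p n A"
      using ss_le_iff_ideal_of[OF sub[OF B] sub[OF A(1)] p] by blast
    have fin: "finite (ideal_of p n A)"
      using ideal_of_in_finite_ideals[OF sub[OF A(1)] p] by (simp add: finite_ideals_def)
    have "f A \<le> f B" using A(2) B by simp
    then have "ideal_of p n B = ideal_of p n A" using card_seteq[OF fin le] by (simp add: f_def)
    then show ?thesis by simp
  qed
  then show ?thesis using that A(1) by blast
qed

lemma lookup_sum_mset: "lookup (\<Sum>A\<in>#M. f A) q = (\<Sum>A\<in>#M. lookup (f A) q)"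
  by (induction M) (simp_all add: lookup_add)

text \<open>The least member of a multichain consists of the cells of maximal multiplicity.\<close>

lemma standard_unique:
  assumes p: "0 < p" "p < n" and "standard p n M" "standard p n N" "size M = size N"
    and "(\<Sum>A\<in>#M. ymon (ideal_of p n A)) = (\<Sum>A\<in>#N. ymon (ideal_of p n A))"
  shows "M = N"
  using assms(3-6)
proof (induction "size M" arbitrary: M N)
  case 0
  then show ?case by simp
next
  case (Suc s)
  have least: "\<exists>A\<in>#M. ideal_of p n A = {q. lookup (\<Sum>A\<in>#M. ymon (ideal_of p n A)) q = size M}"
    if M: "standard p n M" "M \<noteq> {#}" for M
  proof -
    have fin: "finite (ideal_of p n A)" if "A \<in># M" for A
      using ideal_of_in_finite_ideals[OF _ p, of A] that M(1) by (auto simp: finite_ideals_def standard_def)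
    obtain A where A: "A \<in># M" "\<And>B. B \<in># M \<Longrightarrow> ideal_of p n A \<subseteq> ideal_of p n B"
      using standard_least[OF p M] by blast
    have "q \<in> ideal_of p n A \<longleftrightarrow> lookup (\<Sum>A\<in>#M. ymon (ideal_of p n A)) q = size M" for q
    proof -
      have "lookup (\<Sum>A\<in>#M. ymon (ideal_of p n A)) q =
          (\<Sum>B\<in>#M. if q \<in> ideal_of p n B then 1 else 0)"
        unfolding lookup_sum_mset using fin
        by (intro arg_cong[where f = sum_mset] image_mset_cong) (simp add: lookup_ymon)
      also have "\<dots> = size (filter_mset (\<lambda>B. q \<in> ideal_of p n B) M)"
        by (induction M) simp_all
      also have "\<dots> = size M \<longleftrightarrow> (\<forall>B\<in>#M. q \<in> ideal_of p n B)"
      proof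
        assume "size (filter_mset (\<lambda>B. q \<in> ideal_of p n B) M) = size M"
        then show "\<forall>B\<in>#M. q \<in> ideal_of p n B"
          using size_filter_unsat_elem[of _ M "\<lambda>B. q \<in> ideal_of p n B"] by (metis less_irrefl)
      next
        assume "\<forall>B\<in>#M. q \<in> ideal_of p n B"
        then have "filter_mset (\<lambda>B. q \<in> ideal_of p n B) M = M" by (simp add: filter_mset_eq_conv)
        then show "size (filter_mset (\<lambda>B. q \<in> ideal_of p n B) M) = size M" by simp
      qed
      also have "\<dots> \<longleftrightarrow> q \<in> ideal_of p n A" using A by blast
      finally show ?thesis by simp
    qed
    then show ?thesis using A(1) by blast
  qed
  have "M \<noteq> {#}" "N \<noteq> {#}" using Suc(2,5) by auto
  then obtain A B where AB: "A \<in># M" "B \<in># N" "ideal_of p n A = ideal_of p n B"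
    using least[OF Suc(3)] least[OF Suc(4)] Suc(5,6) by metis
  then have "A = B"
    using inj_on_ideal_of[OF p] Suc(3,4) unfolding standard_def by (meson inj_onD subsetD)
  obtain M' where M': "M = add_mset A M'" using AB(1) by (rule mset_add)
  obtain N' where N': "N = add_mset A N'" using AB(2) unfolding \<open>A = B\<close>[symmetric] by (rule mset_add)
  have "M' = N'"
  proof (rule Suc(1))
    show "standard p n M'" "standard p n N'" using Suc(3,4) by (auto simp: M' N' standard_def)
  qed (use Suc(2,5,6) in \<open>simp_all add: M' N'\<close>)
  then show ?case by (simp add: M' N')
qed

lemma leads_lsum:
  assumes "0 < p" "set_mset M \<subseteq> ss_index_set p n"
  obtains c where "zo.leads (Dprod p M) (lsum p M) c"
  using leads_Dprod[OF assms] unfolding lsum_def by blast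

text \<open>\<open>smap\<close> recovers the number of factors and \<open>umap\<close> the
  multiplicity of each cell; together they determine a multichain.\<close>

lemma inj_on_lsum:
  assumes p: "0 < p" "p < n"
  shows "inj_on (lsum p) {M. standard p n M}"
proof (rule inj_onI)
  fix M N assume M: "M \<in> {M. standard p n M}" and N: "N \<in> {M. standard p n M}" and eq: "lsum p M = lsum p N"
  have "umap p n (lsum p M) = umap p n (lsum p N)" "smap (lsum p M) = smap (lsum p N)" using eq by simp_all
  then show "M = N"
    using M N p by (intro standard_unique[OF p]) (auto simp: umap_lsum smap_lsum standard_def)
qed

lemma plucker_leads:
  assumes p: "0 < p" "p < n" and f: "f \<in> carrier (plucker_alg p n)" "f \<noteq> 0"
  obtains N c where "standard p n N" "zo.leads f (lsum p N) c"
proof -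
  have "\<exists>c. zo.leads (Dprod p M) (lsum p M) c" if "standard p n M" for M
    using leads_lsum[OF p(1)] that unfolding standard_def by metis
  then obtain c where c: "\<And>M. standard p n M \<Longrightarrow> zo.leads (Dprod p M) (lsum p M) (c M)" by metis
  have "f \<in> cp.span (Dprod p ` {M. standard p n M})"
    using f(1) plucker_span_standard[of p n] unfolding image_Collect by blast
  then obtain N a where "N \<in> {M. standard p n M}" "zo.leads f (lsum p N) a"
    using zo.span_leads[of "{M. standard p n M}" "Dprod p" "lsum p" c f] c inj_on_lsum[OF p] f(2) by blast
  then show ?thesis using that by blast
qed

definition zmons :: "nat \<Rightarrow> nat \<Rightarrow> zvar monomial set" where
  "zmons p n = {lsum p M | M. set_mset M \<subseteq> ss_index_set p n}"

lemma leads_nonzero: "zo.leads f m c \<Longrightarrow> f \<noteq> 0"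
  using zo.leads_lookup[of f m c] by (auto simp: zo.leads_def)

text \<open>The product of generators along M lies in the Pluecker algebra, so its leading monomial
  is also that of a multichain product. This straightens monomials without any argument about
  lattice operations.\<close>

lemma zmons_standard:
  assumes p: "0 < p" "p < n" and m: "m \<in> zmons p n"
  obtains N where "standard p n N" "m = lsum p N"
proof -
  obtain M where M: "m = lsum p M" "set_mset M \<subseteq> ss_index_set p n" using m by (auto simp: zmons_def)
  obtain c where c: "zo.leads (Dprod p M) (lsum p M) c" by (rule leads_lsum[OF p(1) M(2)])
  obtain N a where N: "standard p n N" "zo.leads (Dprod p M) (lsum p N) a"
    by (rule plucker_leads[OF p Dprod_in_plucker[OF M(2)] leads_nonzero[OF c]])
  then show ?thesis using that zo.leads_unique[OF c N(2)] M(1) by simp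
qed

lemma zmons_inj:
  assumes p: "0 < p" "p < n" and m: "m \<in> zmons p n" "m' \<in> zmons p n"
    and eq: "smap m = smap m'" "umap p n m = umap p n m'"
  shows "m = m'"
proof -
  obtain M where M: "standard p n M" "m = lsum p M" by (rule zmons_standard[OF p m(1)])
  obtain N where N: "standard p n N" "m' = lsum p N" by (rule zmons_standard[OF p m(2)])
  have "M = N"
    using M N eq p by (intro standard_unique[OF p]) (auto simp: umap_lsum smap_lsum standard_def)
  then show ?thesis using M N by simp
qed

lemma zmons_add: "a \<in> zmons p n \<Longrightarrow> b \<in> zmons p n \<Longrightarrow> a + b \<in> zmons p n"
proof -
  assume "a \<in> zmons p n" "b \<in> zmons p n"
  then obtain M N where "a = lsum p M" "b = lsum p N" "set_mset M \<subseteq> ss_index_set p n" "set_mset N \<subseteq> ss_index_set p n"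
    by (auto simp: zmons_def)
  then show ?thesis unfolding zmons_def by (intro CollectI exI[of _ "M + N"]) (simp add: lsum_union)
qed

lemma zmons_0: "0 \<in> zmons p n"
  unfolding zmons_def by (intro CollectI exI[of _ "{#}"]) simp

lemma poly_mapping_sum_single:
  "f = (\<Sum>m\<in>Poly_Mapping.keys f. Poly_Mapping.single m (lookup f m))"
proof (rule poly_mapping_eqI)
  fix m
  show "lookup f m =
      lookup (\<Sum>m\<in>Poly_Mapping.keys f. Poly_Mapping.single m (lookup f m)) m"
    by (auto simp: lookup_sum lookup_single when_def in_keys_iff)
qed

text \<open>Leading monomials of nonzero elements come from multichains and so lie in
  \<open>zmons\<close>; conversely, each member of \<open>zmons\<close> leads a product of
  generators.\<close>

theorem initial_space_plucker:
  assumes p: "0 < p" "p < n"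
  shows "initial_space ss_less (carrier (plucker_alg p n)) = {f. Poly_Mapping.keys f \<subseteq> zmons p n}"
proof -
  define T where "T = {initial_term ss_less f | f. f \<in> carrier (plucker_alg p n) \<and> f \<noteq> 0}"
  have "cp.span T = {f. Poly_Mapping.keys f \<subseteq> zmons p n}"
  proof
    show "cp.span T \<subseteq> {f. Poly_Mapping.keys f \<subseteq> zmons p n}"
    proof (rule cp.span_minimal)
      show "T \<subseteq> {f. Poly_Mapping.keys f \<subseteq> zmons p n}"
      proof
        fix t assume "t \<in> T"
        then obtain f where f: "t = initial_term ss_less f" "f \<in> carrier (plucker_alg p n)" "f \<noteq> 0"
          unfolding T_def by blast
        obtain N c where N: "standard p n N" "zo.leads f (lsum p N) c" by (rule plucker_leads[OF p f(2,3)])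
        have "t = Poly_Mapping.single (lsum p N) c"
          unfolding f(1) ss_less_def by (rule zo.initial_term_leads[OF N(2)])
        then show "t \<in> {f. Poly_Mapping.keys f \<subseteq> zmons p n}"
          using N(1) by (auto simp: standard_def zmons_def)
      qed
      show "cp.subspace {f. Poly_Mapping.keys f \<subseteq> zmons p n}"
      proof (rule cp.subspaceI)
        show "f + g \<in> {f. Poly_Mapping.keys f \<subseteq> zmons p n}"
          if "f \<in> {f. Poly_Mapping.keys f \<subseteq> zmons p n}" "g \<in> {f. Poly_Mapping.keys f \<subseteq> zmons p n}" for f g
          using that keys_add[of f g] by blast
        show "cconst c * f \<in> {f. Poly_Mapping.keys f \<subseteq> zmons p n}"
          if "f \<in> {f. Poly_Mapping.keys f \<subseteq> zmons p n}" for c f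
          using that keys_mult[of "cconst c" f] by (auto simp: cconst_def split: if_splits)
      qed simp
    qed
    show "{f. Poly_Mapping.keys f \<subseteq> zmons p n} \<subseteq> cp.span T"
    proof
      fix f :: "zvar cpoly" assume f: "f \<in> {f. Poly_Mapping.keys f \<subseteq> zmons p n}"
      have "Poly_Mapping.single m a \<in> cp.span T" if m: "m \<in> zmons p n" for m a
      proof -
        obtain M where M: "m = lsum p M" "set_mset M \<subseteq> ss_index_set p n" using m by (auto simp: zmons_def)
        obtain c where c: "zo.leads (Dprod p M) (lsum p M) c" by (rule leads_lsum[OF p(1) M(2)])
        have "initial_term ss_less (Dprod p M) \<in> T"
          unfolding T_def using Dprod_in_plucker[OF M(2)] leads_nonzero[OF c] by blast
        then have "Poly_Mapping.single m c \<in> T"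
          unfolding ss_less_def zo.initial_term_leads[OF c] M(1) .
        then have "cconst (a / c) * Poly_Mapping.single m c \<in> cp.span T"
          by (rule cp.span_scale[OF cp.span_base])
        moreover have "c \<noteq> 0" using c by (simp add: zo.leads_def)
        then have "cconst (a / c) * Poly_Mapping.single m c = Poly_Mapping.single m a"
          by (simp add: cconst_def mult_single)
        ultimately show ?thesis by simp
      qed
      then have "(\<Sum>m\<in>Poly_Mapping.keys f. Poly_Mapping.single m (lookup f m)) \<in> cp.span T"
        using f by (intro cp.span_sum) auto
      then show "f \<in> cp.span T" by (simp flip: poly_mapping_sum_single)
    qed
  qed
  then show ?thesis by (simp add: initial_space_def T_def)
qed


section \<open>The isomorphism with the algebra of the order polytope\<close>

lemma cring_graded_subalg:
  fixes A :: "'a::comm_ring_1 set"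
  assumes "0 \<in> A" "1 \<in> A" and add: "\<And>x y. x \<in> A \<Longrightarrow> y \<in> A \<Longrightarrow> x + y \<in> A"
    and mult: "\<And>x y. x \<in> A \<Longrightarrow> y \<in> A \<Longrightarrow> x * y \<in> A" and minus: "\<And>x. x \<in> A \<Longrightarrow> - x \<in> A"
  shows "cring (graded_subalg \<iota> H A)"
proof (rule cringI)
  show "abelian_group (graded_subalg \<iota> H A)"
  proof (rule abelian_groupI)
    fix x assume "x \<in> carrier (graded_subalg \<iota> H A)"
    then show "\<exists>y\<in>carrier (graded_subalg \<iota> H A). y \<oplus>\<^bsub>graded_subalg \<iota> H A\<^esub> x = \<zero>\<^bsub>graded_subalg \<iota> H A\<^esub>"
      using minus[of x] by (intro bexI[of _ "- x"]) (simp_all add: graded_subalg_def)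
  qed (use assms in \<open>simp_all add: graded_subalg_def algebra_simps\<close>)
  show "comm_monoid (graded_subalg \<iota> H A)"
    by (rule comm_monoidI) (use assms in \<open>simp_all add: graded_subalg_def algebra_simps\<close>)
qed (simp_all add: graded_subalg_def algebra_simps)

text \<open>The substitution is defined on the whole polynomial ring, where it is a ring
  homomorphism; only injectivity requires restriction to the initial subalgebra.\<close>

definition zy_map :: "nat \<Rightarrow> nat \<Rightarrow> zvar cpoly \<Rightarrow> (nat \<times> nat) cpoly poly" where
  "zy_map p n f = (\<Sum>m\<in>Poly_Mapping.keys f.
     Polynomial.monom (Poly_Mapping.single (umap p n m) (lookup f m)) (smap m))"

lemma zy_map_add: "zy_map p n (f + g) = zy_map p n f + zy_map p n g"
  unfolding zy_map_def
  by (rule setsum_keys_plus_distrib[where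
        f = "\<lambda>m x. Polynomial.monom (Poly_Mapping.single (umap p n m) x) (smap m)"])
    (simp_all add: single_add add_monom)

lemma zy_map_0 [simp]: "zy_map p n 0 = 0"
  by (simp add: zy_map_def)

lemma zy_map_sum: "zy_map p n (sum f A) = (\<Sum>x\<in>A. zy_map p n (f x))"
  by (induction A rule: infinite_finite_induct) (simp_all add: zy_map_add)

lemma zy_map_single:
  "zy_map p n (Poly_Mapping.single m c) = Polynomial.monom (Poly_Mapping.single (umap p n m) c) (smap m)"
  by (cases "c = 0") (simp_all add: zy_map_def)

lemma zy_map_mult: "zy_map p n (f * g) = zy_map p n f * zy_map p n g"
proof -
  define F where "F = (\<lambda>m. Poly_Mapping.single m (lookup f m))"
  define G where "G = (\<lambda>m. Poly_Mapping.single m (lookup g m))"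
  have f: "f = sum F (Poly_Mapping.keys f)" and g: "g = sum G (Poly_Mapping.keys g)"
    unfolding F_def G_def by (rule poly_mapping_sum_single)+
  have FG: "zy_map p n (F a * G b) = zy_map p n (F a) * zy_map p n (G b)" for a b
    by (simp add: F_def G_def mult_single zy_map_single mult_monom umap_add smap_add)
  have "zy_map p n (sum F (Poly_Mapping.keys f) * sum G (Poly_Mapping.keys g)) =
      zy_map p n (sum F (Poly_Mapping.keys f)) * zy_map p n (sum G (Poly_Mapping.keys g))"
    unfolding sum_product zy_map_sum FG ..
  then show ?thesis by (simp flip: f g)
qed

lemma zy_map_cconst: "zy_map p n (cconst c) = [:cconst c:]"
  by (simp add: cconst_def zy_map_single monom_0)

lemma zy_map_1: "zy_map p n 1 = 1"
  using zy_map_cconst[of p n 1] by simp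

lemma zy_map_lmon:
  assumes "A \<in> ss_index_set p n" "0 < p"
  shows "zy_map p n (Poly_Mapping.single (lmon p A) 1) = Polynomial.monom (\<Prod>q\<in>ideal_of p n A. cvar q) 1"
  by (simp add: zy_map_single umap_lmon[OF assms] smap_lmon[OF assms(2)] prod_cvar ymon_def)

text \<open>Distinct members of \<open>zmons\<close> have distinct images, so coefficients pass
  through unchanged. Injectivity and the comparison of gradings both rest on this.\<close>

lemma lookup_coeff_zy_map:
  assumes p: "0 < p" "p < n" and f: "Poly_Mapping.keys f \<subseteq> zmons p n" and m: "m \<in> zmons p n"
  shows "lookup (coeff (zy_map p n f) (smap m)) (umap p n m) = lookup f m"
proof -
  have "lookup (coeff (zy_map p n f) (smap m)) (umap p n m) =
      (\<Sum>m'\<in>Poly_Mapping.keys f. lookup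
        (coeff (Polynomial.monom (Poly_Mapping.single (umap p n m') (lookup f m')) (smap m')) (smap m)) (umap p n m))"
    by (simp add: zy_map_def coeff_sum lookup_sum)
  also have "\<dots> = (\<Sum>m'\<in>Poly_Mapping.keys f. if m' = m then lookup f m' else 0)"
  proof (rule sum.cong[OF refl])
    fix m' assume "m' \<in> Poly_Mapping.keys f"
    then have "m' \<in> zmons p n" using f by blast
    then have "smap m' = smap m \<and> umap p n m' = umap p n m \<longleftrightarrow> m' = m"
      using zmons_inj[OF p _ m] by blast
    then show "lookup
        (coeff (Polynomial.monom (Poly_Mapping.single (umap p n m') (lookup f m')) (smap m')) (smap m)) (umap p n m) =
        (if m' = m then lookup f m' else 0)"
      by (auto simp: lookup_single when_def)
  qed
  also have "\<dots> = lookup f m" by (simp add: in_keys_iff)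
  finally show ?thesis .
qed

lemma inj_on_zy_map:
  assumes "0 < p" "p < n"
  shows "inj_on (zy_map p n) {f. Poly_Mapping.keys f \<subseteq> zmons p n}"
proof (rule inj_onI)
  fix f g assume f: "f \<in> {f. Poly_Mapping.keys f \<subseteq> zmons p n}" and g: "g \<in> {f. Poly_Mapping.keys f \<subseteq> zmons p n}"
    and eq: "zy_map p n f = zy_map p n g"
  show "f = g"
  proof (rule poly_mapping_eqI)
    fix m
    show "lookup f m = lookup g m"
    proof (cases "m \<in> zmons p n")
      case True
      then show ?thesis
        using lookup_coeff_zy_map[OF assms, of f m] lookup_coeff_zy_map[OF assms, of g m] f g eq by simp
    next
      case False
      then have "m \<notin> Poly_Mapping.keys f" "m \<notin> Poly_Mapping.keys g" using f g by auto
      then show ?thesis by (simp add: in_keys_iff)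
    qed
  qed
qed

section \<open>The image of the substitution\<close>

definition ygen :: "nat \<Rightarrow> nat \<Rightarrow> (nat \<times> nat) cpoly poly set" where
  "ygen p n = subalg_gen (\<lambda>c. [:cconst c:])
     {Polynomial.monom (\<Prod>q\<in>J. cvar q) 1 |J. J \<in> finite_ideals p n}"

lemma ygen_add: "x \<in> ygen p n \<Longrightarrow> y \<in> ygen p n \<Longrightarrow> x + y \<in> ygen p n"
  and ygen_mult: "x \<in> ygen p n \<Longrightarrow> y \<in> ygen p n \<Longrightarrow> x * y \<in> ygen p n"
  and ygen_scalar: "[:cconst c:] \<in> ygen p n"
  unfolding ygen_def by (rule subalg_gen.add subalg_gen.mult subalg_gen.scalar; assumption?)+

lemma ygen_0: "0 \<in> ygen p n" and ygen_1: "1 \<in> ygen p n"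
  using ygen_scalar[of 0 p n] ygen_scalar[of 1 p n] by (simp_all add: one_pCons)

lemma ygen_minus: "x \<in> ygen p n \<Longrightarrow> - x \<in> ygen p n"
  using ygen_mult[OF ygen_scalar[of "- 1" p n], of x] by (simp add: cconst_minus)

lemma ygen_sum: "(\<And>x. x \<in> A \<Longrightarrow> f x \<in> ygen p n) \<Longrightarrow> sum f A \<in> ygen p n"
  by (induction A rule: infinite_finite_induct) (simp_all add: ygen_0 ygen_add)

lemma zset_add:
  "Poly_Mapping.keys f \<subseteq> zmons p n \<Longrightarrow> Poly_Mapping.keys g \<subseteq> zmons p n \<Longrightarrow> Poly_Mapping.keys (f + g) \<subseteq> zmons p n"
  using keys_add[of f g] by blast

lemma zset_mult:
  assumes "Poly_Mapping.keys f \<subseteq> zmons p n" "Poly_Mapping.keys g \<subseteq> zmons p n"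
  shows "Poly_Mapping.keys (f * g) \<subseteq> zmons p n"
proof
  fix m assume "m \<in> Poly_Mapping.keys (f * g)"
  then obtain a b where "m = a + b" "a \<in> Poly_Mapping.keys f" "b \<in> Poly_Mapping.keys g"
    using keys_mult by blast
  then show "m \<in> zmons p n" using assms zmons_add by blast
qed

lemma zset_cconst: "Poly_Mapping.keys (cconst c) \<subseteq> zmons p n"
  using zmons_0 by (simp add: cconst_def)

lemma lmon_in_zmons: "A \<in> ss_index_set p n \<Longrightarrow> lmon p A \<in> zmons p n"
  unfolding zmons_def by (intro CollectI exI[of _ "{#A#}"]) simp

text \<open>Products of leading monomials go to products of polytope generators; each of these
  generators is hit because every finite ideal comes from an element of the index set.\<close>

lemma zy_map_image:
  assumes p: "0 < p" "p < n"
  shows "zy_map p n ` {f. Poly_Mapping.keys f \<subseteq> zmons p n} = ygen p n"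
proof (intro equalityI subsetI)
  have mon: "zy_map p n (Poly_Mapping.single (lsum p M) 1) \<in> ygen p n" if "set_mset M \<subseteq> ss_index_set p n" for M
    using that
  proof (induction M)
    case empty
    then show ?case by (simp add: zy_map_1 ygen_1)
  next
    case (add A M)
    then have A: "A \<in> ss_index_set p n" by simp
    have "Polynomial.monom (\<Prod>q\<in>ideal_of p n A. cvar q) 1 \<in> ygen p n"
      unfolding ygen_def using ideal_of_in_finite_ideals[OF A p] by (intro subalg_gen.gen) blast
    then have "zy_map p n (Poly_Mapping.single (lmon p A) 1) \<in> ygen p n"
      by (simp only: zy_map_lmon[OF A p(1)])
    moreover have "zy_map p n (Poly_Mapping.single (lsum p M) 1) \<in> ygen p n" using add by simp
    moreover have "Poly_Mapping.single (lsum p (add_mset A M)) (1 :: complex) =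
        Poly_Mapping.single (lmon p A) 1 * Poly_Mapping.single (lsum p M) 1"
      by (simp add: mult_single)
    ultimately show ?case by (simp only: zy_map_mult ygen_mult)
  qed
  fix x assume "x \<in> zy_map p n ` {f. Poly_Mapping.keys f \<subseteq> zmons p n}"
  then obtain f where f: "Poly_Mapping.keys f \<subseteq> zmons p n" "x = zy_map p n f" by blast
  have "zy_map p n (Poly_Mapping.single m a) \<in> ygen p n" if m: "m \<in> zmons p n" for m a
  proof -
    obtain M where M: "m = lsum p M" "set_mset M \<subseteq> ss_index_set p n" using m by (auto simp: zmons_def)
    have "Poly_Mapping.single m a = cconst a * Poly_Mapping.single m 1"
      by (simp add: cconst_def mult_single)
    then show ?thesis using ygen_mult[OF ygen_scalar mon[OF M(2)]] M(1)
      by (simp only: zy_map_mult zy_map_cconst)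
  qed
  then have "(\<Sum>m\<in>Poly_Mapping.keys f. zy_map p n (Poly_Mapping.single m (lookup f m))) \<in> ygen p n"
    using f(1) by (intro ygen_sum) blast
  then show "x \<in> ygen p n" unfolding f(2) by (simp flip: zy_map_sum poly_mapping_sum_single)
next
  fix x assume "x \<in> ygen p n"
  then show "x \<in> zy_map p n ` {f. Poly_Mapping.keys f \<subseteq> zmons p n}"
    unfolding ygen_def
  proof induction
    case (scalar c)
    show ?case by (rule image_eqI[of _ _ "cconst c"]) (use zset_cconst in \<open>simp_all add: zy_map_cconst\<close>)
  next
    case (gen x)
    then obtain J where J: "x = Polynomial.monom (\<Prod>q\<in>J. cvar q) 1" "J \<in> finite_ideals p n" by blast
    obtain A where A: "A \<in> ss_index_set p n" "ideal_of p n A = J" using ideal_of_surj[OF J(2) p] by blast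
    show ?case
      by (rule image_eqI[of _ _ "Poly_Mapping.single (lmon p A) 1"])
        (simp_all add: zy_map_lmon[OF A(1) p(1)] J(1) A lmon_in_zmons)
  next
    case (add x y)
    then obtain f g where "x = zy_map p n f" "y = zy_map p n g" "Poly_Mapping.keys f \<subseteq> zmons p n" "Poly_Mapping.keys g \<subseteq> zmons p n"
      by blast
    then show ?case by (intro image_eqI[of _ _ "f + g"]) (simp_all add: zy_map_add zset_add)
  next
    case (mult x y)
    then obtain f g where "x = zy_map p n f" "y = zy_map p n g" "Poly_Mapping.keys f \<subseteq> zmons p n" "Poly_Mapping.keys g \<subseteq> zmons p n"
      by blast
    then show ?case by (intro image_eqI[of _ _ "f * g"]) (simp_all add: zy_map_mult zset_mult)
  qed
qed

lemma mdeg_zmons: "0 < p \<Longrightarrow> m \<in> zmons p n \<Longrightarrow> mdeg m = p * smap m"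
  by (auto simp: zmons_def mdeg_lsum smap_lsum)

text \<open>On \<open>zmons\<close> the total degree is p times the exponent of s, and no
  coefficient is lost in the image.\<close>

lemma zy_map_homogeneous_iff:
  assumes p: "0 < p" "p < n" and f: "Poly_Mapping.keys f \<subseteq> zmons p n"
  shows "f \<in> homogeneous_polys (p * d) \<longleftrightarrow> (\<exists>h. zy_map p n f = Polynomial.monom h d)"
proof
  assume "f \<in> homogeneous_polys (p * d)"
  then have "smap m = d" if "m \<in> Poly_Mapping.keys f" for m
    using that mdeg_zmons[OF p(1), of m n] f p(1) by (auto simp: homogeneous_polys_def)
  then have "zy_map p n f = (\<Sum>m\<in>Poly_Mapping.keys f.
      Polynomial.monom (Poly_Mapping.single (umap p n m) (lookup f m)) d)"
    unfolding zy_map_def by (intro sum.cong refl) simp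
  then show "\<exists>h. zy_map p n f = Polynomial.monom h d"
    by (auto simp flip: monom_sum)
next
  assume "\<exists>h. zy_map p n f = Polynomial.monom h d"
  then obtain h where h: "zy_map p n f = Polynomial.monom h d" ..
  have "mdeg m = p * d" if m: "m \<in> Poly_Mapping.keys f" for m
  proof -
    have mz: "m \<in> zmons p n" using m f by blast
    have "lookup (coeff (Polynomial.monom h d) (smap m)) (umap p n m) \<noteq> 0"
      using lookup_coeff_zy_map[OF p f mz] m by (simp add: h in_keys_iff)
    then have "smap m = d" by (auto split: if_splits)
    then show ?thesis using mdeg_zmons[OF p(1) mz] by simp
  qed
  then show "f \<in> homogeneous_polys (p * d)" by (simp add: homogeneous_polys_def)
qed

lemma graded_ring_iso_zy_map:
  assumes p: "0 < p" "p < n"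
  shows "graded_ring_iso (initial_plucker_alg p n) (order_polytope_alg p n) (zy_map p n)"
proof -
  define Zp :: "zvar cpoly set" where "Zp = {f. Poly_Mapping.keys f \<subseteq> zmons p n}"
  have R: "initial_plucker_alg p n = graded_subalg cconst (\<lambda>d. homogeneous_polys (p * d)) Zp"
    by (simp add: initial_plucker_alg_def initial_space_plucker[OF p] Zp_def)
  have S: "order_polytope_alg p n = graded_subalg (\<lambda>c. [:cconst c:]) (\<lambda>d. {Polynomial.monom f d |f. True}) (ygen p n)"
    by (simp add: order_polytope_alg_def ygen_def)
  show ?thesis
    unfolding R S
  proof (rule graded_ring_iso.intro)
    show "cring (graded_subalg cconst (\<lambda>d. homogeneous_polys (p * d)) Zp)"
      using zset_cconst[of 1 p n]
      by (intro cring_graded_subalg) (simp_all add: Zp_def zset_add zset_mult)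
    show "cring (graded_subalg (\<lambda>c. [:cconst c:]) (\<lambda>d. {Polynomial.monom f d |f. True}) (ygen p n))"
      by (intro cring_graded_subalg ygen_0 ygen_1 ygen_add ygen_mult ygen_minus)
    show "bij_betw (zy_map p n) (carrier (graded_subalg cconst (\<lambda>d. homogeneous_polys (p * d)) Zp))
        (carrier (graded_subalg (\<lambda>c. [:cconst c:]) (\<lambda>d. {Polynomial.monom f d |f. True}) (ygen p n)))"
      using inj_on_zy_map[OF p] zy_map_image[OF p]
      by (simp add: graded_subalg_def bij_betw_def Zp_def)
    show "zy_map p n ` hpart (graded_subalg cconst (\<lambda>d. homogeneous_polys (p * d)) Zp) d =
        hpart (graded_subalg (\<lambda>c. [:cconst c:]) (\<lambda>d. {Polynomial.monom f d |f. True}) (ygen p n)) d" for d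
    proof -
      have "zy_map p n ` (Zp \<inter> homogeneous_polys (p * d)) = ygen p n \<inter> {Polynomial.monom f d |f. True}"
      proof (intro equalityI subsetI)
        fix y assume "y \<in> zy_map p n ` (Zp \<inter> homogeneous_polys (p * d))"
        then obtain f where f: "y = zy_map p n f" "f \<in> Zp" "f \<in> homogeneous_polys (p * d)" by blast
        have "y \<in> ygen p n" unfolding f(1) zy_map_image[OF p, symmetric] using f(2) by (simp add: Zp_def)
        then show "y \<in> ygen p n \<inter> {Polynomial.monom f d |f. True}"
          using zy_map_homogeneous_iff[OF p, of f d] f by (auto simp: Zp_def)
      next
        fix y assume y: "y \<in> ygen p n \<inter> {Polynomial.monom f d |f. True}"
        then obtain f where f: "y = zy_map p n f" "f \<in> Zp"
          unfolding zy_map_image[OF p, symmetric] Zp_def by blast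
        then have "f \<in> homogeneous_polys (p * d)"
          using zy_map_homogeneous_iff[OF p, of f d] y by (auto simp: Zp_def)
        then show "y \<in> zy_map p n ` (Zp \<inter> homogeneous_polys (p * d))" using f by blast
      qed
      then show ?thesis by (simp add: graded_subalg_def)
    qed
  qed (use zset_cconst in \<open>auto simp: graded_subalg_def zy_map_add zy_map_mult zy_map_1 zy_map_cconst Zp_def\<close>)
qed

theorem theoremA:
  fixes p n :: nat
  assumes "1 \<le> p" and "p < n"
  shows "cspace_isomorphic (Proj (initial_plucker_alg p n)) (Proj (order_polytope_alg p n)) \<and>
    distributive_lattice (ss_lattice p n) \<and>
    distributive_lattice (ideal_lattice p n) \<and>
    lattice_isomorphic (ss_lattice p n) (ideal_lattice p n)"
proof (intro conjI)
  have p: "0 < p" "p < n" using assms by simp_all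
  \<comment> \<open>The induced map of Proj runs from the codomain to the domain, hence the inverse
    isomorphism.\<close>
  show "cspace_isomorphic (Proj (initial_plucker_alg p n)) (Proj (order_polytope_alg p n))"
    by (rule graded_ring_iso.cspace_isomorphic_Proj[OF graded_ring_iso.inverse[OF graded_ring_iso_zy_map[OF p]]])
  show "distributive_lattice (ss_lattice p n)"
    by (rule set_lattice.distributive[OF set_lattice_ss[OF p]])
  show "distributive_lattice (ideal_lattice p n)"
    by (rule set_lattice.distributive[OF set_lattice_ideal])
  show "lattice_isomorphic (ss_lattice p n) (ideal_lattice p n)"
    by (rule lattice_isomorphic_ss_ideal[OF p])
qed

end
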